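(* In the covariate-adaptive randomization setting described in the context, suppose that as $n\to\infty$: (A1) (global balance) $n^{-1}\sum_{i=1}^n(2T_i-1)\overset{p}{\rightarrow}0$; (A2) (covariate balance) $n^{-1/2}\sum_{i=1}^n(2T_i-1)\bm{x}_i\overset{d}{\rightarrow}\bm{\xi}$, where $\bm{\xi}$ is a $(p+q)$-dimensional random vector with $\mathbb{E}[\bm{\xi}]=\bm{0}$. Let $\bm{\xi}_{\mathrm{ex}}$ denote the last $q$ coordinates of $\bm{\xi}$, let $Z$ be a standard normal random variable independent of $\bm{\xi}_{\mathrm{ex}}$, and put $\lambda_1=\sigma_\epsilon/\sigma_w$, $\lambda_2=1/\sigma_w$. 1. If $\mu_1-\mu_2=0$, then $S\overset{d}{\rightarrow}\lambda_1Z+\lambda_2\bm{\beta}_{\mathrm{ex}}^t\bm{\xi}_{\mathrm{ex}}$. 2. Under the sequence of local alternatives $\mu_1-\mu_2=\delta/\sqrt{n}$ for a fixed $\delta\ne0$, $S\overset{d}{\rightarrow}\lambda_1Z+\lambda_2\bm{\beta}_{\mathrm{ex}}^t\bm{\xi}_{\mathrm{ex}}+\lambda_2\delta/2$.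
   Context: Setting. Fix integers $p,q\ge 0$. For each $n$ there are $n$ units; $T_i\in\{0,1\}$ is the treatment assignment of unit $i$ ($T_i=1$ for treatment 1, $T_i=0$ for treatment 2), possibly depending on $n$, and $\bm{x}_i=(x_{i,1},\dots,x_{i,p+q})^t$ is its covariate vector. The vectors $\bm{x}_i$ are i.i.d. over $i$; $x_{i,j}$ is distributed as $X_j$, the covariates $X_1,\dots,X_{p+q}$ are independent of each other, with $\mathbb{E}X_j=0$ and $0<\mathrm{Var}(X_j)<\infty$. The outcomes follow the true linear model $$Y_i=\mu_1T_i+\mu_2(1-T_i)+\sum_{j=1}^{p+q}\beta_jx_{i,j}+\epsilon_i,$$ where $\epsilon_1,\dots,\epsilon_n$ are i.i.d. with mean $0$ and variance $\sigma_\epsilon^2\in(0,\infty)$, independent of the covariates. The randomization uses only covariate information (and possibly extra external randomness), not the responses: $(T_1,\dots,T_n)$ and all covariates are jointly independent of $(\epsilon_1,\dots,\epsilon_n)$. Working model. Only the first $p$ covariates are included: $\mathbb{E}[Y_i]=\mu_1T_i+\mu_2(1-T_i)+\sum_{j=1}^p\beta_jx_{i,j}$. Write $\bm{Y}=(Y_1,\dots,Y_n)^t$, $\bm{T}=(T_1,\dots,T_n)^t$, $\mathbf{X}_{\mathrm{in}}=(x_{i,j})_{1\le i\le n,1\le j\le p}$, $\bm{\beta}_{\mathrm{in}}=(\beta_1,\dots,\beta_p)^t$, $\bm{\beta}_{\mathrm{ex}}=(\beta_{p+1},\dots,\beta_{p+q})^t$, $\bm{1}_n$ the vector of $n$ ones,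 $\mathbf{G}=[\bm{T};\bm{1}_n-\bm{T};\mathbf{X}_{\mathrm{in}}]$ (an $n\times(p+2)$ matrix, columns juxtaposed), and $\bm{\theta}=(\mu_1,\mu_2,\bm{\beta}_{\mathrm{in}}^t)^t$. The OLS estimator is $\hat{\bm{\theta}}=(\mathbf{G}^t\mathbf{G})^{-1}\mathbf{G}^t\bm{Y}$ (defined arbitrarily when $\mathbf{G}^t\mathbf{G}$ is singular). Test statistic for the treatment effect ($H_0:\mu_1-\mu_2=0$ versus $H_1:\mu_1-\mu_2\neq0$): $$S=\frac{\bm{L}^t\hat{\bm{\theta}}}{\sqrt{\hat\sigma_w^2\,\bm{L}^t(\mathbf{G}^t\mathbf{G})^{-1}\bm{L}}},\qquad \bm{L}=(1,-1,0,\dots,0)^t\in\mathbb{R}^{p+2},\qquad \hat\sigma_w^2=\frac{\Vert\bm{Y}-\mathbf{G}\hat{\bm{\theta}}\Vert^2}{n-p-2}.$$ Also $\sigma_w^2=\sigma_\epsilon^2+\sum_{j=1}^q\beta_{p+j}^2\mathrm{Var}(X_{p+j})$. *)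

theory Defs
  imports "HOL-Probability.Probability" "Jordan_Normal_Form.Gauss_Jordan_Elimination"
begin

text \<open>
  Units and covariates are numbered from 0: the units of the \<open>n\<close>-th experiment are \<open>i < n\<close>,
  covariates \<open>j < p\<close> are in the working model and covariates \<open>p \<le> j < p + q\<close> are not.
  Since \<open>p\<close> and \<open>q\<close> are arbitrary (possibly 0), a random vector with index set \<open>I\<close> is
  represented by the extensional function \<open>\<lambda>j\<in>I. X j \<omega>\<close>, an element of the
  product space \<open>real_vec_space I\<close>.
\<close>

abbreviation real_vec_space :: "'i set \<Rightarrow> ('i \<Rightarrow> real) measure" where
  "real_vec_space I \<equiv> PiM I (\<lambda>_. borel)"

abbreviation random_vec :: "'i set \<Rightarrow> ('i \<Rightarrow> 'w \<Rightarrow> real) \<Rightarrow> 'w \<Rightarrow> 'i \<Rightarrow> real" where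
  "random_vec I X \<equiv> (\<lambda>\<omega>. \<lambda>j\<in>I. X j \<omega>)"

text \<open>
  Weak convergence of distributions on \<open>real_vec_space I\<close>, tested against the bounded continuous
  functions; for finite \<open>I\<close> the product topology is the Euclidean one.  For distributions
  on the real line the library's \<^const>\<open>weak_conv_m\<close> is used instead.
\<close>

definition weak_conv_vec :: "'i set \<Rightarrow> (nat \<Rightarrow> ('i \<Rightarrow> real) measure) \<Rightarrow> ('i \<Rightarrow> real) measure \<Rightarrow> bool" where
  "weak_conv_vec I D_seq D \<longleftrightarrow>
    (\<forall>f :: ('i \<Rightarrow> real) \<Rightarrow> real.
       continuous_map (product_topology (\<lambda>_. euclideanreal) I) euclideanreal f \<longrightarrow>
       bounded (f ` topspace (product_topology (\<lambda>_. euclideanreal) I)) \<longrightarrow>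
       (\<lambda>n. integral\<^sup>L (D_seq n) f) \<longlonglongrightarrow> integral\<^sup>L D f)"

text \<open>
  \<open>prob_space.indep_var\<close> for two random variables whose values may have different types.
\<close>

definition indep_rv ::
  "'w measure \<Rightarrow> 'a measure \<Rightarrow> ('w \<Rightarrow> 'a) \<Rightarrow> 'b measure \<Rightarrow> ('w \<Rightarrow> 'b) \<Rightarrow> bool" where
  "indep_rv M A U B V \<longleftrightarrow>
     U \<in> measurable M A \<and> V \<in> measurable M B \<and>
     prob_space.indep_set M {U -` E \<inter> space M | E. E \<in> sets A} {V -` E \<inter> space M | E. E \<in> sets B}"

definition conv_in_prob :: "'w measure \<Rightarrow> (nat \<Rightarrow> 'w \<Rightarrow> real) \<Rightarrow> real \<Rightarrow> bool" where
  "conv_in_prob M X c \<longleftrightarrow>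
    (\<forall>e>0. (\<lambda>n. measure M {\<omega> \<in> space M. \<bar>X n \<omega> - c\<bar> > e}) \<longlonglongrightarrow> 0)"

definition outcome ::
  "real \<Rightarrow> real \<Rightarrow> (nat \<Rightarrow> real) \<Rightarrow> nat \<Rightarrow> real \<Rightarrow> (nat \<Rightarrow> real) \<Rightarrow> real \<Rightarrow> real" where
  "outcome mu1 mu2 \<beta> d t x e = mu1 * t + mu2 * (1 - t) + (\<Sum>j<d. \<beta> j * x j) + e"

definition design_matrix :: "nat \<Rightarrow> nat \<Rightarrow> (nat \<Rightarrow> real) \<Rightarrow> (nat \<Rightarrow> nat \<Rightarrow> real) \<Rightarrow> real mat" where
  "design_matrix n p t x = Matrix.mat n (p + 2)
     (\<lambda>(i, k). if k = 0 then t i else if k = 1 then 1 - t i else x i (k - 2))"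

definition gram :: "real mat \<Rightarrow> real mat" where
  "gram G = transpose_mat G * G"

text \<open>
  \<open>gram_inverse\<close>, and what is defined from it, is meaningful only if \<open>invertible_mat (gram G)\<close>;
  otherwise \<^const>\<open>mat_inverse\<close> returns \<^const>\<open>None\<close>.
\<close>

definition gram_inverse :: "real mat \<Rightarrow> real mat" where
  "gram_inverse G = the (mat_inverse (gram G))"

definition ols :: "real mat \<Rightarrow> real Matrix.vec \<Rightarrow> real Matrix.vec" where
  "ols G y = (gram_inverse G * transpose_mat G) *\<^sub>v y"

definition residual_variance :: "real mat \<Rightarrow> real Matrix.vec \<Rightarrow> real" where
  "residual_variance G y =
     (let r = y - G *\<^sub>v ols G y
      in scalar_prod r r / (real (dim_row G) - real (dim_col G)))"

definition contrast :: "nat \<Rightarrow> real Matrix.vec" where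
  "contrast m = Matrix.vec m (\<lambda>k. if k = 0 then 1 else if k = 1 then -1 else 0)"

definition test_stat :: "real mat \<Rightarrow> real Matrix.vec \<Rightarrow> real" where
  "test_stat G y =
     (let L = contrast (dim_col G)
      in scalar_prod L (ols G y) /
         sqrt (residual_variance G y * scalar_prod L (gram_inverse G *\<^sub>v L)))"

end

theory Submission
  imports Defs "Jordan_Normal_Form.Determinant"
begin

text \<open>
  With \<open>w\<close> the vector of \<open>w\<^sub>i = (\<Sum>j\<ge>p. \<beta>\<^sub>j x\<^sub>i\<^sub>j) + \<epsilon>\<^sub>i\<close>, the estimation error is
  \<open>(G\<^sup>t G)\<^sup>-\<^sup>1 G\<^sup>t w\<close>.  Balance and the law of large numbers make \<open>G\<^sup>t G / n\<close> converge in
  probability to a diagonal matrix with leading entries 1/2, 1/2, while \<open>G\<^sup>t w / \<surd>n\<close> is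
  bounded in probability and the residual variance tends to \<open>\<sigma>\<^sub>w\<^sup>2\<close>.  Hence, up to a term that
  tends to 0 in probability, the statistic is the sum of \<open>\<delta> / (2 \<sigma>\<^sub>w)\<close> and of
  \<open>\<Sum>\<^sub>i (2 T\<^sub>i - 1) w\<^sub>i / (\<sigma>\<^sub>w \<surd>n)\<close>.
  Conditionally on the design, the error part of the latter is a signed sum of i.i.d. variables,
  whose characteristic function tends to the Gaussian one uniformly in the signs; this yields the
  independent normal component of the limit, and Levy's continuity theorem concludes.
\<close>

section \<open>Convergence in probability as a filter\<close>

text \<open>The assignments may depend on all covariates at once, so the treated units are not an
  independent sample and no i.i.d. central limit theorem applies to the signed sum of the
  \<open>w\<^sub>i\<close>. Only the errors are independent of the design; the covariate part of the
  sum has a limit solely by (A2), and that limit need not be normal. Hence the errors are integrated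
  out with the design fixed, and the covariate part passes through as a factor of modulus one whose
  expectation is known to converge. The 1/2 beside \<delta> stems from the 1/2 in the Gram limit.
  Its inverse has leading entries 2, so the numerator is close to \<delta> plus twice the signed
  noise, while the denominator tends to twice \<open>\<sigma>\<^sub>w\<close>: the 2 cancels for the
  noise but not for \<delta>. Since only second moments are available, averages of squares call for
  a weak law with merely integrable summands. Singular Gram matrices form an event of vanishing
  probability, which the filter absorbs.\<close>

text \<open>
  With this filter on pairs of an index and an outcome, convergence in probability is
  \<^const>\<open>tendsto\<close>, so that the limit calculus of the library, continuous mappings
  included, applies to it.
\<close>

definition in_probability :: "'w measure \<Rightarrow> (nat \<times> 'w) filter" where
  "in_probability M = Abs_filter (\<lambda>Q. \<forall>\<eta>>0. \<forall>\<^sub>F n in sequentially.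
     \<exists>A\<in>sets M. measure M A \<le> \<eta> \<and> (\<forall>\<omega>\<in>space M - A. Q (n, \<omega>)))"

text \<open>The exceptional set is covered by a measurable \<open>A\<close> instead of being
  measured itself, so \<open>Q\<close> may be any predicate, measurable or not. The only filter
  axiom with content is the conjunction, where each property receives half of
  \<open>\<eta>\<close>.\<close>

lemma (in prob_space) eventually_in_probability:
  "eventually Q (in_probability M) \<longleftrightarrow> (\<forall>\<eta>>0. \<forall>\<^sub>F n in sequentially.
     \<exists>A\<in>sets M. prob A \<le> \<eta> \<and> (\<forall>\<omega>\<in>space M - A. Q (n, \<omega>)))"
  unfolding in_probability_def
proof (rule eventually_Abs_filter, rule is_filter.intro)
  show "\<forall>\<eta>>0. \<forall>\<^sub>F n in sequentially.
     \<exists>A\<in>sets M. prob A \<le> \<eta> \<and> (\<forall>\<omega>\<in>space M - A. True)"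
    by (auto intro!: always_eventually bexI[of _ "{}"])
next
  fix Q R :: "nat \<times> 'a \<Rightarrow> bool"
  assume Q: "\<forall>\<eta>>0. \<forall>\<^sub>F n in sequentially.
      \<exists>A\<in>sets M. prob A \<le> \<eta> \<and> (\<forall>\<omega>\<in>space M - A. Q (n, \<omega>))"
    and R: "\<forall>\<eta>>0. \<forall>\<^sub>F n in sequentially.
      \<exists>A\<in>sets M. prob A \<le> \<eta> \<and> (\<forall>\<omega>\<in>space M - A. R (n, \<omega>))"
  show "\<forall>\<eta>>0. \<forall>\<^sub>F n in sequentially.
     \<exists>A\<in>sets M. prob A \<le> \<eta> \<and> (\<forall>\<omega>\<in>space M - A. Q (n, \<omega>) \<and> R (n, \<omega>))"
  proof (intro allI impI)
    fix \<eta> :: real assume "\<eta> > 0"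
    then have h: "\<eta> / 2 > 0" by simp
    show "\<forall>\<^sub>F n in sequentially.
       \<exists>A\<in>sets M. prob A \<le> \<eta> \<and> (\<forall>\<omega>\<in>space M - A. Q (n, \<omega>) \<and> R (n, \<omega>))"
      using Q[rule_format, OF h] R[rule_format, OF h]
    proof eventually_elim
      case (elim n)
      then obtain A B where AB: "A \<in> sets M" "prob A \<le> \<eta> / 2" "\<forall>\<omega>\<in>space M - A. Q (n, \<omega>)"
        "B \<in> sets M" "prob B \<le> \<eta> / 2" "\<forall>\<omega>\<in>space M - B. R (n, \<omega>)" by blast
      have "prob (A \<union> B) \<le> \<eta>"
        using measure_Un_le[of A M B] AB by simp
      with AB show ?case by (intro bexI[of _ "A \<union> B"]) auto
    qed
  qed
next
  fix Q R :: "nat \<times> 'a \<Rightarrow> bool"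
  assume imp: "\<forall>z. Q z \<longrightarrow> R z" and Q: "\<forall>\<eta>>0. \<forall>\<^sub>F n in sequentially.
      \<exists>A\<in>sets M. prob A \<le> \<eta> \<and> (\<forall>\<omega>\<in>space M - A. Q (n, \<omega>))"
  show "\<forall>\<eta>>0. \<forall>\<^sub>F n in sequentially.
     \<exists>A\<in>sets M. prob A \<le> \<eta> \<and> (\<forall>\<omega>\<in>space M - A. R (n, \<omega>))"
  proof (intro allI impI)
    fix \<eta> :: real assume "\<eta> > 0"
    from Q[rule_format, OF this]
    show "\<forall>\<^sub>F n in sequentially. \<exists>A\<in>sets M. prob A \<le> \<eta> \<and> (\<forall>\<omega>\<in>space M - A. R (n, \<omega>))"
      by eventually_elim (use imp in blast)
  qed
qed

lemma (in prob_space) eventually_in_probabilityI: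
  assumes "\<And>\<eta>. \<eta> > 0 \<Longrightarrow> \<forall>\<^sub>F n in sequentially.
     \<exists>A\<in>sets M. prob A \<le> \<eta> \<and> (\<forall>\<omega>\<in>space M - A. Q (n, \<omega>))"
  shows "eventually Q (in_probability M)"
  using assms by (simp add: eventually_in_probability)

text \<open>Through this, deterministic limits in the sample size become limits in probability; the
  exceptional set is empty.\<close>

lemma (in prob_space) filterlim_fst_in_probability:
  "filterlim fst sequentially (in_probability M)"
  unfolding filterlim_iff
proof (intro allI impI eventually_in_probabilityI)
  fix Q and \<eta> :: real assume "eventually Q sequentially" "\<eta> > 0"
  then show "\<forall>\<^sub>F n in sequentially. \<exists>A\<in>sets M. prob A \<le> \<eta> \<and> (\<forall>\<omega>\<in>space M - A. Q (fst (n, \<omega>)))"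
    by (auto elim!: eventually_mono intro!: bexI[of _ "{}"])
qed

text \<open>The hypotheses on \<open>T\<close> and \<open>S\<close> hold only on
  \<open>space M\<close>; this lets pointwise arguments along the filter invoke them.\<close>

lemma (in prob_space) eventually_snd_in_space: "\<forall>\<^sub>F z in in_probability M. snd z \<in> space M"
  by (rule eventually_in_probabilityI) (auto intro!: always_eventually bexI[of _ "{}"])

lemma (in prob_space) tendsto_in_probabilityI:
  fixes X :: "nat \<Rightarrow> 'a \<Rightarrow> real"
  assumes [measurable]: "\<And>n. X n \<in> borel_measurable M"
    and lim: "\<And>e \<eta>. e > 0 \<Longrightarrow> \<eta> > 0 \<Longrightarrow>
      \<forall>\<^sub>F n in sequentially. prob {\<omega>\<in>space M. \<bar>X n \<omega> - c\<bar> \<ge> e} \<le> \<eta>"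
  shows "((\<lambda>z. X (fst z) (snd z)) \<longlongrightarrow> c) (in_probability M)"
proof (rule tendstoI, rule eventually_in_probabilityI)
  fix e \<eta> :: real assume "e > 0" "\<eta> > 0"
  from lim[OF this]
  show "\<forall>\<^sub>F n in sequentially. \<exists>A\<in>sets M. prob A \<le> \<eta> \<and>
      (\<forall>\<omega>\<in>space M - A. dist (X (fst (n, \<omega>)) (snd (n, \<omega>))) c < e)"
  proof eventually_elim
    case (elim n)
    show ?case
      by (rule bexI[of _ "{\<omega>\<in>space M. \<bar>X n \<omega> - c\<bar> \<ge> e}"])
        (use elim in \<open>auto simp: dist_real_def not_le\<close>)
  qed
qed

lemma (in prob_space) conv_in_prob_imp_tendsto:
  assumes [measurable]: "\<And>n. X n \<in> borel_measurable M" and conv: "conv_in_prob M X c"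
  shows "((\<lambda>z. X (fst z) (snd z)) \<longlongrightarrow> c) (in_probability M)"
proof (rule tendsto_in_probabilityI)
  fix e \<eta> :: real assume e: "e > 0" "\<eta> > 0"
  \<comment> \<open>Halving \<open>e\<close> bridges the strict inequality in
    \<open>conv_in_prob\<close> and the non-strict one required here.\<close>
  have "(\<lambda>n. prob {\<omega>\<in>space M. \<bar>X n \<omega> - c\<bar> > e / 2}) \<longlonglongrightarrow> 0"
    using conv half_gt_zero[OF e(1)] unfolding conv_in_prob_def by blast
  from order_tendstoD(2)[OF this e(2)]
  show "\<forall>\<^sub>F n in sequentially. prob {\<omega>\<in>space M. \<bar>X n \<omega> - c\<bar> \<ge> e} \<le> \<eta>"
  proof eventually_elim
    case (elim n)
    have "prob {\<omega>\<in>space M. \<bar>X n \<omega> - c\<bar> \<ge> e} \<le> prob {\<omega>\<in>space M. \<bar>X n \<omega> - c\<bar> > e / 2}"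
      using e by (intro finite_measure_mono) auto
    with elim show ?case by simp
  qed
qed simp

section \<open>Boundedness in probability\<close>

text \<open>Boundedness in probability is encoded by its use: multiplying by \<open>Y\<close>
  preserves null sequences. Closure under sums and multiples is then inherited from
  \<open>tendsto\<close>, with no tightness constants to track.\<close>

definition stochastically_bounded :: "'w measure \<Rightarrow> (nat \<times> 'w \<Rightarrow> real) \<Rightarrow> bool" where
  "stochastically_bounded M Y \<longleftrightarrow>
     (\<forall>X. (X \<longlongrightarrow> 0) (in_probability M) \<longrightarrow> ((\<lambda>z. X z * Y z) \<longlongrightarrow> 0) (in_probability M))"

lemma stochastically_boundedD:
  assumes "stochastically_bounded M Y" "(X \<longlongrightarrow> 0) (in_probability M)"
  shows "((\<lambda>z. X z * Y z) \<longlongrightarrow> 0) (in_probability M)"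
  using assms by (auto simp: stochastically_bounded_def)

lemma stochastically_bounded_const: "stochastically_bounded M (\<lambda>z. a)"
  by (auto simp: stochastically_bounded_def intro!: tendsto_mult_left_zero)

lemma stochastically_bounded_add:
  assumes "stochastically_bounded M Y" "stochastically_bounded M Y'"
  shows "stochastically_bounded M (\<lambda>z. Y z + Y' z)"
  using assms by (auto simp: stochastically_bounded_def distrib_left intro!: tendsto_add_zero)

lemma stochastically_bounded_cmult:
  assumes "stochastically_bounded M Y"
  shows "stochastically_bounded M (\<lambda>z. a * Y z)"
  using assms
  by (auto simp: stochastically_bounded_def mult.left_commute intro!: tendsto_mult_right_zero)

lemma stochastically_bounded_sum:
  assumes "\<And>k. k \<in> A \<Longrightarrow> stochastically_bounded M (Y k)"
  shows "stochastically_bounded M (\<lambda>z. \<Sum>k\<in>A. Y k z)"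
  using assms by (auto simp: stochastically_bounded_def sum_distrib_left intro!: tendsto_null_sum)

lemma (in prob_space) stochastically_boundedI:
  assumes [measurable]: "\<And>n. Y n \<in> borel_measurable M"
    and tight: "\<And>\<eta>. \<eta> > 0 \<Longrightarrow>
      \<exists>K. \<forall>\<^sub>F n in sequentially. prob {\<omega>\<in>space M. \<bar>Y n \<omega>\<bar> > K} \<le> \<eta>"
  shows "stochastically_bounded M (\<lambda>z. Y (fst z) (snd z))"
  unfolding stochastically_bounded_def
proof (intro allI impI tendstoI eventually_in_probabilityI)
  fix X :: "nat \<times> 'a \<Rightarrow> real" and e \<eta> :: real
  assume X: "(X \<longlongrightarrow> 0) (in_probability M)" and e: "e > 0" "\<eta> > 0"
  obtain K where K: "\<forall>\<^sub>F n in sequentially. prob {\<omega>\<in>space M. \<bar>Y n \<omega>\<bar> > K} \<le> \<eta> / 2"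
    using tight[of "\<eta> / 2"] e by auto
  \<comment> \<open>Off the tail event \<open>Y\<close> is below \<open>\<bar>K\<bar> + 1\<close> in
    absolute value, which is positive whatever the sign of \<open>K\<close>.\<close>
  have "e / (\<bar>K\<bar> + 1) > 0" using e by simp
  from tendstoD[OF X this] have "\<forall>\<^sub>F n in sequentially. \<exists>A\<in>sets M. prob A \<le> \<eta> / 2 \<and>
      (\<forall>\<omega>\<in>space M - A. dist (X (n, \<omega>)) 0 < e / (\<bar>K\<bar> + 1))"
    using e unfolding eventually_in_probability by (auto dest!: spec[of _ "\<eta> / 2"])
  with K show "\<forall>\<^sub>F n in sequentially. \<exists>A\<in>sets M. prob A \<le> \<eta> \<and>
      (\<forall>\<omega>\<in>space M - A. dist (X (n, \<omega>) * Y (fst (n, \<omega>)) (snd (n, \<omega>))) 0 < e)"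
  proof eventually_elim
    case (elim n)
    then obtain A where A: "A \<in> sets M" "prob A \<le> \<eta> / 2"
      "\<And>\<omega>. \<omega>\<in>space M - A \<Longrightarrow> \<bar>X (n, \<omega>)\<bar> < e / (\<bar>K\<bar> + 1)" by auto
    let ?B = "{\<omega>\<in>space M. \<bar>Y n \<omega>\<bar> > K}"
    have B: "?B \<in> sets M" by measurable
    have "prob (A \<union> ?B) \<le> \<eta>"
      using measure_Un_le[OF A(1) B] A elim by simp
    moreover have "\<bar>X (n, \<omega>) * Y n \<omega>\<bar> < e" if "\<omega> \<in> space M - (A \<union> ?B)" for \<omega>
    proof -
      have "\<bar>Y n \<omega>\<bar> < \<bar>K\<bar> + 1" using that by auto
      then have "\<bar>X (n, \<omega>)\<bar> * \<bar>Y n \<omega>\<bar> < e / (\<bar>K\<bar> + 1) * (\<bar>K\<bar> + 1)"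
        using A(3)[of \<omega>] that by (intro mult_strict_mono') auto
      also have "\<dots> = e" by (simp add: add_nonneg_eq_0_iff)
      finally show ?thesis by (simp add: abs_mult)
    qed
    ultimately show ?case using A B by (intro bexI[of _ "A \<union> ?B"]) auto
  qed
qed

lemma (in prob_space) stochastically_bounded_second_moment:
  fixes Y :: "nat \<Rightarrow> 'a \<Rightarrow> real"
  assumes [measurable]: "\<And>n. Y n \<in> borel_measurable M"
    and int: "\<And>n. integrable M (\<lambda>\<omega>. (Y n \<omega>)\<^sup>2)"
    and C: "\<And>n. expectation (\<lambda>\<omega>. (Y n \<omega>)\<^sup>2) \<le> C"
  shows "stochastically_bounded M (\<lambda>z. Y (fst z) (snd z))"
proof (rule stochastically_boundedI)
  fix \<eta> :: real assume eta: "\<eta> > 0"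
  have "0 \<le> expectation (\<lambda>\<omega>. (Y 0 \<omega>)\<^sup>2)" by simp
  also note C[of 0]
  finally have "0 \<le> C" .
  \<comment> \<open>Chosen so that Chebyshev's inequality gives exactly \<open>\<eta>\<close>; the
    \<open>+ 1\<close> keeps \<open>K\<close> positive when \<open>C = 0\<close>.\<close>
  define K where "K = sqrt ((C + 1) / \<eta>)"
  have K: "K > 0" "K\<^sup>2 = (C + 1) / \<eta>" using eta \<open>0 \<le> C\<close> by (auto simp: K_def)
  have bound: "prob {\<omega>\<in>space M. \<bar>Y n \<omega>\<bar> > K} \<le> \<eta>" for n
  proof -
    have "prob {\<omega>\<in>space M. \<bar>Y n \<omega>\<bar> > K} \<le> prob {\<omega>\<in>space M. (Y n \<omega>)\<^sup>2 \<ge> K\<^sup>2}"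
      using K(1) by (intro finite_measure_mono) (auto simp: abs_le_square_iff[symmetric])
    also have "\<dots> \<le> expectation (\<lambda>\<omega>. (Y n \<omega>)\<^sup>2) / K\<^sup>2"
      using K(1) by (intro integral_Markov_inequality_measure[OF int, where A="{}"]) auto
    also have "\<dots> \<le> (C + 1) / K\<^sup>2"
      using C[of n] by (intro divide_right_mono) auto
    also have "\<dots> = \<eta>" using K eta \<open>0 \<le> C\<close> by simp
    finally show ?thesis .
  qed
  show "\<exists>K. \<forall>\<^sub>F n in sequentially. prob {\<omega>\<in>space M. \<bar>Y n \<omega>\<bar> > K} \<le> \<eta>"
    using bound by (intro exI[of _ K] always_eventually allI)
qed simp

text \<open>The spare factor \<open>1 / sqrt n\<close> is a deterministic null sequence. This
  disposes of the treatment-covariate entries of the Gram matrix, of the covariate-error cross terms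
  and of the score vector divided by \<open>n\<close>.\<close>

lemma (in prob_space) stochastically_bounded_over_sqrt:
  assumes "stochastically_bounded M (\<lambda>z. Y z / sqrt (real (fst z)))"
  shows "((\<lambda>z. Y z / real (fst z)) \<longlongrightarrow> 0) (in_probability M)"
proof -
  have "(\<lambda>n. 1 / sqrt (real n)) \<longlonglongrightarrow> 0" by real_asymp
  from stochastically_boundedD[OF assms filterlim_compose[OF this filterlim_fst_in_probability]]
  show ?thesis
    by (simp add: divide_divide_eq_left mult.commute flip: real_sqrt_mult)
qed

text \<open>Slutsky's lemma for characteristic functions: \<open>iexp\<close> is Lipschitz, which
  settles the event where the variables are close, and bounded, which settles the exceptional
  event.\<close>

lemma (in prob_space) char_tendsto_of_diff_in_probability:
  assumes [measurable]: "\<And>n. S n \<in> borel_measurable M" "\<And>n. S' n \<in> borel_measurable M"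
    and diff: "((\<lambda>z. S (fst z) (snd z) - S' (fst z) (snd z)) \<longlongrightarrow> 0) (in_probability M)"
    and lim: "(\<lambda>n. char (distr M borel (S' n)) t) \<longlonglongrightarrow> c"
  shows "(\<lambda>n. char (distr M borel (S n)) t) \<longlonglongrightarrow> c"
proof -
  have "(\<lambda>n. char (distr M borel (S n)) t - char (distr M borel (S' n)) t) \<longlonglongrightarrow> 0"
  proof (rule tendstoI)
    fix e :: real assume e: "e > 0"
    \<comment> \<open>Off the exceptional set the integrand is at most
      \<open>\<bar>t\<bar> * h \<le> e / 2\<close>; on it, at most 2, against a probability of at
      most \<open>e / 8\<close>. The \<open>+ 1\<close> admits \<open>t = 0\<close>.\<close>
    define h where "h = e / (2 * (\<bar>t\<bar> + 1))"
    have h: "h > 0" using e by (simp add: h_def)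
    have th: "\<bar>t\<bar> * h \<le> e / 2" using e by (simp add: h_def field_simps)
    have "\<forall>\<^sub>F n in sequentially. \<exists>A\<in>sets M. prob A \<le> e / 8 \<and>
        (\<forall>\<omega>\<in>space M - A. dist (S (fst (n, \<omega>)) (snd (n, \<omega>)) - S' (fst (n, \<omega>)) (snd (n, \<omega>))) 0 < h)"
      using tendstoD[OF diff h] e unfolding eventually_in_probability
      by (auto dest!: spec[of _ "e / 8"])
    then show "\<forall>\<^sub>F n in sequentially.
        dist (char (distr M borel (S n)) t - char (distr M borel (S' n)) t) 0 < e"
    proof eventually_elim
      case (elim n)
      then obtain A where A[measurable]: "A \<in> sets M" and PA: "prob A \<le> e / 8"
        and AS: "\<And>\<omega>. \<omega>\<in>space M - A \<Longrightarrow> \<bar>S n \<omega> - S' n \<omega>\<bar> < h"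
        by auto
      have [simp]: "integrable M (\<lambda>\<omega>. iexp (t * S n \<omega>))" "integrable M (\<lambda>\<omega>. iexp (t * S' n \<omega>))"
        by (auto intro!: integrable_iexp)
      have "char (distr M borel (S n)) t - char (distr M borel (S' n)) t
          = expectation (\<lambda>\<omega>. iexp (t * S n \<omega>) - iexp (t * S' n \<omega>))"
        unfolding char_def
        by (subst Bochner_Integration.integral_diff) (simp_all add: integral_distr del: of_real_mult)
      also have "norm \<dots> \<le> expectation (\<lambda>\<omega>. norm (iexp (t * S n \<omega>) - iexp (t * S' n \<omega>)))"
        by (rule integral_norm_bound)
      also have "\<dots> \<le> expectation (\<lambda>\<omega>. \<bar>t\<bar> * h + 2 * indicator A \<omega>)"
      proof (rule integral_mono)
        fix \<omega> assume w: "\<omega> \<in> space M"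
        have *: "norm (iexp (t * S n \<omega>) - iexp (t * S' n \<omega>)) \<le> \<bar>t\<bar> * \<bar>S n \<omega> - S' n \<omega>\<bar>"
        proof -
          have "iexp (t * S n \<omega>) - iexp (t * S' n \<omega>)
              = iexp (t * S' n \<omega>) * (iexp (t * (S n \<omega> - S' n \<omega>)) - 1)"
            by (simp add: algebra_simps flip: exp_add)
          also have "norm \<dots> = norm (iexp (t * (S n \<omega> - S' n \<omega>)) - 1)"
            by (simp add: norm_mult)
          also have "\<dots> \<le> \<bar>t * (S n \<omega> - S' n \<omega>)\<bar>"
            using iexp_approx1[of "t * (S n \<omega> - S' n \<omega>)" 0] by simp
          finally show ?thesis by (simp add: abs_mult)
        qed
        have **: "norm (iexp (t * S n \<omega>) - iexp (t * S' n \<omega>)) \<le> 2"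
          by (rule order_trans[OF norm_triangle_ineq4]) simp
        show "norm (iexp (t * S n \<omega>) - iexp (t * S' n \<omega>)) \<le> \<bar>t\<bar> * h + 2 * indicator A \<omega>"
        proof (cases "\<omega> \<in> A")
          case True
          then show ?thesis using ** h by (simp add: add.commute add_increasing2)
        next
          case False
          with AS[of \<omega>] w have "\<bar>t\<bar> * \<bar>S n \<omega> - S' n \<omega>\<bar> \<le> \<bar>t\<bar> * h"
            by (intro mult_left_mono) auto
          with * False show ?thesis by simp
        qed
      qed (auto intro!: integrable_norm Bochner_Integration.integrable_diff
          simp: emeasure_eq_measure simp del: of_real_mult)
      also have "\<dots> = \<bar>t\<bar> * h + 2 * prob A"
        by (subst Bochner_Integration.integral_add)
          (auto intro!: integrable_real_indicator simp: emeasure_eq_measure prob_space)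
      also have "\<dots> < e" using th PA e by simp
      finally show ?case by simp
    qed
  qed
  from tendsto_add[OF this lim] show ?thesis by simp
qed

section \<open>Laws of large numbers\<close>

lemma integrable_mult_of_square_integrable:
  fixes f g :: "'a \<Rightarrow> real"
  assumes [measurable]: "f \<in> borel_measurable M" "g \<in> borel_measurable M"
    and "integrable M (\<lambda>\<omega>. (f \<omega>)\<^sup>2)" "integrable M (\<lambda>\<omega>. (g \<omega>)\<^sup>2)"
  shows "integrable M (\<lambda>\<omega>. f \<omega> * g \<omega>)"
proof (rule Bochner_Integration.integrable_bound)
  show "integrable M (\<lambda>\<omega>. (f \<omega>)\<^sup>2 + (g \<omega>)\<^sup>2)" using assms by simp
  have "\<bar>a * b\<bar> \<le> a\<^sup>2 + b\<^sup>2" for a b :: real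
  proof -
    have "2 * \<bar>a * b\<bar> \<le> a\<^sup>2 + b\<^sup>2" using sum_squares_bound[of "\<bar>a\<bar>" "\<bar>b\<bar>"] by (simp add: abs_mult)
    then show ?thesis using abs_ge_zero[of "a * b"] by linarith
  qed
  then show "AE \<omega> in M. norm (f \<omega> * g \<omega>) \<le> norm ((f \<omega>)\<^sup>2 + (g \<omega>)\<^sup>2)" by simp
qed simp

lemma (in prob_space) indep_vars_integral_mult:
  fixes X :: "'i \<Rightarrow> 'a \<Rightarrow> real"
  assumes "indep_vars (\<lambda>_. borel) X I" "i \<in> I" "j \<in> I" "i \<noteq> j"
    and "integrable M (X i)" "integrable M (X j)"
  shows "expectation (\<lambda>\<omega>. X i \<omega> * X j \<omega>) = expectation (X i) * expectation (X j)"
    and "integrable M (\<lambda>\<omega>. X i \<omega> * X j \<omega>)"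
proof -
  have "indep_vars (\<lambda>_. borel) X {i, j}"
    by (rule indep_vars_subset[OF assms(1)]) (use assms in auto)
  from indep_vars_lebesgue_integral[OF _ this] indep_vars_integrable[OF _ this]
  show "expectation (\<lambda>\<omega>. X i \<omega> * X j \<omega>) = expectation (X i) * expectation (X j)"
    and "integrable M (\<lambda>\<omega>. X i \<omega> * X j \<omega>)"
    using assms by auto
qed

text \<open>Orthogonality is assumed in place of independence because some summands used later
  contain the assignments \<open>T\<close>, which may be dependent across units.\<close>

lemma (in prob_space) expectation_square_sum_orthogonal:
  fixes Z :: "nat \<Rightarrow> 'a \<Rightarrow> real"
  assumes [measurable]: "\<And>i. i < n \<Longrightarrow> Z i \<in> borel_measurable M"
    and sq: "\<And>i. i < n \<Longrightarrow> integrable M (\<lambda>\<omega>. (Z i \<omega>)\<^sup>2)"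
    and orth: "\<And>i j. i < n \<Longrightarrow> j < n \<Longrightarrow> i \<noteq> j \<Longrightarrow> expectation (\<lambda>\<omega>. Z i \<omega> * Z j \<omega>) = 0"
  shows "integrable M (\<lambda>\<omega>. (\<Sum>i<n. Z i \<omega>)\<^sup>2)"
    and "expectation (\<lambda>\<omega>. (\<Sum>i<n. Z i \<omega>)\<^sup>2) = (\<Sum>i<n. expectation (\<lambda>\<omega>. (Z i \<omega>)\<^sup>2))"
proof -
  have prod: "integrable M (\<lambda>\<omega>. Z i \<omega> * Z j \<omega>)" if "i < n" "j < n" for i j
    using that sq by (intro integrable_mult_of_square_integrable) auto
  have eq: "(\<Sum>i<n. Z i \<omega>)\<^sup>2 = (\<Sum>i<n. \<Sum>j<n. Z i \<omega> * Z j \<omega>)" for \<omega>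
    by (simp add: power2_eq_square sum_product)
  show "integrable M (\<lambda>\<omega>. (\<Sum>i<n. Z i \<omega>)\<^sup>2)"
    unfolding eq using prod by (intro Bochner_Integration.integrable_sum) auto
  have "expectation (\<lambda>\<omega>. (\<Sum>i<n. Z i \<omega>)\<^sup>2)
      = (\<Sum>i<n. \<Sum>j<n. expectation (\<lambda>\<omega>. Z i \<omega> * Z j \<omega>))"
    unfolding eq using prod by (subst Bochner_Integration.integral_sum; auto)+
  also have "\<dots> = (\<Sum>i<n. \<Sum>j<n. if j = i then expectation (\<lambda>\<omega>. (Z i \<omega>)\<^sup>2) else 0)"
    using orth by (intro sum.cong refl) (auto simp: power2_eq_square)
  also have "\<dots> = (\<Sum>i<n. expectation (\<lambda>\<omega>. (Z i \<omega>)\<^sup>2))" by simp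
  finally show "expectation (\<lambda>\<omega>. (\<Sum>i<n. Z i \<omega>)\<^sup>2) = (\<Sum>i<n. expectation (\<lambda>\<omega>. (Z i \<omega>)\<^sup>2))" .
qed

lemma (in prob_space) stochastically_bounded_orthogonal:
  fixes Z :: "nat \<Rightarrow> nat \<Rightarrow> 'a \<Rightarrow> real"
  assumes [measurable]: "\<And>n i. i < n \<Longrightarrow> Z n i \<in> borel_measurable M"
    and sq: "\<And>n i. i < n \<Longrightarrow> integrable M (\<lambda>\<omega>. (Z n i \<omega>)\<^sup>2)"
    and C: "\<And>n i. i < n \<Longrightarrow> expectation (\<lambda>\<omega>. (Z n i \<omega>)\<^sup>2) \<le> C"
    and orth: "\<And>n i j. i < n \<Longrightarrow> j < n \<Longrightarrow> i \<noteq> j \<Longrightarrow> expectation (\<lambda>\<omega>. Z n i \<omega> * Z n j \<omega>) = 0"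
  shows "stochastically_bounded M (\<lambda>z. (\<Sum>i<fst z. Z (fst z) i (snd z)) / sqrt (real (fst z)))"
proof (rule stochastically_bounded_second_moment[where C = "\<bar>C\<bar>"])
  fix n
  note * = expectation_square_sum_orthogonal[of n "Z n", OF assms(1) sq orth]
  show "integrable M (\<lambda>\<omega>. ((\<Sum>i<n. Z n i \<omega>) / sqrt (real n))\<^sup>2)"
    using *(1) by (simp add: power_divide)
  have "(\<Sum>i<n. expectation (\<lambda>\<omega>. (Z n i \<omega>)\<^sup>2)) \<le> (\<Sum>i<n. \<bar>C\<bar>)"
    by (intro sum_mono) (use C[of _ n] in force)
  then show "expectation (\<lambda>\<omega>. ((\<Sum>i<n. Z n i \<omega>) / sqrt (real n))\<^sup>2) \<le> \<bar>C\<bar>"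
    using *(2) by (cases "n = 0") (auto simp: power_divide field_simps)
qed (intro borel_measurable_divide borel_measurable_sum, simp_all)

text \<open>Truncation reduces the integrable case to a square integrable one.\<close>

lemma (in prob_space) weak_law_of_large_numbers:
  fixes Z :: "nat \<Rightarrow> 'a \<Rightarrow> real"
  assumes indep: "indep_vars (\<lambda>_. borel) Z UNIV"
    and ident: "\<And>i. distr M borel (Z i) = distr M borel (Z 0)"
    and int0: "integrable M (Z 0)"
  shows "((\<lambda>z. (\<Sum>i<fst z. Z i (snd z)) / real (fst z)) \<longlongrightarrow> expectation (Z 0)) (in_probability M)"
proof (rule tendsto_in_probabilityI)
  have rv[measurable]: "Z i \<in> borel_measurable M" for i
    using indep by (auto simp: indep_vars_def2)
  then show "(\<lambda>\<omega>. (\<Sum>i<n. Z i \<omega>) / real n) \<in> borel_measurable M" for n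
    by measurable
  have transfer_int: "integrable M (\<lambda>\<omega>. h (Z i \<omega>)) \<longleftrightarrow> integrable M (\<lambda>\<omega>. h (Z 0 \<omega>))"
    and transfer: "expectation (\<lambda>\<omega>. h (Z i \<omega>)) = expectation (\<lambda>\<omega>. h (Z 0 \<omega>))"
    if [measurable]: "h \<in> borel_measurable borel" for h :: "real \<Rightarrow> real" and i
    using integrable_distr_eq[of "Z i" M borel h] integrable_distr_eq[of "Z 0" M borel h]
      integral_distr[of "Z i" M borel h] integral_distr[of "Z 0" M borel h] ident[of i] by auto
  fix e \<eta> :: real assume e: "e > 0" "\<eta> > 0"
  define trunc :: "real \<Rightarrow> real \<Rightarrow> real" where "trunc K z = (if \<bar>z\<bar> \<le> K then z else 0)" for K z
  have [measurable]: "trunc K \<in> borel_measurable borel" for K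
    unfolding trunc_def by measurable
  have "(\<lambda>k. expectation (\<lambda>\<omega>. \<bar>Z 0 \<omega> - trunc (real k) (Z 0 \<omega>)\<bar>)) \<longlonglongrightarrow> expectation (\<lambda>\<omega>. 0)"
  proof (rule integral_dominated_convergence[where w = "\<lambda>\<omega>. \<bar>Z 0 \<omega>\<bar>"])
    show "AE \<omega> in M. (\<lambda>k. \<bar>Z 0 \<omega> - trunc (real k) (Z 0 \<omega>)\<bar>) \<longlonglongrightarrow> 0"
    proof (intro AE_I2 tendsto_eventually)
      fix \<omega>
      have "\<forall>\<^sub>F k in sequentially. \<bar>Z 0 \<omega>\<bar> \<le> real k"
        using filterlim_real_sequentially unfolding filterlim_at_top by auto
      then show "\<forall>\<^sub>F k in sequentially. \<bar>Z 0 \<omega> - trunc (real k) (Z 0 \<omega>)\<bar> = 0"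
        by eventually_elim (simp add: trunc_def)
    qed
  qed (use int0 in \<open>auto simp: trunc_def\<close>)
  \<comment> \<open>Centring at most doubles the truncation error, to \<open>\<eta> * e / 4\<close>;
    Markov's inequality at level \<open>e / 2\<close> then leaves \<open>\<eta> / 2\<close>.\<close>
  moreover have "\<eta> * e / 8 > 0" using e by simp
  ultimately have "\<forall>\<^sub>F k in sequentially.
      expectation (\<lambda>\<omega>. \<bar>Z 0 \<omega> - trunc (real k) (Z 0 \<omega>)\<bar>) < \<eta> * e / 8"
    by (intro order_tendstoD(2)[of _ 0]) (simp_all only: integral_zero)
  then obtain K :: real
    where K: "expectation (\<lambda>\<omega>. \<bar>Z 0 \<omega> - trunc K (Z 0 \<omega>)\<bar>) < \<eta> * e / 8" and "K \<ge> 0"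
    unfolding eventually_sequentially by (meson le_refl of_nat_0_le_iff)
  \<comment> \<open>\<open>U\<close> is the centred truncation, controlled by its variance, and
    \<open>R\<close> the centred rest, controlled by its first absolute moment. They add up to
    \<open>Z i - expectation (Z 0)\<close>.\<close>
  define m where "m = expectation (\<lambda>\<omega>. trunc K (Z 0 \<omega>))"
  define U where "U i \<omega> = trunc K (Z i \<omega>) - m" for i \<omega>
  define R where "R i \<omega> = Z i \<omega> - trunc K (Z i \<omega>) - (expectation (Z 0) - m)" for i \<omega>
  have bounded: "\<bar>trunc K z\<bar> \<le> K" for z using \<open>K \<ge> 0\<close> by (simp add: trunc_def)
  have int_trunc: "integrable M (\<lambda>\<omega>. trunc K (Z i \<omega>))" for i
    by (rule integrable_const_bound[where B = K]) (auto simp: bounded)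
  have int: "integrable M (Z i)" for i
    using transfer_int[of "\<lambda>z. z" i] int0 by simp
  have [measurable]: "U i \<in> borel_measurable M" "R i \<in> borel_measurable M" for i
    unfolding U_def R_def by measurable
  have mU: "\<bar>m\<bar> \<le> K"
    unfolding m_def
    by (rule order_trans[OF integral_abs_bound integral_le_const])
      (use int_trunc bounded in \<open>auto intro!: AE_I2\<close>)
  have U_le: "\<bar>U i \<omega>\<bar> \<le> 2 * K" for i \<omega>
    using bounded[of "Z i \<omega>"] mU unfolding U_def by linarith
  have U_sq: "integrable M (\<lambda>\<omega>. (U i \<omega>)\<^sup>2)" "expectation (\<lambda>\<omega>. (U i \<omega>)\<^sup>2) \<le> (2 * K)\<^sup>2" for i
  proof -
    have *: "(U i \<omega>)\<^sup>2 \<le> (2 * K)\<^sup>2" for \<omega>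
      using U_le[of i \<omega>] by (metis abs_le_square_iff abs_ge_self order_trans)
    show i: "integrable M (\<lambda>\<omega>. (U i \<omega>)\<^sup>2)"
      by (rule integrable_const_bound[where B = "(2 * K)\<^sup>2"]) (use * in auto)
    show "expectation (\<lambda>\<omega>. (U i \<omega>)\<^sup>2) \<le> (2 * K)\<^sup>2"
      by (rule integral_le_const[OF i]) (use * in auto)
  qed
  have U_int: "integrable M (U i)" for i
    unfolding U_def using int_trunc by simp
  have U_mean: "expectation (U i) = 0" for i
    unfolding U_def using int_trunc transfer[of "trunc K" i] by (simp add: m_def prob_space)
  have U_orth: "expectation (\<lambda>\<omega>. U i \<omega> * U j \<omega>) = 0" if "i \<noteq> j" for i j
  proof -
    have "indep_vars (\<lambda>_. borel) (\<lambda>i \<omega>. U i \<omega>) UNIV"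
      unfolding U_def by (rule indep_vars_compose2[OF indep]) auto
    from indep_vars_integral_mult(1)[OF this] show ?thesis
      using that U_int U_mean by simp
  qed
  have R_int: "integrable M (R i)" for i
    unfolding R_def using int int_trunc by simp
  have R_abs: "expectation (\<lambda>\<omega>. \<bar>R i \<omega>\<bar>) \<le> \<eta> * e / 4" for i
  proof -
    let ?D = "\<lambda>\<omega>. \<bar>Z 0 \<omega> - trunc K (Z 0 \<omega>)\<bar>"
    have D: "integrable M ?D" using int int_trunc by auto
    have "\<bar>expectation (Z 0) - m\<bar> = \<bar>expectation (\<lambda>\<omega>. Z 0 \<omega> - trunc K (Z 0 \<omega>))\<bar>"
      unfolding m_def using int int_trunc by simp
    also have "\<dots> \<le> expectation ?D" by (rule integral_abs_bound)
    finally have 1: "\<bar>expectation (Z 0) - m\<bar> \<le> expectation ?D" .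
    have "expectation (\<lambda>\<omega>. \<bar>R i \<omega>\<bar>) = expectation (\<lambda>\<omega>. \<bar>R 0 \<omega>\<bar>)"
      unfolding R_def
      using transfer[of "\<lambda>z. \<bar>z - trunc K z - (expectation (Z 0) - m)\<bar>" i] by simp
    also have "\<dots> \<le> expectation (\<lambda>\<omega>. ?D \<omega> + expectation ?D)"
      using 1 D integrable_abs[OF R_int[of 0]] by (intro integral_mono) (auto simp: R_def)
    also have "\<dots> = 2 * expectation ?D" using D by (simp add: prob_space)
    finally show ?thesis using K by simp
  qed
  \<comment> \<open>Since \<open>U\<close> is bounded by \<open>2 * K\<close>, Chebyshev's
    inequality at level \<open>n * e / 2\<close> gives
    \<open>16 * K\<^sup>2 / (e\<^sup>2 * n)\<close>, and this threshold makes it at most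
    \<open>\<eta> / 2\<close>.\<close>
  have "\<forall>\<^sub>F n in sequentially. real n > 32 * K\<^sup>2 / (e\<^sup>2 * \<eta>)"
    using filterlim_real_sequentially unfolding filterlim_at_top_dense by auto
  then show "\<forall>\<^sub>F n in sequentially.
      prob {\<omega>\<in>space M. \<bar>(\<Sum>i<n. Z i \<omega>) / real n - expectation (Z 0)\<bar> \<ge> e} \<le> \<eta>"
    using eventually_gt_at_top[of 0]
  proof eventually_elim
    case (elim n)
    then have n: "real n > 0" by simp
    let ?A = "{\<omega>\<in>space M. (\<Sum>i<n. U i \<omega>)\<^sup>2 \<ge> (real n * e / 2)\<^sup>2}"
    let ?B = "{\<omega>\<in>space M. (\<Sum>i<n. \<bar>R i \<omega>\<bar>) \<ge> real n * e / 2}"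
    have "{\<omega>\<in>space M. \<bar>(\<Sum>i<n. Z i \<omega>) / real n - expectation (Z 0)\<bar> \<ge> e} \<subseteq> ?A \<union> ?B"
    proof (rule subsetI, rule ccontr)
      fix \<omega> assume w: "\<omega> \<in> {\<omega>\<in>space M. \<bar>(\<Sum>i<n. Z i \<omega>) / real n - expectation (Z 0)\<bar> \<ge> e}"
        and "\<omega> \<notin> ?A \<union> ?B"
      then have "\<not> (real n * e / 2)\<^sup>2 \<le> (\<Sum>i<n. U i \<omega>)\<^sup>2" "(\<Sum>i<n. \<bar>R i \<omega>\<bar>) < real n * e / 2"
        by auto
      then have U: "\<bar>\<Sum>i<n. U i \<omega>\<bar> < real n * e / 2"
        using n e by (simp add: abs_le_square_iff[symmetric])
      have R: "\<bar>\<Sum>i<n. R i \<omega>\<bar> < real n * e / 2"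
        using \<open>(\<Sum>i<n. \<bar>R i \<omega>\<bar>) < real n * e / 2\<close> sum_abs[of "\<lambda>i. R i \<omega>" "{..<n}"] by linarith
      have "(\<Sum>i<n. Z i \<omega>) - real n * expectation (Z 0) = (\<Sum>i<n. U i \<omega>) + (\<Sum>i<n. R i \<omega>)"
        by (simp add: U_def R_def sum_subtractf right_diff_distrib)
      then have "\<bar>(\<Sum>i<n. Z i \<omega>) - real n * expectation (Z 0)\<bar> < real n * e"
        using U R by linarith
      moreover have "(\<Sum>i<n. Z i \<omega>) / real n - expectation (Z 0)
          = ((\<Sum>i<n. Z i \<omega>) - real n * expectation (Z 0)) / real n"
        using n by (simp add: field_simps)
      ultimately have "\<bar>(\<Sum>i<n. Z i \<omega>) / real n - expectation (Z 0)\<bar> < e"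
        using n by (simp add: abs_divide field_simps)
      with w show False by simp
    qed
    then have "prob {\<omega>\<in>space M. \<bar>(\<Sum>i<n. Z i \<omega>) / real n - expectation (Z 0)\<bar> \<ge> e} \<le> prob (?A \<union> ?B)"
      by (intro finite_measure_mono) auto
    also have "\<dots> \<le> prob ?A + prob ?B" by (intro measure_Un_le) auto
    also have "prob ?A \<le> \<eta> / 2"
    proof -
      note orth = expectation_square_sum_orthogonal[of n U, OF _ U_sq(1) U_orth]
      have "prob ?A \<le> expectation (\<lambda>\<omega>. (\<Sum>i<n. U i \<omega>)\<^sup>2) / (real n * e / 2)\<^sup>2"
        using n e orth(1) by (intro integral_Markov_inequality_measure[where A = "{}"]) auto
      also have "\<dots> \<le> (\<Sum>i<n. (2 * K)\<^sup>2) / (real n * e / 2)\<^sup>2"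
        unfolding orth(2)[simplified] by (intro divide_right_mono sum_mono U_sq) simp
      also have "\<dots> = 16 * K\<^sup>2 / (e\<^sup>2 * real n)"
        using n e by (simp add: field_simps power2_eq_square)
      also have "\<dots> \<le> \<eta> / 2"
        using elim(1) n e by (simp add: field_simps)
      finally show ?thesis .
    qed
    also have "prob ?B \<le> \<eta> / 2"
    proof -
      have "prob ?B \<le> expectation (\<lambda>\<omega>. \<Sum>i<n. \<bar>R i \<omega>\<bar>) / (real n * e / 2)"
        using n e R_int
        by (intro integral_Markov_inequality_measure[where A = "{}"]) (auto intro!: AE_I2 sum_nonneg)
      also have "\<dots> \<le> (\<Sum>i<n. \<eta> * e / 4) / (real n * e / 2)"
        using R_int n e
        by (intro divide_right_mono, subst Bochner_Integration.integral_sum)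
          (auto intro!: sum_mono R_abs simp del: sum_constant)
      also have "\<dots> = \<eta> / 2" using n e by (simp add: field_simps)
      finally show ?thesis .
    qed
    finally show ?case by simp
  qed
qed

section \<open>The test statistic in terms of the inverse Gram matrix\<close>

unbundle no inner_syntax

section \<open>Entrywise limits of determinants and inverses\<close>

text \<open>By the Leibniz formula the determinant is a polynomial in the entries. Matrix limits are
  taken entrywise throughout, so that the limit calculus for reals suffices along any
  filter.\<close>

lemma tendsto_det:
  fixes A :: "'z \<Rightarrow> real mat"
  assumes "\<And>z. A z \<in> carrier_mat m m" "D \<in> carrier_mat m m"
    and "\<And>i j. i < m \<Longrightarrow> j < m \<Longrightarrow> ((\<lambda>z. A z $$ (i, j)) \<longlongrightarrow> D $$ (i, j)) F"
  shows "((\<lambda>z. Determinant.det (A z)) \<longlongrightarrow> Determinant.det D) F"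
  unfolding det_def'[OF assms(1)] det_def'[OF assms(2)]
  by (intro tendsto_sum tendsto_mult tendsto_const tendsto_prod assms(3))
    (auto dest: permutes_in_image)

lemma tendsto_adj_mat:
  fixes A :: "'z \<Rightarrow> real mat"
  assumes A: "\<And>z. A z \<in> carrier_mat m m" and D: "D \<in> carrier_mat m m"
    and lim: "\<And>i j. i < m \<Longrightarrow> j < m \<Longrightarrow> ((\<lambda>z. A z $$ (i, j)) \<longlongrightarrow> D $$ (i, j)) F"
    and kl: "k < m" "l < m"
  shows "((\<lambda>z. adj_mat (A z) $$ (k, l)) \<longlongrightarrow> adj_mat D $$ (k, l)) F"
proof -
  have "((\<lambda>z. Determinant.det (mat_delete (A z) l k)) \<longlongrightarrow> Determinant.det (mat_delete D l k)) F"
  proof (rule tendsto_det[where m = "m - 1"])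
    show "mat_delete (A z) l k \<in> carrier_mat (m - 1) (m - 1)" for z
      using A[of z] by (auto simp: mat_delete_def)
    show "mat_delete D l k \<in> carrier_mat (m - 1) (m - 1)"
      using D by (auto simp: mat_delete_def)
    show "((\<lambda>z. mat_delete (A z) l k $$ (i, j)) \<longlongrightarrow> mat_delete D l k $$ (i, j)) F"
      if "i < m - 1" "j < m - 1" for i j
    proof -
      have "mat_delete B l k $$ (i, j) = B $$ (if i < l then i else Suc i, if j < k then j else Suc j)"
        if "B \<in> carrier_mat m m" for B :: "real mat"
        using that \<open>i < m - 1\<close> \<open>j < m - 1\<close> by (auto simp: mat_delete_def)
      then show ?thesis
        using A D that by (simp only:) (intro lim; auto)
    qed
  qed
  moreover have "adj_mat B $$ (k, l) = (-1) ^ (l + k) * Determinant.det (mat_delete B l k)"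
    if "B \<in> carrier_mat m m" for B :: "real mat"
    using that kl by (auto simp: adj_mat_def cofactor_def)
  ultimately show ?thesis
    using A D by (simp only:) (intro tendsto_intros)
qed

text \<open>The inverse is computed by Gauss-Jordan elimination, whose pivot choices are not visibly
  continuous in the entries. Cramer's formula is, and every left inverse satisfies it.\<close>

lemma left_inverse_entry:
  fixes A :: "real mat"
  assumes A: "A \<in> carrier_mat m m" and B: "B \<in> carrier_mat m m"
    and inv: "B * A = 1\<^sub>m m" and kl: "k < m" "l < m"
  shows "B $$ (k, l) = adj_mat A $$ (k, l) / Determinant.det A"
proof -
  have "Determinant.det B * Determinant.det A = 1"
    using det_mult[OF B A] inv by simp
  then have nz: "Determinant.det A \<noteq> 0" by auto
  have "adj_mat A = (B * A) * adj_mat A" using adj_mat(1)[OF A] inv by simp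
  also have "\<dots> = B * (A * adj_mat A)" using A B adj_mat(1)[OF A] by (simp add: assoc_mult_mat)
  also have "\<dots> = Determinant.det A \<cdot>\<^sub>m B"
    using B by (simp add: adj_mat(2)[OF A] mult_smult_distrib[of _ m m _ m])
  finally have "adj_mat A $$ (k, l) = Determinant.det A * B $$ (k, l)"
    using B kl by simp
  with nz show ?thesis by simp
qed

text \<open>\<open>B\<close> is required to be an inverse only eventually, because the Gram matrix
  may be singular on an event of small probability. The limit \<open>D\<close> is nonsingular, so
  the quotient in Cramer's formula converges.\<close>

lemma tendsto_left_inverse:
  fixes A B :: "'z \<Rightarrow> real mat"
  assumes A: "\<And>z. A z \<in> carrier_mat m m" and D: "D \<in> carrier_mat m m" "E \<in> carrier_mat m m"
    and ED: "E * D = 1\<^sub>m m"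
    and lim: "\<And>i j. i < m \<Longrightarrow> j < m \<Longrightarrow> ((\<lambda>z. A z $$ (i, j)) \<longlongrightarrow> D $$ (i, j)) F"
    and B: "\<forall>\<^sub>F z in F. B z \<in> carrier_mat m m \<and> B z * A z = 1\<^sub>m m"
    and kl: "k < m" "l < m"
  shows "((\<lambda>z. B z $$ (k, l)) \<longlongrightarrow> E $$ (k, l)) F"
proof -
  have "Determinant.det E * Determinant.det D = 1"
    using det_mult[OF D(2,1)] ED by simp
  then have nz: "Determinant.det D \<noteq> 0" by auto
  have "((\<lambda>z. adj_mat (A z) $$ (k, l) / Determinant.det (A z)) \<longlongrightarrow> E $$ (k, l)) F"
    unfolding left_inverse_entry[OF D ED kl]
    using A D(1) lim kl nz by (intro tendsto_divide tendsto_adj_mat[where m = m] tendsto_det[where m = m])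
  then show ?thesis
  proof (rule Lim_transform_eventually)
    show "\<forall>\<^sub>F z in F. adj_mat (A z) $$ (k, l) / Determinant.det (A z) = B z $$ (k, l)"
      using B by eventually_elim (use left_inverse_entry[OF A] kl in auto)
  qed
qed

section \<open>Least squares algebra\<close>

lemma gram_carrier: "G \<in> carrier_mat n m \<Longrightarrow> gram G \<in> carrier_mat m m"
  by (auto simp: gram_def)

text \<open>A nonzero determinant is the working form of invertibility: it is an open condition,
  hence inherited from the limit, and it ensures that \<open>mat_inverse\<close> returns
  \<open>Some\<close>.\<close>

lemma gram_inverse_of_det:
  assumes G: "G \<in> carrier_mat n m" and det: "Determinant.det (gram G) \<noteq> 0"
  shows "invertible_mat (gram G)" "gram_inverse G \<in> carrier_mat m m"
    "gram_inverse G * gram G = 1\<^sub>m m" "gram G * gram_inverse G = 1\<^sub>m m"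
proof -
  note A = gram_carrier[OF G]
  have U: "gram G \<in> Units (ring_mat TYPE(real) m ())"
    by (rule det_non_zero_imp_unit[OF A det])
  then obtain B where B: "mat_inverse (gram G) = Some B"
    using mat_inverse(1)[OF A, where b = "()"] by (cases "mat_inverse (gram G)") auto
  note BB = mat_inverse(2)[OF A B]
  have eq: "gram_inverse G = B" by (simp add: gram_inverse_def B)
  show "gram_inverse G \<in> carrier_mat m m" "gram_inverse G * gram G = 1\<^sub>m m"
    "gram G * gram_inverse G = 1\<^sub>m m" using BB eq by auto
  show "invertible_mat (gram G)"
    unfolding invertible_mat_def inverts_mat_def using A BB by (auto intro!: exI[of _ B])
qed

lemma ols_expansion:
  fixes w \<theta> :: "real Matrix.vec"
  assumes G: "G \<in> carrier_mat n m" and det: "Determinant.det (gram G) \<noteq> 0"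
    and th: "\<theta> \<in> carrier_vec m" and w: "w \<in> carrier_vec n"
  shows "ols G (G *\<^sub>v \<theta> + w) = \<theta> + gram_inverse G *\<^sub>v (transpose_mat G *\<^sub>v w)"
proof -
  note H = gram_inverse_of_det[OF G det]
  have GT: "transpose_mat G \<in> carrier_mat m n" using G by simp
  have "ols G (G *\<^sub>v \<theta> + w) = gram_inverse G *\<^sub>v (transpose_mat G *\<^sub>v (G *\<^sub>v \<theta> + w))"
    unfolding ols_def using G GT H th w
    by (intro assoc_mult_mat_vec[of _ m m _ n]) auto
  also have "transpose_mat G *\<^sub>v (G *\<^sub>v \<theta> + w) = gram G *\<^sub>v \<theta> + transpose_mat G *\<^sub>v w"
    using G GT th w
    by (subst mult_add_distrib_mat_vec[of _ m n]) (auto simp: gram_def assoc_mult_mat_vec[of _ m n])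
  also have "gram_inverse G *\<^sub>v (gram G *\<^sub>v \<theta> + transpose_mat G *\<^sub>v w)
      = gram_inverse G *\<^sub>v (gram G *\<^sub>v \<theta>) + gram_inverse G *\<^sub>v (transpose_mat G *\<^sub>v w)"
    using gram_carrier[OF G] H GT th w by (intro mult_add_distrib_mat_vec[of _ m m]) auto
  also have "gram_inverse G *\<^sub>v (gram G *\<^sub>v \<theta>) = \<theta>"
    using gram_carrier[OF G] H th by (subst assoc_mult_mat_vec[symmetric, of _ m m _ m]) auto
  finally show ?thesis .
qed

text \<open>The residual vector is orthogonal to the columns of \<open>G\<close>, hence to the fitted part of \<open>w\<close>.\<close>

lemma residual_square:
  fixes w \<theta> :: "real Matrix.vec"
  assumes G: "G \<in> carrier_mat n m" and det: "Determinant.det (gram G) \<noteq> 0"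
    and th: "\<theta> \<in> carrier_vec m" and w: "w \<in> carrier_vec n"
  defines "u \<equiv> transpose_mat G *\<^sub>v w"
  defines "r \<equiv> (G *\<^sub>v \<theta> + w) - G *\<^sub>v ols G (G *\<^sub>v \<theta> + w)"
  shows "r \<bullet> r = w \<bullet> w - u \<bullet> (gram_inverse G *\<^sub>v u)"
proof -
  note H = gram_inverse_of_det[OF G det]
  have GT: "transpose_mat G \<in> carrier_mat m n" using G by simp
  define h where "h = gram_inverse G *\<^sub>v u"
  have u: "u \<in> carrier_vec m" unfolding u_def using GT w by simp
  have h: "h \<in> carrier_vec m" unfolding h_def using H u by simp
  have Gh: "G *\<^sub>v h \<in> carrier_vec n" and Gt: "G *\<^sub>v \<theta> \<in> carrier_vec n" using G h th by auto
  have r: "r = w - G *\<^sub>v h"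
    unfolding r_def ols_expansion[OF G det th w] u_def[symmetric] h_def[symmetric]
      mult_add_distrib_mat_vec[OF G th h]
    using w G Gh Gt by (intro eq_vecI) auto
  have normal: "transpose_mat G *\<^sub>v (G *\<^sub>v h) = u"
  proof -
    have "transpose_mat G *\<^sub>v (G *\<^sub>v h) = gram G *\<^sub>v h"
      unfolding gram_def using G GT h by (intro assoc_mult_mat_vec[symmetric]) auto
    also have "\<dots> = u"
      unfolding h_def using H u gram_carrier[OF G] by (subst assoc_mult_mat_vec[symmetric, of _ m m _ m]) auto
    finally show ?thesis .
  qed
  have swap: "v \<bullet> (G *\<^sub>v h) = (transpose_mat G *\<^sub>v v) \<bullet> h" if "v \<in> carrier_vec n" for v
    using transpose_vec_mult_scalar[OF G h that] by simp
  have rGh: "r \<bullet> (G *\<^sub>v h) = 0"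
  proof -
    have "r \<bullet> (G *\<^sub>v h) = w \<bullet> (G *\<^sub>v h) - (G *\<^sub>v h) \<bullet> (G *\<^sub>v h)"
      unfolding r using w Gh by (intro minus_scalar_prod_distrib) auto
    also have "\<dots> = 0" unfolding swap[OF w] swap[OF Gh] normal u_def[symmetric] by simp
    finally show ?thesis .
  qed
  have "r \<in> carrier_vec n" unfolding r using w Gh by simp
  then have "r \<bullet> r = r \<bullet> w - r \<bullet> (G *\<^sub>v h)"
    using w Gh by (subst (2) r) (intro scalar_prod_minus_distrib, auto)
  also have "\<dots> = w \<bullet> w - (G *\<^sub>v h) \<bullet> w"
    unfolding rGh unfolding r using w Gh by (simp add: minus_scalar_prod_distrib)
  also have "(G *\<^sub>v h) \<bullet> w = u \<bullet> h"
    using swap[OF w] w Gh by (simp add: u_def comm_scalar_prod[of _ n])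
  finally show ?thesis by (simp add: h_def)
qed

lemma contrast_scalar_prod:
  assumes "v \<in> carrier_vec m" "2 \<le> m"
  shows "contrast m \<bullet> v = v $ 0 - v $ 1"
proof -
  have "contrast m \<bullet> v = (\<Sum>k = 0..<m. (if k = 0 then v $ 0 else 0) - (if k = 1 then v $ 1 else 0))"
    using assms by (auto simp: scalar_prod_def contrast_def intro!: sum.cong)
  also have "\<dots> = v $ 0 - v $ 1" using assms(2) by (simp add: sum_subtractf)
  finally show ?thesis .
qed

lemma mult_mat_vec_entry:
  assumes "B \<in> carrier_mat m n" "v \<in> carrier_vec n" "k < m"
  shows "(B *\<^sub>v v) $ k = (\<Sum>l<n. B $$ (k, l) * v $ l)"
  using assms by (auto simp: scalar_prod_def atLeast0LessThan intro!: sum.cong)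

text \<open>Flattens the statistic into finite sums of entries of the inverse and of the score
  vector \<open>u\<close>. The true coefficients survive only through
  \<open>\<theta> $ 0 - \<theta> $ 1\<close>, because the residuals do not depend on
  \<open>\<theta>\<close>.\<close>

lemma test_stat_expansion:
  fixes w \<theta> :: "real Matrix.vec"
  assumes G: "G \<in> carrier_mat n m" and det: "Determinant.det (gram G) \<noteq> 0" and m: "2 \<le> m"
    and th: "\<theta> \<in> carrier_vec m" and w: "w \<in> carrier_vec n"
  defines "u \<equiv> transpose_mat G *\<^sub>v w" and "H \<equiv> gram_inverse G"
  shows "test_stat G (G *\<^sub>v \<theta> + w) =
     (\<theta> $ 0 - \<theta> $ 1 + (\<Sum>l<m. (H $$ (0, l) - H $$ (1, l)) * u $ l)) /
     sqrt ((w \<bullet> w - (\<Sum>k<m. \<Sum>l<m. u $ k * H $$ (k, l) * u $ l)) / (real n - real m)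
       * (H $$ (0, 0) - H $$ (0, 1) - H $$ (1, 0) + H $$ (1, 1)))"
proof -
  have H: "H \<in> carrier_mat m m" unfolding H_def by (rule gram_inverse_of_det[OF G det])
  have GT: "transpose_mat G \<in> carrier_mat m n" using G by simp
  have u: "u \<in> carrier_vec m" unfolding u_def using GT w by simp
  have Hu: "H *\<^sub>v u \<in> carrier_vec m" using H u by simp
  have L: "contrast m \<in> carrier_vec m" by (simp add: contrast_def)
  have num: "contrast m \<bullet> ols G (G *\<^sub>v \<theta> + w)
      = \<theta> $ 0 - \<theta> $ 1 + (\<Sum>l<m. (H $$ (0, l) - H $$ (1, l)) * u $ l)"
    unfolding ols_expansion[OF G det th w] u_def[symmetric] H_def[symmetric]
    using m H th Hu mult_mat_vec_entry[OF H u, of 0] mult_mat_vec_entry[OF H u, of 1]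
    by (subst contrast_scalar_prod)
      (auto simp: left_diff_distrib sum_subtractf simp del: index_mult_mat_vec)
  have HL: "(H *\<^sub>v contrast m) $ k = H $$ (k, 0) - H $$ (k, 1)" if "k < m" for k
  proof -
    have "(H *\<^sub>v contrast m) $ k = row H k \<bullet> contrast m" using H that by simp
    also have "\<dots> = contrast m \<bullet> row H k" using H L by (intro comm_scalar_prod[of _ m]) auto
    also have "\<dots> = H $$ (k, 0) - H $$ (k, 1)"
      using contrast_scalar_prod[of "row H k" m] H m that by simp
    finally show ?thesis .
  qed
  have quad: "contrast m \<bullet> (H *\<^sub>v contrast m)
      = H $$ (0, 0) - H $$ (0, 1) - H $$ (1, 0) + H $$ (1, 1)"
    using m H L HL[of 0] HL[of 1] by (subst contrast_scalar_prod[of _ m]) auto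
  have "u \<bullet> (H *\<^sub>v u) = (\<Sum>k<m. \<Sum>l<m. u $ k * H $$ (k, l) * u $ l)"
    using H u mult_mat_vec_entry[OF H u]
    by (simp add: scalar_prod_def atLeast0LessThan sum_distrib_left mult.assoc)
  with residual_square[OF G det th w]
  have "residual_variance G (G *\<^sub>v \<theta> + w)
      = (w \<bullet> w - (\<Sum>k<m. \<Sum>l<m. u $ k * H $$ (k, l) * u $ l)) / (real n - real m)"
    using G unfolding residual_variance_def Let_def u_def[symmetric] H_def[symmetric] by simp
  with num quad G show ?thesis by (simp add: test_stat_def Let_def H_def)
qed

section \<open>Weak convergence of random vectors\<close>

lemma continuous_map_linear_form:
  fixes b :: "'i \<Rightarrow> real"
  assumes "finite J" "J \<subseteq> I"
  shows "continuous_map (product_topology (\<lambda>_. euclideanreal) I) euclideanreal (\<lambda>y. \<Sum>j\<in>J. b j * y j)"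
  using assms
  by (intro continuous_map_sum continuous_map_real_mult continuous_map_product_projection) auto

text \<open>The form in which (A2) is used: \<open>g\<close> will be a cosine and a sine for
  characteristic functions, and a ramp for tightness.\<close>

lemma weak_conv_vec_continuous:
  fixes g :: "real \<Rightarrow> real" and b :: "'i \<Rightarrow> real"
  assumes conv: "weak_conv_vec I D_seq D" and J: "finite J" "J \<subseteq> I"
    and g: "continuous_on UNIV g" "\<And>y. \<bar>g y\<bar> \<le> C"
  shows "(\<lambda>n. integral\<^sup>L (D_seq n) (\<lambda>y. g (\<Sum>j\<in>J. b j * y j)))
           \<longlonglongrightarrow> integral\<^sup>L D (\<lambda>y. g (\<Sum>j\<in>J. b j * y j))"
proof -
  have "continuous_map (product_topology (\<lambda>_. euclideanreal) I) euclideanreal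
      (g \<circ> (\<lambda>y. \<Sum>j\<in>J. b j * y j))"
    using g(1) by (intro continuous_map_compose[OF continuous_map_linear_form[OF J]]) simp
  moreover have "bounded (h ` S)" if "h = g \<circ> (\<lambda>y. \<Sum>j\<in>J. b j * y j)" for h S
    unfolding bounded_iff using g(2) that by auto
  ultimately show ?thesis
    using conv unfolding weak_conv_vec_def comp_def by blast
qed

lemma char_linear_form_tendsto:
  fixes b :: "'i \<Rightarrow> real"
  assumes M: "prob_space M" and P: "prob_space P"
    and J: "finite J" "J \<subseteq> I"
    and Y: "\<And>n j. j \<in> I \<Longrightarrow> Y n j \<in> borel_measurable M"
    and \<xi>: "\<And>j. j \<in> I \<Longrightarrow> \<xi> j \<in> borel_measurable P"
    and conv: "weak_conv_vec I (\<lambda>n. distr M (real_vec_space I) (random_vec I (Y n)))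
                 (distr P (real_vec_space I) (random_vec I \<xi>))"
  shows "(\<lambda>n. char (distr M borel (\<lambda>\<omega>. \<Sum>j\<in>J. b j * Y n j \<omega>)) t)
           \<longlonglongrightarrow> char (distr P borel (\<lambda>u. \<Sum>j\<in>J. b j * \<xi> j u)) t"
proof -
  \<comment> \<open>Test functions in \<open>weak_conv_vec\<close> are real-valued, so
    \<open>iexp\<close> is split into its real and imaginary parts. The space \<open>Q\<close> is
    generic to serve both the sequence and its limit.\<close>
  have eq: "char (distr Q borel (\<lambda>\<omega>. \<Sum>j\<in>J. b j * Z j \<omega>)) t =
      Complex (integral\<^sup>L (distr Q (real_vec_space I) (random_vec I Z)) (\<lambda>y. cos (t * (\<Sum>j\<in>J. b j * y j))))
        (integral\<^sup>L (distr Q (real_vec_space I) (random_vec I Z)) (\<lambda>y. sin (t * (\<Sum>j\<in>J. b j * y j))))"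
    if Q: "prob_space Q" and Z[measurable]: "\<And>j. j \<in> I \<Longrightarrow> Z j \<in> borel_measurable Q"
    for Q :: "'z measure" and Z :: "'i \<Rightarrow> 'z \<Rightarrow> real"
  proof -
    interpret Q: prob_space Q by fact
    have J_meas[measurable]: "\<And>j. j \<in> J \<Longrightarrow> Z j \<in> borel_measurable Q" using J by auto
    have comp: "(\<lambda>y. y j) \<in> borel_measurable (real_vec_space I)" if "j \<in> J" for j
      using that J by (intro measurable_component_singleton) auto
    have [measurable]: "(\<lambda>y. \<Sum>j\<in>J. b j * y j) \<in> borel_measurable (real_vec_space I)"
      using comp by (intro borel_measurable_sum borel_measurable_times) auto
    have [measurable]: "random_vec I Z \<in> measurable Q (real_vec_space I)"
      by (intro measurable_restrict) simp
    have sum_eq: "(\<Sum>j\<in>J. b j * random_vec I Z \<omega> j) = (\<Sum>j\<in>J. b j * Z j \<omega>)" for \<omega>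
      using J by (intro sum.cong) auto
    let ?V = "\<lambda>\<omega>. \<Sum>j\<in>J. b j * Z j \<omega>"
    have int: "complex_integrable Q (\<lambda>\<omega>. iexp (t * ?V \<omega>))"
      by (intro Q.integrable_iexp) measurable
    have "char (distr Q borel ?V) t = (CLINT \<omega>|Q. iexp (t * ?V \<omega>))"
      unfolding char_def by (simp add: integral_distr del: of_real_mult of_real_sum)
    also have "\<dots> = Complex (LINT \<omega>|Q. cos (t * ?V \<omega>)) (LINT \<omega>|Q. sin (t * ?V \<omega>))"
      using integral_Re[OF int] integral_Im[OF int]
      by (intro complex_eqI) (simp_all add: cis_conv_exp[symmetric] del: of_real_mult of_real_sum)
    finally show ?thesis
      by (simp add: integral_distr sum_eq del: restrict_apply)
  qed
  have cont: "continuous_on UNIV (\<lambda>y :: real. cos (t * y))" "continuous_on UNIV (\<lambda>y :: real. sin (t * y))"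
    by (auto intro!: continuous_intros)
  show ?thesis
    by (simp only: eq M P Y \<xi>, intro tendsto_Complex
        weak_conv_vec_continuous[OF conv J cont(1), where C = 1]
        weak_conv_vec_continuous[OF conv J cont(2), where C = 1]) simp_all
qed

text \<open>Weakly convergent sequences are tight: a tail that is small for the limit law is small
  for large \<open>n\<close>, once its indicator is replaced by a continuous function.\<close>

lemma (in prob_space) stochastically_bounded_of_weak_conv_vec:
  fixes Y :: "nat \<Rightarrow> 'i \<Rightarrow> 'a \<Rightarrow> real"
  assumes P: "prob_space P" and j: "j \<in> I"
    and Y: "\<And>n j. j \<in> I \<Longrightarrow> Y n j \<in> borel_measurable M"
    and \<xi>: "\<And>j. j \<in> I \<Longrightarrow> \<xi> j \<in> borel_measurable P"
    and conv: "weak_conv_vec I (\<lambda>n. distr M (real_vec_space I) (random_vec I (Y n)))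
                 (distr P (real_vec_space I) (random_vec I \<xi>))"
  shows "stochastically_bounded M (\<lambda>z. Y (fst z) j (snd z))"
proof (rule stochastically_boundedI)
  note [measurable] = Y[OF j] \<xi>[OF j]
  show "Y n j \<in> borel_measurable M" for n by simp
  interpret P: prob_space P by fact
  \<comment> \<open>A continuous function that vanishes for \<open>\<bar>y\<bar> \<le> K\<close> and
    equals 1 for \<open>\<bar>y\<bar> \<ge> K + 1\<close>, hence a majorant of the tail indicator
    beyond \<open>K + 1\<close>.\<close>
  define ramp :: "real \<Rightarrow> real \<Rightarrow> real" where "ramp K y = min 1 (max 0 (\<bar>y\<bar> - K))" for K y
  have ramp_cont: "continuous_on UNIV (ramp K)" for K
    unfolding ramp_def by (intro continuous_intros)
  then have [measurable]: "ramp K \<in> borel_measurable borel" for K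
    by (rule borel_measurable_continuous_onI)
  have ramp_bound: "\<bar>ramp K y\<bar> \<le> 1" "0 \<le> ramp K y" for K y by (auto simp: ramp_def)
  have comp[measurable]: "(\<lambda>y. y j) \<in> borel_measurable (real_vec_space I)"
    using j by (intro measurable_component_singleton)
  have [measurable]: "random_vec I (Y n) \<in> measurable M (real_vec_space I)" for n
    using Y by (intro measurable_restrict) simp
  have [measurable]: "random_vec I \<xi> \<in> measurable P (real_vec_space I)"
    using \<xi> by (intro measurable_restrict) simp
  fix \<eta> :: real assume eta: "\<eta> > 0"
  have "(\<lambda>k. P.expectation (\<lambda>u. ramp (real k) (\<xi> j u))) \<longlonglongrightarrow> P.expectation (\<lambda>u. 0)"
  proof (rule integral_dominated_convergence[where w = "\<lambda>u. 1"])
    show "AE u in P. (\<lambda>k. ramp (real k) (\<xi> j u)) \<longlonglongrightarrow> 0"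
    proof (intro AE_I2 tendsto_eventually)
      fix u
      have "\<forall>\<^sub>F k in sequentially. \<bar>\<xi> j u\<bar> \<le> real k"
        using filterlim_real_sequentially unfolding filterlim_at_top by auto
      then show "\<forall>\<^sub>F k in sequentially. ramp (real k) (\<xi> j u) = 0"
        by eventually_elim (simp add: ramp_def)
    qed
  qed (use ramp_bound in auto)
  then have "\<forall>\<^sub>F k in sequentially. P.expectation (\<lambda>u. ramp (real k) (\<xi> j u)) < \<eta>"
    using eta by (intro order_tendstoD(2)[of _ 0]) (simp_all only: integral_zero)
  then obtain K :: real where K: "P.expectation (\<lambda>u. ramp K (\<xi> j u)) < \<eta>"
    unfolding eventually_sequentially by (meson le_refl)
  have "(\<lambda>n. expectation (\<lambda>\<omega>. ramp K (Y n j \<omega>))) \<longlonglongrightarrow> P.expectation (\<lambda>u. ramp K (\<xi> j u))"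
    using weak_conv_vec_continuous[OF conv _ _ ramp_cont ramp_bound(1), of "{j}" K "\<lambda>_. 1"] j
    by (simp add: integral_distr)
  from order_tendstoD(2)[OF this K]
  have "\<forall>\<^sub>F n in sequentially. prob {\<omega>\<in>space M. \<bar>Y n j \<omega>\<bar> > K + 1} \<le> \<eta>"
  proof eventually_elim
    case (elim n)
    have "prob {\<omega>\<in>space M. \<bar>Y n j \<omega>\<bar> > K + 1} \<le> prob {\<omega>\<in>space M. ramp K (Y n j \<omega>) \<ge> 1}"
      by (intro finite_measure_mono) (auto simp: ramp_def)
    also have "\<dots> \<le> expectation (\<lambda>\<omega>. ramp K (Y n j \<omega>)) / 1"
      using ramp_bound
      by (intro integral_Markov_inequality_measure[where A = "{}"])
        (auto intro!: integrable_const_bound[where B = 1])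
    finally show ?case using elim by simp
  qed
  then show "\<exists>K. \<forall>\<^sub>F n in sequentially. prob {\<omega>\<in>space M. \<bar>Y n j \<omega>\<bar> > K} \<le> \<eta>" by blast
qed

section \<open>Signed sums of errors\<close>

lemma indep_rv_measurable:
  "indep_rv M A U B V \<Longrightarrow> U \<in> measurable M A" "indep_rv M A U B V \<Longrightarrow> V \<in> measurable M B"
  by (auto simp: indep_rv_def)

text \<open>The product form of the joint law gives access to Fubini's theorem, which replaces
  conditioning on the design.\<close>

lemma (in prob_space) indep_rv_distr_pair:
  assumes "indep_rv M A U B V"
  shows "distr M (A \<Otimes>\<^sub>M B) (\<lambda>\<omega>. (U \<omega>, V \<omega>)) = distr M A U \<Otimes>\<^sub>M distr M B V"
proof -
  note [measurable] = indep_rv_measurable[OF assms]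
  interpret A: prob_space "distr M A U" by (rule prob_space_distr) simp
  interpret B: prob_space "distr M B V" by (rule prob_space_distr) simp
  show ?thesis
  proof (rule pair_measure_eqI[symmetric])
    fix E F assume "E \<in> sets (distr M A U)" "F \<in> sets (distr M B V)"
    then have [measurable]: "E \<in> sets A" "F \<in> sets B" by auto
    have "prob ((U -` E \<inter> space M) \<inter> (V -` F \<inter> space M))
        = prob (U -` E \<inter> space M) * prob (V -` F \<inter> space M)"
      using assms unfolding indep_rv_def by (intro indep_setD) auto
    moreover have "(\<lambda>\<omega>. (U \<omega>, V \<omega>)) -` (E \<times> F) \<inter> space M = (U -` E \<inter> space M) \<inter> (V -` F \<inter> space M)"
      by auto
    ultimately show "emeasure (distr M A U) E * emeasure (distr M B V) F
        = emeasure (distr M (A \<Otimes>\<^sub>M B) (\<lambda>\<omega>. (U \<omega>, V \<omega>))) (E \<times> F)"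
      by (simp add: emeasure_distr emeasure_eq_measure ennreal_mult)
  qed (auto intro: A.sigma_finite_measure_axioms B.sigma_finite_measure_axioms)
qed

text \<open>Leads from \<open>indep_rv\<close>, whose two variables may differ in type, to the
  library's \<open>indep_var\<close>, once \<open>f\<close> and \<open>g\<close> have brought both
  into a common type. Preimage events are stable under intersection, so independence extends to the
  generated sigma-algebras.\<close>

lemma (in prob_space) indep_rv_compose:
  assumes "indep_rv M A U B V" and [measurable]: "f \<in> measurable A C" "g \<in> measurable B D"
  shows "indep_var C (\<lambda>\<omega>. f (U \<omega>)) D (\<lambda>\<omega>. g (V \<omega>))"
proof -
  note [measurable] = indep_rv_measurable[OF assms(1)]
  let ?E = "{(\<lambda>\<omega>. f (U \<omega>)) -` E \<inter> space M | E. E \<in> sets C}"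
  let ?F = "{(\<lambda>\<omega>. g (V \<omega>)) -` E \<inter> space M | E. E \<in> sets D}"
  have sub: "\<exists>F. (\<lambda>\<omega>. h (W \<omega>)) -` E \<inter> space M = W -` F \<inter> space M \<and> F \<in> sets K"
    if "h \<in> measurable K L" "W \<in> measurable M K" "E \<in> sets L" for h K L W E
    using that measurable_space[OF that(2)]
    by (intro exI[of _ "h -` E \<inter> space K"] conjI) (auto intro: measurable_sets)
  have "indep_set ?E ?F"
    using assms unfolding indep_rv_def
    by (intro indep_setI) (auto intro!: indep_setD sub[OF assms(2) indep_rv_measurable(1)[OF assms(1)]]
        sub[OF assms(3) indep_rv_measurable(2)[OF assms(1)]])
  moreover have "Int_stable {W -` E \<inter> space M | E. E \<in> sets L}" for W :: "'a \<Rightarrow> 'z" and L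
  proof (rule Int_stableI)
    fix a b assume "a \<in> {W -` E \<inter> space M | E. E \<in> sets L}" "b \<in> {W -` E \<inter> space M | E. E \<in> sets L}"
    then obtain E F where "a = W -` E \<inter> space M" "b = W -` F \<inter> space M" "E \<in> sets L" "F \<in> sets L" by auto
    then show "a \<inter> b \<in> {W -` E \<inter> space M | E. E \<in> sets L}"
      by (intro CollectI exI[of _ "E \<inter> F"]) auto
  qed
  ultimately show ?thesis
    unfolding indep_var_eq by (auto intro!: indep_set_sigma_sets)
qed

lemma (in prob_space) indep_rv_integral_mult:
  fixes f :: "'b \<Rightarrow> real" and g :: "'c \<Rightarrow> real"
  assumes "indep_rv M A U B V" "f \<in> borel_measurable A" "g \<in> borel_measurable B"
    and "integrable M (\<lambda>\<omega>. f (U \<omega>))" "integrable M (\<lambda>\<omega>. g (V \<omega>))"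
  shows "expectation (\<lambda>\<omega>. f (U \<omega>) * g (V \<omega>)) = expectation (\<lambda>\<omega>. f (U \<omega>)) * expectation (\<lambda>\<omega>. g (V \<omega>))"
    and "integrable M (\<lambda>\<omega>. f (U \<omega>) * g (V \<omega>))"
  using indep_var_lebesgue_integral[OF indep_rv_compose[OF assms(1-3)] assms(4,5)]
    indep_var_integrable[OF indep_rv_compose[OF assms(1-3)] assms(4,5)] by auto

text \<open>
  Given the signs, the characteristic function of the signed sum of errors is a product of
  values at \<open>t / sqrt n\<close> and \<open>- t / sqrt n\<close>; the quadratic Taylor bound is the same for
  both, so it holds uniformly in the signs.
\<close>

lemma (in prob_space) char_signed_sum_approx:
  fixes eps :: "nat \<Rightarrow> 'a \<Rightarrow> real" and \<sigma> t :: real and v :: "'b \<Rightarrow> real" and s :: "nat \<Rightarrow> 'b \<Rightarrow> real"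
  assumes indep: "indep_rv M A U (real_vec_space {..<n}) (random_vec {..<n} eps)"
    and eps: "indep_vars (\<lambda>_. borel) eps UNIV"
    and ident: "\<And>i. distr M borel (eps i) = distr M borel (eps 0)"
    and sq: "\<And>i. integrable M (\<lambda>\<omega>. (eps i \<omega>)\<^sup>2)"
    and mean: "\<And>i. expectation (eps i) = 0"
    and var: "\<And>i. variance (eps i) = \<sigma>\<^sup>2"
    and v[measurable]: "v \<in> borel_measurable A"
    and s: "\<And>i. i < n \<Longrightarrow> s i \<in> borel_measurable A"
    and signs: "\<And>i a. i < n \<Longrightarrow> a \<in> space A \<Longrightarrow> \<bar>s i a\<bar> = 1"
    and n: "n > 0" "t\<^sup>2 * \<sigma>\<^sup>2 \<le> 4 * real n"
  shows "norm (char (distr M borel (\<lambda>\<omega>. v (U \<omega>) + (\<Sum>i<n. s i (U \<omega>) * eps i \<omega>) / sqrt (real n))) t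
      - of_real ((1 + (- (t\<^sup>2 * \<sigma>\<^sup>2 / 2)) / real n) ^ n) * char (distr M borel (\<lambda>\<omega>. v (U \<omega>))) t)
    \<le> t\<^sup>2 / 6 * expectation (\<lambda>\<omega>. min (6 * (eps 0 \<omega>)\<^sup>2) (\<bar>t\<bar> / sqrt (real n) * \<bar>eps 0 \<omega>\<bar> ^ 3))"
    (is "norm (?lhs - of_real ?c * ?rhs) \<le> t\<^sup>2 / 6 * ?R")
proof -
  note [measurable] = indep_rv_measurable[OF indep] s
  have rv[measurable]: "eps i \<in> borel_measurable M" for i
    using eps by (auto simp: indep_vars_def2)
  have int[simp]: "integrable M (eps i)" for i
    by (rule square_integrable_imp_integrable[OF rv sq])
  let ?B = "real_vec_space {..<n}" and ?e = "random_vec {..<n} eps"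
  define \<mu> where "\<mu> = distr M borel (eps 0)"
  define \<phi> where "\<phi> = char (distr M borel (eps 0))"
  define r where "r = sqrt (real n)"
  have r: "r > 0" "r\<^sup>2 = real n" using n by (auto simp: r_def)
  interpret e0: real_distribution "distr M borel (eps 0)" by simp
  have \<phi>[measurable]: "\<phi> \<in> borel_measurable borel" "norm (\<phi> y) \<le> 1" for y
    unfolding \<phi>_def by (auto intro: e0.cmod_char_le_1)
  interpret A: prob_space "distr M A U" by (rule prob_space_distr) simp
  interpret B: prob_space "distr M ?B ?e" by (rule prob_space_distr) simp
  interpret AB: pair_prob_space "distr M A U" "distr M ?B ?e" ..
  define L where "L a b = v a + (\<Sum>i<n. s i a * b i) / r" for a b
  have comp[measurable]: "(\<lambda>b. b i) \<in> borel_measurable ?B" if "i < n" for i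
    using that by (intro measurable_component_singleton) auto
  have L_pair[measurable]: "(\<lambda>(a, b). L a b) \<in> borel_measurable (A \<Otimes>\<^sub>M ?B)"
    unfolding L_def split_beta
    by (intro borel_measurable_add borel_measurable_divide borel_measurable_sum borel_measurable_times
        measurable_compose[OF measurable_fst v] measurable_compose[OF measurable_fst s]
        measurable_compose[OF measurable_snd comp]) auto
  let ?K = "\<lambda>(a, b). iexp (t * L a b)"
  have K_meas: "?K \<in> borel_measurable (A \<Otimes>\<^sub>M ?B)"
    using L_pair unfolding split_beta by measurable
  have L_eps: "L a (?e \<omega>) = v a + (\<Sum>i<n. s i a / r * eps i \<omega>)" for a \<omega>
    by (simp add: L_def sum_divide_distrib)
  have scaled: "char (distr M borel (\<lambda>\<omega>. c * eps i \<omega>)) t = \<phi> (t * c)" for i c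
    unfolding \<phi>_def ident[of i, symmetric] char_def
    by (simp add: integral_distr mult.assoc)
  have "?lhs = expectation (\<lambda>\<omega>. iexp (t * L (U \<omega>) (?e \<omega>)))"
    unfolding char_def r_def[symmetric]
    by (subst integral_distr) (simp_all add: L_def del: of_real_mult)
  also have "\<dots> = integral\<^sup>L (distr M (A \<Otimes>\<^sub>M ?B) (\<lambda>\<omega>. (U \<omega>, ?e \<omega>))) ?K"
    using K_meas by (subst integral_distr) auto
  also have "\<dots> = integral\<^sup>L (distr M A U \<Otimes>\<^sub>M distr M ?B ?e) ?K"
    by (simp only: indep_rv_distr_pair[OF indep])
  \<comment> \<open>From here on the design value \<open>a\<close> is fixed inside the inner
    integral, so the signs are constants and the errors remain i.i.d.\<close>
  also have "\<dots> = (\<integral>a. (\<integral>b. ?K (a, b) \<partial>distr M ?B ?e) \<partial>distr M A U)"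
  proof (rule AB.integral_fst'[symmetric])
    show "integrable (distr M A U \<Otimes>\<^sub>M distr M ?B ?e) ?K"
      using K_meas
      by (intro AB.integrable_const_bound[where B = 1]) (auto simp: split_beta cong: measurable_cong_sets)
  qed
  also have "\<dots> = (\<integral>a. iexp (t * v a) * (\<Prod>i<n. \<phi> (t * s i a / r)) \<partial>distr M A U)"
  proof (rule Bochner_Integration.integral_cong[OF refl])
    fix a assume "a \<in> space (distr M A U)"
    then have a: "a \<in> space A" by simp
    have "(\<lambda>b. iexp (t * L a b)) \<in> borel_measurable ?B"
      using measurable_compose[OF measurable_Pair1'[OF a] K_meas] by simp
    then have "(\<integral>b. ?K (a, b) \<partial>distr M ?B ?e) = expectation (\<lambda>\<omega>. iexp (t * L a (?e \<omega>)))"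
      by (subst integral_distr) auto
    also have "\<dots> = expectation (\<lambda>\<omega>. iexp (t * v a) * iexp (t * (\<Sum>i<n. s i a / r * eps i \<omega>)))"
      unfolding L_eps by (simp add: distrib_left flip: exp_add)
    also have "\<dots> = iexp (t * v a) * char (distr M borel (\<lambda>\<omega>. \<Sum>i<n. s i a / r * eps i \<omega>)) t"
      unfolding char_def by (subst integral_distr) (simp_all del: of_real_mult)
    also have "char (distr M borel (\<lambda>\<omega>. \<Sum>i<n. s i a / r * eps i \<omega>)) t
        = (\<Prod>i<n. char (distr M borel (\<lambda>\<omega>. s i a / r * eps i \<omega>)) t)"
      by (rule char_distr_sum)
        (rule indep_vars_compose2[where X = eps, OF indep_vars_subset[OF eps]], auto)
    also have "\<dots> = (\<Prod>i<n. \<phi> (t * s i a / r))"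
      unfolding scaled by simp
    finally show "(\<integral>b. ?K (a, b) \<partial>distr M ?B ?e) = iexp (t * v a) * (\<Prod>i<n. \<phi> (t * s i a / r))" .
  qed
  finally have lhs: "?lhs = (\<integral>a. iexp (t * v a) * (\<Prod>i<n. \<phi> (t * s i a / r)) \<partial>distr M A U)" .
  have rhs: "?rhs = (\<integral>a. iexp (t * v a) \<partial>distr M A U)"
    unfolding char_def by (simp add: integral_distr del: of_real_mult)
  have prod_meas: "(\<lambda>a. \<Prod>i<n. \<phi> (t * s i a / r)) \<in> borel_measurable A"
    by (intro borel_measurable_prod measurable_compose[OF _ \<phi>(1)] borel_measurable_divide
        borel_measurable_times s) auto
  have prod_le: "norm (\<Prod>i<n. \<phi> (t * s i a / r)) \<le> 1" for a
    unfolding prod_norm[symmetric] by (intro prod_le_1) (auto intro: \<phi>(2))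
  have int1: "integrable (distr M A U) (\<lambda>a. iexp (t * v a) * (\<Prod>i<n. \<phi> (t * s i a / r)))"
    using prod_meas prod_le
    by (intro A.integrable_const_bound[where B = 1]) (auto simp: norm_mult cong: measurable_cong_sets)
  have int2: "integrable (distr M A U) (\<lambda>a. iexp (t * v a))"
    by (intro A.integrable_const_bound[where B = 1]) (auto cong: measurable_cong_sets)
  have approx: "norm ((\<Prod>i<n. \<phi> (t * s i a / r)) - of_real ?c) \<le> t\<^sup>2 / 6 * ?R" if a: "a \<in> space A" for a
  proof -
    let ?q = "1 + (- (t\<^sup>2 * \<sigma>\<^sup>2 / 2)) / real n"
    \<comment> \<open>The bound of a difference of products by the sum of the differences requires
      all factors in the closed unit disc; this is where
      \<open>t\<^sup>2 * \<sigma>\<^sup>2 \<le> 4 * real n\<close> enters.\<close>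
    have q: "norm (of_real ?q :: complex) \<le> 1"
    proof -
      have "t\<^sup>2 * \<sigma>\<^sup>2 / 2 / real n \<le> 2" using n by (simp add: field_simps)
      moreover have "0 \<le> t\<^sup>2 * \<sigma>\<^sup>2 / 2 / real n" by simp
      ultimately have "\<bar>?q\<bar> \<le> 1" by linarith
      then show ?thesis by (simp only: norm_of_real)
    qed
    have each: "norm (\<phi> (t * s i a / r) - of_real ?q) \<le> t\<^sup>2 / real n / 6 * ?R" if i: "i < n" for i
    proof -
      have s2: "(s i a)\<^sup>2 = 1" using signs[OF i a] by (metis power2_abs power_one)
      then have u2: "(t * s i a / r)\<^sup>2 = t\<^sup>2 / real n" and u1: "\<bar>t * s i a / r\<bar> = \<bar>t\<bar> / r"
        using r signs[OF i a] by (auto simp: power_mult_distrib power_divide abs_mult)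
      have "norm (char \<mu> (t * s i a / r) - of_real (1 - (t * s i a / r)\<^sup>2 * \<sigma>\<^sup>2 / 2)) \<le>
         ((t * s i a / r)\<^sup>2 / 6) * expectation (\<lambda>\<omega>. min (6 * (eps 0 \<omega>)\<^sup>2) (\<bar>t * s i a / r\<bar> * \<bar>eps 0 \<omega>\<bar> ^ 3))"
        by (rule char_approx3'[OF rv int sq mean var \<mu>_def])
      then show ?thesis unfolding u1 u2 \<phi>_def \<mu>_def by (simp add: r_def mult.commute)
    qed
    have "norm ((\<Prod>i<n. \<phi> (t * s i a / r)) - (\<Prod>i<n. of_real ?q))
        \<le> (\<Sum>i<n. norm (\<phi> (t * s i a / r) - of_real ?q))"
      by (intro norm_prod_diff \<phi>(2) q)
    also have "\<dots> \<le> (\<Sum>i<n. t\<^sup>2 / real n / 6 * ?R)" by (intro sum_mono each) simp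
    also have "\<dots> = t\<^sup>2 / 6 * ?R" using n by simp
    finally show ?thesis by simp
  qed
  \<comment> \<open>The approximation error for a fixed design. The factor
    \<open>iexp (t * v a)\<close> has modulus one, so the bound on \<open>D\<close> carries over to
    the integral whatever \<open>v\<close> is.\<close>
  define D where "D a = (\<Prod>i<n. \<phi> (t * s i a / r)) - of_real ?c" for a
  have int3: "integrable (distr M A U) (\<lambda>a. iexp (t * v a) * D a)"
    using Bochner_Integration.integrable_diff[OF int1 integrable_mult_left[OF int2, of "of_real ?c"]]
    by (simp only: right_diff_distrib D_def)
  have "?lhs - of_real ?c * ?rhs = (\<integral>a. iexp (t * v a) * D a \<partial>distr M A U)"
    unfolding lhs rhs D_def right_diff_distrib
    using int1 int2 by (subst Bochner_Integration.integral_diff) (auto simp: mult.commute)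
  also have "norm \<dots> \<le> (\<integral>a. norm (iexp (t * v a) * D a) \<partial>distr M A U)"
    by (rule integral_norm_bound)
  also have "\<dots> = (\<integral>a. norm (D a) \<partial>distr M A U)"
    by (simp add: norm_mult)
  also have "\<dots> \<le> t\<^sup>2 / 6 * ?R"
  proof (rule A.integral_le_const)
    show "integrable (distr M A U) (\<lambda>a. norm (D a))"
      using integrable_norm[OF int3] by (simp add: norm_mult)
    show "AE a in distr M A U. norm (D a) \<le> t\<^sup>2 / 6 * ?R"
      using approx unfolding D_def by (intro AE_I2) (simp only: space_distr)
  qed
  finally show ?thesis .
qed

text \<open>Only the characteristic function of \<open>v n (U n \<omega>)\<close> itself has to
  converge. Its dependence on the signs is harmless because the approximation of the error part is
  uniform in them.\<close>

lemma (in prob_space) char_signed_sum_tendsto: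
  fixes eps :: "nat \<Rightarrow> 'a \<Rightarrow> real" and \<sigma> t :: real
    and v :: "nat \<Rightarrow> 'b \<Rightarrow> real" and s :: "nat \<Rightarrow> nat \<Rightarrow> 'b \<Rightarrow> real" and U :: "nat \<Rightarrow> 'a \<Rightarrow> 'b"
  assumes indep: "\<And>n. indep_rv M (A n) (U n) (real_vec_space {..<n}) (random_vec {..<n} eps)"
    and eps: "indep_vars (\<lambda>_. borel) eps UNIV"
    and ident: "\<And>i. distr M borel (eps i) = distr M borel (eps 0)"
    and sq: "\<And>i. integrable M (\<lambda>\<omega>. (eps i \<omega>)\<^sup>2)"
    and mean: "\<And>i. expectation (eps i) = 0"
    and var: "\<And>i. variance (eps i) = \<sigma>\<^sup>2"
    and v: "\<And>n. v n \<in> borel_measurable (A n)"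
    and s: "\<And>n i. i < n \<Longrightarrow> s n i \<in> borel_measurable (A n)"
    and signs: "\<And>n i a. i < n \<Longrightarrow> a \<in> space (A n) \<Longrightarrow> \<bar>s n i a\<bar> = 1"
    and lim: "(\<lambda>n. char (distr M borel (\<lambda>\<omega>. v n (U n \<omega>))) t) \<longlonglongrightarrow> c0"
  shows "(\<lambda>n. char (distr M borel
      (\<lambda>\<omega>. v n (U n \<omega>) + (\<Sum>i<n. s n i (U n \<omega>) * eps i \<omega>) / sqrt (real n))) t)
    \<longlonglongrightarrow> of_real (exp (- (t\<^sup>2 * \<sigma>\<^sup>2 / 2))) * c0"
proof -
  have rv[measurable]: "eps i \<in> borel_measurable M" for i
    using eps by (auto simp: indep_vars_def2)
  let ?X = "\<lambda>n. char (distr M borel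
      (\<lambda>\<omega>. v n (U n \<omega>) + (\<Sum>i<n. s n i (U n \<omega>) * eps i \<omega>) / sqrt (real n))) t"
  let ?c = "\<lambda>n. (1 + (- (t\<^sup>2 * \<sigma>\<^sup>2 / 2)) / real n) ^ n"
  let ?R = "\<lambda>n. expectation (\<lambda>\<omega>. min (6 * (eps 0 \<omega>)\<^sup>2) (\<bar>t\<bar> / sqrt (real n) * \<bar>eps 0 \<omega>\<bar> ^ 3))"
  \<comment> \<open>Pointwise the cubic branch of the minimum tends to 0, while the quadratic branch
    is an integrable majorant; so two moments suffice, as in Lindeberg's argument.\<close>
  have "?R \<longlonglongrightarrow> expectation (\<lambda>\<omega>. 0)"
  proof (rule integral_dominated_convergence[where w = "\<lambda>\<omega>. 6 * (eps 0 \<omega>)\<^sup>2"])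
    have "(\<lambda>n. 1 / sqrt (real n)) \<longlonglongrightarrow> 0" by real_asymp
    from tendsto_mult_left_zero[OF tendsto_mult_right_zero[OF this]]
    have "(\<lambda>n. \<bar>t\<bar> / sqrt (real n) * y) \<longlonglongrightarrow> 0" for y
      by simp
    then have "(\<lambda>n. min (6 * (eps 0 \<omega>)\<^sup>2) (\<bar>t\<bar> / sqrt (real n) * \<bar>eps 0 \<omega>\<bar> ^ 3)) \<longlonglongrightarrow> min (6 * (eps 0 \<omega>)\<^sup>2) 0" for \<omega>
      by (intro tendsto_min tendsto_const)
    then show "AE \<omega> in M. (\<lambda>n. min (6 * (eps 0 \<omega>)\<^sup>2) (\<bar>t\<bar> / sqrt (real n) * \<bar>eps 0 \<omega>\<bar> ^ 3)) \<longlonglongrightarrow> 0"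
      by (simp add: min_absorb2)
    show "AE \<omega> in M. norm (min (6 * (eps 0 \<omega>)\<^sup>2) (\<bar>t\<bar> / sqrt (real n) * \<bar>eps 0 \<omega>\<bar> ^ 3)) \<le> 6 * (eps 0 \<omega>)\<^sup>2" for n
      by (intro AE_I2) (simp add: abs_of_nonneg)
    show "integrable M (\<lambda>\<omega>. 6 * (eps 0 \<omega>)\<^sup>2)" using sq[of 0] by simp
  qed measurable
  then have R: "(\<lambda>n. t\<^sup>2 / 6 * ?R n) \<longlonglongrightarrow> 0"
    by (intro tendsto_mult_right_zero) simp
  have "\<forall>\<^sub>F n in sequentially. real n \<ge> t\<^sup>2 * \<sigma>\<^sup>2 / 4"
    using filterlim_real_sequentially unfolding filterlim_at_top by blast
  then have "\<forall>\<^sub>F n in sequentially. norm (?X n - of_real (?c n) * char (distr M borel (\<lambda>\<omega>. v n (U n \<omega>))) t)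
      \<le> t\<^sup>2 / 6 * ?R n"
    using eventually_gt_at_top[of 0]
  proof eventually_elim
    case (elim n)
    have "t\<^sup>2 * \<sigma>\<^sup>2 \<le> 4 * real n" using elim(1) by simp
    from char_signed_sum_approx[where v = "v n" and s = "s n", OF indep[of n] eps ident sq mean var v[of n] s signs elim(2) this]
    show ?case by blast
  qed
  then have 1: "(\<lambda>n. ?X n - of_real (?c n) * char (distr M borel (\<lambda>\<omega>. v n (U n \<omega>))) t) \<longlonglongrightarrow> 0"
    by (rule Lim_null_comparison[OF _ R])
  have 2: "(\<lambda>n. of_real (?c n) * char (distr M borel (\<lambda>\<omega>. v n (U n \<omega>))) t)
      \<longlonglongrightarrow> complex_of_real (exp (- (t\<^sup>2 * \<sigma>\<^sup>2 / 2))) * c0"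
    by (intro tendsto_mult lim tendsto_of_real tendsto_exp_limit_sequentially)
  show ?thesis using tendsto_add[OF 1 2] by (simp only: diff_add_cancel add_0_left)
qed

lemma (in prob_space) char_affine:
  assumes [measurable]: "f \<in> borel_measurable M"
  shows "char (distr M borel (\<lambda>\<omega>. a + b * f \<omega>)) t = iexp (t * a) * char (distr M borel f) (b * t)"
proof -
  have "char (distr M borel (\<lambda>\<omega>. a + b * f \<omega>)) t = (CLINT \<omega>|M. iexp (t * a) * iexp (b * t * f \<omega>))"
    unfolding char_def by (subst integral_distr) (simp_all add: exp_add[symmetric] algebra_simps)
  also have "\<dots> = iexp (t * a) * char (distr M borel f) (b * t)"
    unfolding char_def by (subst integral_distr) (simp_all del: of_real_mult)
  finally show ?thesis .
qed

section \<open>The randomized experiment\<close>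

text \<open>Three spaces related only through laws: \<open>M\<close> carries the experiments,
  \<open>N\<close> a generic covariate vector, \<open>P\<close> the limit \<xi>. The covariates and
  errors form one sequence, whereas \<open>T\<close> has the extra index \<open>n\<close>, since all
  assignments may change with the sample size.\<close>

locale covariate_adaptive_experiment =
  prob_space M + N: prob_space N + P: prob_space P
  for M :: "'w measure" and N :: "'v measure" and P :: "'u measure" +
  fixes p q :: nat
    and X :: "nat \<Rightarrow> 'v \<Rightarrow> real"
    and x :: "nat \<Rightarrow> nat \<Rightarrow> 'w \<Rightarrow> real"
    and T :: "nat \<Rightarrow> nat \<Rightarrow> 'w \<Rightarrow> real"
    and eps :: "nat \<Rightarrow> 'w \<Rightarrow> real"
    and \<sigma> :: real
    and \<xi> :: "nat \<Rightarrow> 'u \<Rightarrow> real"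
  assumes X_indep: "N.indep_vars (\<lambda>_. borel) X {..<p + q}"
    and X_square: "\<And>j. j < p + q \<Longrightarrow> integrable N (\<lambda>v. (X j v)\<^sup>2)"
    and X_mean: "\<And>j. j < p + q \<Longrightarrow> N.expectation (X j) = 0"
    and X_var: "\<And>j. j < p + q \<Longrightarrow> 0 < N.variance (X j)"
    and x_indep: "indep_vars (\<lambda>_. real_vec_space {..<p + q}) (\<lambda>i. random_vec {..<p + q} (x i)) UNIV"
    and x_law: "\<And>i. distr M (real_vec_space {..<p + q}) (random_vec {..<p + q} (x i)) =
      distr N (real_vec_space {..<p + q}) (random_vec {..<p + q} X)"
    and eps_indep: "indep_vars (\<lambda>_. borel) eps UNIV"
    and eps_ident: "\<And>i. distr M borel (eps i) = distr M borel (eps 0)"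
    and eps_square: "\<And>i. integrable M (\<lambda>\<omega>. (eps i \<omega>)\<^sup>2)"
    and eps_mean: "\<And>i. expectation (eps i) = 0"
    and eps_var: "\<And>i. variance (eps i) = \<sigma>\<^sup>2"
    and sigma_pos: "0 < \<sigma>"
    and T_meas: "\<And>n i. i < n \<Longrightarrow> T n i \<in> borel_measurable M"
    and T_01: "\<And>n i \<omega>. i < n \<Longrightarrow> \<omega> \<in> space M \<Longrightarrow> T n i \<omega> \<in> {0, 1}"
    and design_indep_eps: "\<And>n. indep_rv M
      (real_vec_space {..<n} \<Otimes>\<^sub>M real_vec_space ({..<n} \<times> {..<p + q}))
      (\<lambda>\<omega>. (random_vec {..<n} (T n) \<omega>, random_vec ({..<n} \<times> {..<p + q}) (\<lambda>(i, j). x i j) \<omega>))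
      (real_vec_space {..<n}) (random_vec {..<n} eps)"
    and global_balance: "conv_in_prob M (\<lambda>n \<omega>. (\<Sum>i<n. 2 * T n i \<omega> - 1) / real n) 0"
    and xi_integrable: "\<And>j. j < p + q \<Longrightarrow> integrable P (\<xi> j)"
    and covariate_balance: "weak_conv_vec {..<p + q}
      (\<lambda>n. distr M (real_vec_space {..<p + q})
        (random_vec {..<p + q} (\<lambda>j \<omega>. (\<Sum>i<n. (2 * T n i \<omega> - 1) * x i j \<omega>) / sqrt (real n))))
      (distr P (real_vec_space {..<p + q}) (random_vec {..<p + q} \<xi>))"
begin

abbreviation "design_space n \<equiv> real_vec_space {..<n} \<Otimes>\<^sub>M real_vec_space ({..<n} \<times> {..<p + q})"

abbreviation design :: "nat \<Rightarrow> 'w \<Rightarrow> (nat \<Rightarrow> real) \<times> (nat \<times> nat \<Rightarrow> real)" where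
  "design n \<equiv> (\<lambda>\<omega>. (random_vec {..<n} (T n) \<omega>,
     random_vec ({..<n} \<times> {..<p + q}) (\<lambda>(i, j). x i j) \<omega>))"

section \<open>Moments and averages of covariates and errors\<close>

definition var_X :: "nat \<Rightarrow> real" where "var_X j = N.variance (X j)"

lemma var_X_pos: "j < p + q \<Longrightarrow> 0 < var_X j"
  using X_var by (simp add: var_X_def)

lemma X_meas[measurable]: "j < p + q \<Longrightarrow> X j \<in> borel_measurable N"
  using X_indep by (auto simp: N.indep_vars_def2)

lemma X_integrable: "j < p + q \<Longrightarrow> integrable N (X j)"
  using N.square_integrable_imp_integrable[OF X_meas X_square] by simp

lemma var_X_eq: "j < p + q \<Longrightarrow> N.expectation (\<lambda>v. (X j v)\<^sup>2) = var_X j"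
  by (simp add: var_X_def X_mean)

lemma X_product:
  assumes "j < p + q" "k < p + q"
  shows "integrable N (\<lambda>v. X j v * X k v)"
    and "N.expectation (\<lambda>v. X j v * X k v) = (if j = k then var_X j else 0)"
proof -
  show "integrable N (\<lambda>v. X j v * X k v)"
    using assms by (intro integrable_mult_of_square_integrable X_square) auto
  show "N.expectation (\<lambda>v. X j v * X k v) = (if j = k then var_X j else 0)"
    using N.indep_vars_integral_mult(1)[OF X_indep, of j k] assms var_X_eq[of j]
    by (auto simp: X_integrable X_mean power2_eq_square)
qed

text \<open>Fourth moments may be infinite, but for distinct covariates the square of the product is
  a product of independent integrable variables.\<close>

lemma X_product_square:
  assumes "j < p + q" "k < p + q" "j \<noteq> k"
  shows "integrable N (\<lambda>v. (X j v * X k v)\<^sup>2)"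
proof -
  have "N.indep_vars (\<lambda>_. borel) (\<lambda>j v. (X j v)\<^sup>2) {..<p + q}"
    by (rule N.indep_vars_compose2[OF X_indep]) simp
  from N.indep_vars_integral_mult(2)[OF this, of j k] show ?thesis
    using assms by (simp add: X_square power_mult_distrib)
qed

lemma x_vec_meas: "random_vec {..<p + q} (x i) \<in> measurable M (real_vec_space {..<p + q})"
  using x_indep by (auto simp: indep_vars_def2)

lemma coordinate_meas: "j \<in> I \<Longrightarrow> (\<lambda>y. y j) \<in> borel_measurable (real_vec_space I)"
  by (rule measurable_component_singleton)

lemma x_meas[measurable]: "j < p + q \<Longrightarrow> x i j \<in> borel_measurable M"
  using measurable_compose[OF x_vec_meas coordinate_meas, of j i] by simp

text \<open>The units' covariates are known only through the joint law of their vector, so every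
  moment is computed on \<open>N\<close> as that of a functional \<open>h\<close> of the
  vector.\<close>

lemma x_transfer:
  fixes h :: "(nat \<Rightarrow> real) \<Rightarrow> real"
  assumes h: "h \<in> borel_measurable (real_vec_space {..<p + q})"
  shows "integrable M (\<lambda>\<omega>. h (random_vec {..<p + q} (x i) \<omega>)) \<longleftrightarrow>
      integrable N (\<lambda>v. h (random_vec {..<p + q} X v))"
    and "expectation (\<lambda>\<omega>. h (random_vec {..<p + q} (x i) \<omega>)) =
      N.expectation (\<lambda>v. h (random_vec {..<p + q} X v))"
    and "distr M borel (\<lambda>\<omega>. h (random_vec {..<p + q} (x i) \<omega>)) =
      distr N borel (\<lambda>v. h (random_vec {..<p + q} X v))"
proof -
  have X: "random_vec {..<p + q} X \<in> measurable N (real_vec_space {..<p + q})"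
    by (intro measurable_restrict) simp
  show "integrable M (\<lambda>\<omega>. h (random_vec {..<p + q} (x i) \<omega>)) \<longleftrightarrow>
      integrable N (\<lambda>v. h (random_vec {..<p + q} X v))"
    using integrable_distr_eq[OF x_vec_meas h, of i] integrable_distr_eq[OF X h] x_law[of i] by simp
  show "expectation (\<lambda>\<omega>. h (random_vec {..<p + q} (x i) \<omega>)) =
      N.expectation (\<lambda>v. h (random_vec {..<p + q} X v))"
    using integral_distr[OF x_vec_meas h, of i] integral_distr[OF X h] x_law[of i] by simp
  show "distr M borel (\<lambda>\<omega>. h (random_vec {..<p + q} (x i) \<omega>)) =
      distr N borel (\<lambda>v. h (random_vec {..<p + q} X v))"
    using distr_distr[OF h x_vec_meas, of i] distr_distr[OF h X] x_law[of i] by (simp add: comp_def)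
qed

lemma product_meas:
  "j < p + q \<Longrightarrow> k < p + q \<Longrightarrow> (\<lambda>y. y j * y k :: real) \<in> borel_measurable (real_vec_space {..<p + q})"
  by (intro borel_measurable_times coordinate_meas) auto

lemma x_product:
  assumes "j < p + q" "k < p + q"
  shows "integrable M (\<lambda>\<omega>. x i j \<omega> * x i k \<omega>)"
    and "expectation (\<lambda>\<omega>. x i j \<omega> * x i k \<omega>) = (if j = k then var_X j else 0)"
  using x_transfer[OF product_meas[OF assms], of i] X_product[OF assms] assms by auto

lemma x_moments:
  assumes "j < p + q"
  shows "integrable M (x i j)" "expectation (x i j) = 0"
    "integrable M (\<lambda>\<omega>. (x i j \<omega>)\<^sup>2)" "expectation (\<lambda>\<omega>. (x i j \<omega>)\<^sup>2) = var_X j"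
proof -
  show "integrable M (x i j)" "expectation (x i j) = 0"
    using x_transfer[OF coordinate_meas, of j i] assms X_mean X_integrable by auto
  show "integrable M (\<lambda>\<omega>. (x i j \<omega>)\<^sup>2)" "expectation (\<lambda>\<omega>. (x i j \<omega>)\<^sup>2) = var_X j"
    using x_product[OF assms assms, of i] by (simp_all add: power2_eq_square)
qed

lemma x_functional_indep:
  assumes "h \<in> borel_measurable (real_vec_space {..<p + q})"
  shows "indep_vars (\<lambda>_. borel) (\<lambda>i \<omega>. h (random_vec {..<p + q} (x i) \<omega>)) UNIV"
  using assms by (intro indep_vars_compose2[OF x_indep]) auto

text \<open>On the diagonal the summands are squares without a guaranteed second moment, so
  Chebyshev's inequality alone would not do and the truncated weak law is invoked.\<close>

lemma mean_x_product:
  assumes "j < p + q" "k < p + q"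
  shows "((\<lambda>z. (\<Sum>i<fst z. x i j (snd z) * x i k (snd z)) / real (fst z))
    \<longlongrightarrow> (if j = k then var_X j else 0)) (in_probability M)"
proof -
  have eq: "(\<lambda>\<omega>. random_vec {..<p + q} (x i) \<omega> j * random_vec {..<p + q} (x i) \<omega> k)
      = (\<lambda>\<omega>. x i j \<omega> * x i k \<omega>)" for i
    using assms by auto
  have "indep_vars (\<lambda>_. borel) (\<lambda>i \<omega>. x i j \<omega> * x i k \<omega>) UNIV"
    using x_functional_indep[OF product_meas[OF assms]] unfolding eq .
  from weak_law_of_large_numbers[OF this _ x_product(1)[OF assms]] show ?thesis
    using x_transfer(3)[OF product_meas[OF assms]] unfolding eq x_product(2)[OF assms] by auto
qed

lemma eps_meas[measurable]: "eps i \<in> borel_measurable M"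
  using eps_indep by (auto simp: indep_vars_def2)

lemma mean_eps_square:
  "((\<lambda>z. (\<Sum>i<fst z. (eps i (snd z))\<^sup>2) / real (fst z)) \<longlongrightarrow> \<sigma>\<^sup>2) (in_probability M)"
proof -
  have "indep_vars (\<lambda>_. borel) (\<lambda>i \<omega>. (eps i \<omega>)\<^sup>2) UNIV"
    by (rule indep_vars_compose2[OF eps_indep]) simp
  moreover have "distr M borel (\<lambda>\<omega>. (eps i \<omega>)\<^sup>2) = distr (distr M borel (eps i)) borel (\<lambda>y. y\<^sup>2)" for i
    by (subst distr_distr) (simp_all add: comp_def)
  then have "distr M borel (\<lambda>\<omega>. (eps i \<omega>)\<^sup>2) = distr M borel (\<lambda>\<omega>. (eps 0 \<omega>)\<^sup>2)" for i
    using eps_ident[of i] by (simp only:)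
  ultimately have "((\<lambda>z. (\<Sum>i<fst z. (eps i (snd z))\<^sup>2) / real (fst z))
      \<longlongrightarrow> expectation (\<lambda>\<omega>. (eps 0 \<omega>)\<^sup>2)) (in_probability M)"
    by (rule weak_law_of_large_numbers) (rule eps_square)
  then show ?thesis using eps_var[of 0] by (simp add: eps_mean)
qed

lemma eps_product:
  "integrable M (\<lambda>\<omega>. eps i \<omega> * eps j \<omega>)"
  "expectation (\<lambda>\<omega>. eps i \<omega> * eps j \<omega>) = (if i = j then \<sigma>\<^sup>2 else 0)"
proof -
  have int: "integrable M (eps i)" for i
    by (rule square_integrable_imp_integrable[OF eps_meas eps_square])
  show "integrable M (\<lambda>\<omega>. eps i \<omega> * eps j \<omega>)"
    by (intro integrable_mult_of_square_integrable eps_square) auto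
  show "expectation (\<lambda>\<omega>. eps i \<omega> * eps j \<omega>) = (if i = j then \<sigma>\<^sup>2 else 0)"
    using indep_vars_integral_mult(1)[OF eps_indep, of i j] eps_var[of i] int
    by (auto simp: eps_mean power2_eq_square)
qed

section \<open>Sums of order sqrt n\<close>

lemma sum_x_bounded:
  assumes "j < p + q"
  shows "stochastically_bounded M (\<lambda>z. (\<Sum>i<fst z. x i j (snd z)) / sqrt (real (fst z)))"
proof (rule stochastically_bounded_orthogonal[where Z = "\<lambda>n i. x i j"])
  have "indep_vars (\<lambda>_. borel) (\<lambda>i. x i j) UNIV"
    using x_functional_indep[OF coordinate_meas[of j]] assms by simp
  from indep_vars_integral_mult(1)[OF this]
  show "expectation (\<lambda>\<omega>. x i j \<omega> * x k j \<omega>) = 0" if "i \<noteq> k" for i k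
    using that x_moments[OF assms] by simp
qed (use x_moments[OF assms] assms in auto)

lemma sum_x_product_bounded:
  assumes "j < p + q" "k < p + q" "j \<noteq> k"
  shows "stochastically_bounded M (\<lambda>z. (\<Sum>i<fst z. x i j (snd z) * x i k (snd z)) / sqrt (real (fst z)))"
proof (rule stochastically_bounded_orthogonal[where Z = "\<lambda>n i \<omega>. x i j \<omega> * x i k \<omega>"])
  have "indep_vars (\<lambda>_. borel) (\<lambda>i \<omega>. x i j \<omega> * x i k \<omega>) UNIV"
    using x_functional_indep[OF product_meas[OF assms(1,2)]] assms by simp
  from indep_vars_integral_mult(1)[OF this]
  show "expectation (\<lambda>\<omega>. (x i j \<omega> * x i k \<omega>) * (x l j \<omega> * x l k \<omega>)) = 0" if "i \<noteq> l" for i l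
    using that x_product[OF assms(1,2)] assms by simp
  have sq: "(\<lambda>y. (y j * y k)\<^sup>2 :: real) \<in> borel_measurable (real_vec_space {..<p + q})"
    using product_meas[OF assms(1,2)] by measurable
  show "integrable M (\<lambda>\<omega>. (x i j \<omega> * x i k \<omega>)\<^sup>2)" for i
    using x_transfer(1)[OF sq, of i] X_product_square[OF assms] assms by simp
  show "expectation (\<lambda>\<omega>. (x i j \<omega> * x i k \<omega>)\<^sup>2) \<le> N.expectation (\<lambda>v. (X j v * X k v)\<^sup>2)" for i
    using x_transfer(2)[OF sq, of i] assms by simp
qed (use assms in measurable)

text \<open>The weight \<open>f n i\<close> may involve the whole design. Independence of design and
  errors factorizes the mixed moments, and the orthogonality of the errors removes them however the
  weights are correlated.\<close>

lemma sum_design_eps_bounded: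
  fixes f :: "nat \<Rightarrow> nat \<Rightarrow> (nat \<Rightarrow> real) \<times> (nat \<times> nat \<Rightarrow> real) \<Rightarrow> real"
  assumes f: "\<And>n i. i < n \<Longrightarrow> f n i \<in> borel_measurable (design_space n)"
    and sq: "\<And>n i. i < n \<Longrightarrow> integrable M (\<lambda>\<omega>. (f n i (design n \<omega>))\<^sup>2)"
    and C: "\<And>n i. i < n \<Longrightarrow> expectation (\<lambda>\<omega>. (f n i (design n \<omega>))\<^sup>2) \<le> C"
  shows "stochastically_bounded M
    (\<lambda>z. (\<Sum>i<fst z. f (fst z) i (design (fst z) (snd z)) * eps i (snd z)) / sqrt (real (fst z)))"
proof (rule stochastically_bounded_orthogonal[where Z = "\<lambda>n i \<omega>. f n i (design n \<omega>) * eps i \<omega>"])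
  have fd: "(\<lambda>\<omega>. f n i (design n \<omega>)) \<in> borel_measurable M" if "i < n" for n i
    by (rule measurable_compose[OF indep_rv_measurable(1)[OF design_indep_eps] f[OF that]])
  then show "(\<lambda>\<omega>. f n i (design n \<omega>) * eps i \<omega>) \<in> borel_measurable M" if "i < n" for n i
    using that by measurable
  have prod: "expectation (\<lambda>\<omega>. (f n i (design n \<omega>) * f n j (design n \<omega>)) * (eps i \<omega> * eps j \<omega>))
        = expectation (\<lambda>\<omega>. f n i (design n \<omega>) * f n j (design n \<omega>)) * expectation (\<lambda>\<omega>. eps i \<omega> * eps j \<omega>)"
      "integrable M (\<lambda>\<omega>. (f n i (design n \<omega>) * f n j (design n \<omega>)) * (eps i \<omega> * eps j \<omega>))"
    if ij: "i < n" "j < n" for n i j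
  proof -
    have ff: "(\<lambda>a. f n i a * f n j a) \<in> borel_measurable (design_space n)"
      using f[OF ij(1)] f[OF ij(2)] by measurable
    have ee: "(\<lambda>b. b i * b j :: real) \<in> borel_measurable (real_vec_space {..<n})"
      using ij by (intro borel_measurable_times coordinate_meas) auto
    have "integrable M (\<lambda>\<omega>. f n i (design n \<omega>) * f n j (design n \<omega>))"
      using ij fd sq by (intro integrable_mult_of_square_integrable) auto
    from indep_rv_integral_mult[OF design_indep_eps ff ee this]
    show "expectation (\<lambda>\<omega>. (f n i (design n \<omega>) * f n j (design n \<omega>)) * (eps i \<omega> * eps j \<omega>))
        = expectation (\<lambda>\<omega>. f n i (design n \<omega>) * f n j (design n \<omega>)) * expectation (\<lambda>\<omega>. eps i \<omega> * eps j \<omega>)"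
      "integrable M (\<lambda>\<omega>. (f n i (design n \<omega>) * f n j (design n \<omega>)) * (eps i \<omega> * eps j \<omega>))"
      using ij eps_product(1)[of i j] by simp_all
  qed
  have rearrange: "(a * b) * (c * d) = (a * c) * (b * d)" "(a * b)\<^sup>2 = (a * a) * (b * b)" for a b c d :: real
    by (simp_all add: power2_eq_square)
  show "expectation (\<lambda>\<omega>. (f n i (design n \<omega>) * eps i \<omega>) * (f n j (design n \<omega>) * eps j \<omega>)) = 0"
    if "i < n" "j < n" "i \<noteq> j" for n i j
    using prod(1)[OF that(1,2)] that(3) unfolding rearrange(1)[of _ "eps i _"] eps_product(2) by simp
  show "integrable M (\<lambda>\<omega>. (f n i (design n \<omega>) * eps i \<omega>)\<^sup>2)" if "i < n" for n i
    unfolding rearrange(2) by (rule prod(2)[OF that that])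
  show "expectation (\<lambda>\<omega>. (f n i (design n \<omega>) * eps i \<omega>)\<^sup>2) \<le> C * \<sigma>\<^sup>2" if "i < n" for n i
    unfolding rearrange(2) prod(1)[OF that that] eps_product(2)
    using C[OF that] by (simp add: mult_right_mono power2_eq_square)
qed

lemma fst_component: "i < n \<Longrightarrow> (\<lambda>a. fst a i) \<in> borel_measurable (design_space n)"
  using measurable_compose[OF measurable_fst coordinate_meas[of i "{..<n}"]] by auto

lemma snd_component:
  "i < n \<Longrightarrow> j < p + q \<Longrightarrow> (\<lambda>a. snd a (i, j)) \<in> borel_measurable (design_space n)"
  using measurable_compose[OF measurable_snd coordinate_meas[of "(i, j)" "{..<n} \<times> {..<p + q}"]] by auto

lemma balance_sum_bounded:
  assumes "j < p + q"
  shows "stochastically_bounded M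
    (\<lambda>z. (\<Sum>i<fst z. (2 * T (fst z) i (snd z) - 1) * x i j (snd z)) / sqrt (real (fst z)))"
proof (rule stochastically_bounded_of_weak_conv_vec[where
      Y = "\<lambda>n j \<omega>. (\<Sum>i<n. (2 * T n i \<omega> - 1) * x i j \<omega>) / sqrt (real n)",
      OF P.prob_space_axioms _ _ _ covariate_balance])
  show "(\<lambda>\<omega>. (\<Sum>i<n. (2 * T n i \<omega> - 1) * x i j \<omega>) / sqrt (real n)) \<in> borel_measurable M"
    if "j \<in> {..<p + q}" for n j
    using that T_meas by (intro borel_measurable_divide borel_measurable_sum borel_measurable_times
        borel_measurable_diff) auto
  show "\<xi> j \<in> borel_measurable P" if "j \<in> {..<p + q}" for j
    using that xi_integrable by auto
qed (use assms in auto)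

definition regressor :: "nat \<Rightarrow> nat \<Rightarrow> nat \<Rightarrow> 'w \<Rightarrow> real" where
  "regressor n k i \<omega> = (if k = 0 then T n i \<omega> else if k = 1 then 1 - T n i \<omega> else x i (k - 2) \<omega>)"

lemma regressor_simps [simp]:
  "regressor n 0 i \<omega> = T n i \<omega>" "regressor n (Suc 0) i \<omega> = 1 - T n i \<omega>"
  "regressor n (Suc (Suc l)) i \<omega> = x i l \<omega>"
  by (simp_all add: regressor_def)

lemma regressor_cases:
  assumes "k < p + 2"
  obtains "k = 0" | "k = Suc 0" | l where "k = Suc (Suc l)" "l < p"
  using assms by (metis Suc_less_eq add_2_eq_Suc' not0_implies_Suc)

definition noise :: "(nat \<Rightarrow> real) \<Rightarrow> nat \<Rightarrow> 'w \<Rightarrow> real" where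
  "noise \<beta> i \<omega> = (\<Sum>j = p..<p + q. \<beta> j * x i j \<omega>) + eps i \<omega>"

text \<open>\<open>T\<close> and \<open>1 - T\<close> are the halves of
  \<open>1 + (2 * T - 1)\<close> and \<open>1 - (2 * T - 1)\<close>: one part is an i.i.d. sum, the
  other is tight by (A2).\<close>

lemma T_sum_x_bounded:
  assumes "j < p + q"
  shows "stochastically_bounded M
      (\<lambda>z. (\<Sum>i<fst z. T (fst z) i (snd z) * x i j (snd z)) / sqrt (real (fst z)))"
    and "stochastically_bounded M
      (\<lambda>z. (\<Sum>i<fst z. (1 - T (fst z) i (snd z)) * x i j (snd z)) / sqrt (real (fst z)))"
proof -
  have split: "(\<Sum>i<n. T n i \<omega> * x i j \<omega>) / r
        = 1/2 * ((\<Sum>i<n. (2 * T n i \<omega> - 1) * x i j \<omega>) / r) + 1/2 * ((\<Sum>i<n. x i j \<omega>) / r)"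
      "(\<Sum>i<n. (1 - T n i \<omega>) * x i j \<omega>) / r
        = (- 1/2) * ((\<Sum>i<n. (2 * T n i \<omega> - 1) * x i j \<omega>) / r) + 1/2 * ((\<Sum>i<n. x i j \<omega>) / r)"
    for n \<omega> r
    by (simp_all add: left_diff_distrib sum_subtractf sum_distrib_left[symmetric]
        diff_divide_distrib mult.assoc)
  show "stochastically_bounded M
      (\<lambda>z. (\<Sum>i<fst z. T (fst z) i (snd z) * x i j (snd z)) / sqrt (real (fst z)))"
    "stochastically_bounded M
      (\<lambda>z. (\<Sum>i<fst z. (1 - T (fst z) i (snd z)) * x i j (snd z)) / sqrt (real (fst z)))"
    unfolding split
    by (intro stochastically_bounded_add stochastically_bounded_cmult
        balance_sum_bounded[OF assms] sum_x_bounded[OF assms])+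
qed

text \<open>An included and an omitted covariate have distinct indices, so only products of
  independent covariates occur, and these have mean 0 and finite variance.\<close>

lemma regressor_x_bounded:
  assumes "k < p + 2" "p \<le> j" "j < p + q"
  shows "stochastically_bounded M
    (\<lambda>z. (\<Sum>i<fst z. regressor (fst z) k i (snd z) * x i j (snd z)) / sqrt (real (fst z)))"
  using assms(1)
proof (cases k rule: regressor_cases)
  case (3 l)
  then show ?thesis using sum_x_product_bounded[of l j] assms by simp
qed (use T_sum_x_bounded[OF assms(3)] in simp_all)

lemma regressor_eps_bounded:
  assumes "k < p + 2"
  shows "stochastically_bounded M
    (\<lambda>z. (\<Sum>i<fst z. regressor (fst z) k i (snd z) * eps i (snd z)) / sqrt (real (fst z)))"
  using assms
proof (cases k rule: regressor_cases)
  case 1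
  have sq: "(T n i \<omega>)\<^sup>2 \<le> 1" if "i < n" "\<omega> \<in> space M" for n i \<omega>
    using T_01[OF that] by auto
  have int: "integrable M (\<lambda>\<omega>. (T n i \<omega>)\<^sup>2)" if "i < n" for n i
    using T_meas[OF that] sq[OF that]
    by (intro integrable_const_bound[where B = 1]) auto
  have "stochastically_bounded M (\<lambda>z. (\<Sum>i<fst z. (\<lambda>n i a. fst a i) (fst z) i (design (fst z) (snd z))
      * eps i (snd z)) / sqrt (real (fst z)))"
    using int sq by (intro sum_design_eps_bounded[where C = 1])
      (auto intro!: fst_component integral_le_const)
  then show ?thesis using 1 by (simp cong: sum.cong_simp)
next
  case 2
  have sq: "(1 - T n i \<omega>)\<^sup>2 \<le> 1" if "i < n" "\<omega> \<in> space M" for n i \<omega>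
    using T_01[OF that] by auto
  have int: "integrable M (\<lambda>\<omega>. (1 - T n i \<omega>)\<^sup>2)" if "i < n" for n i
    using T_meas[OF that] sq[OF that]
    by (intro integrable_const_bound[where B = 1]) auto
  have "stochastically_bounded M (\<lambda>z. (\<Sum>i<fst z. (\<lambda>n i a. 1 - fst a i) (fst z) i (design (fst z) (snd z))
      * eps i (snd z)) / sqrt (real (fst z)))"
    using int sq by (intro sum_design_eps_bounded[where C = 1])
      (auto intro!: fst_component integral_le_const)
  then show ?thesis using 2 by (simp cong: sum.cong_simp)
next
  case (3 l)
  then have l: "l < p + q" by simp
  have "stochastically_bounded M (\<lambda>z. (\<Sum>i<fst z. (\<lambda>n i a. snd a (i, l)) (fst z) i (design (fst z) (snd z))
      * eps i (snd z)) / sqrt (real (fst z)))"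
    using x_moments(3,4)[OF l] l
    by (intro sum_design_eps_bounded[where C = "var_X l"]) (auto intro!: snd_component)
  then show ?thesis using 3 l by (simp cong: sum.cong_simp)
qed

lemma regressor_noise_bounded:
  assumes "k < p + 2"
  shows "stochastically_bounded M
    (\<lambda>z. (\<Sum>i<fst z. regressor (fst z) k i (snd z) * noise \<beta> i (snd z)) / sqrt (real (fst z)))"
proof -
  have split: "(\<Sum>i<n. regressor n k i \<omega> * noise \<beta> i \<omega>) / r
      = (\<Sum>j = p..<p + q. \<beta> j * ((\<Sum>i<n. regressor n k i \<omega> * x i j \<omega>) / r))
        + (\<Sum>i<n. regressor n k i \<omega> * eps i \<omega>) / r" for n \<omega> r
  proof -
    have "(\<Sum>i<n. regressor n k i \<omega> * noise \<beta> i \<omega>)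
        = (\<Sum>i<n. \<Sum>j = p..<p + q. \<beta> j * (regressor n k i \<omega> * x i j \<omega>))
          + (\<Sum>i<n. regressor n k i \<omega> * eps i \<omega>)"
      by (simp add: noise_def distrib_left sum.distrib sum_distrib_left mult.left_commute)
    also have "(\<Sum>i<n. \<Sum>j = p..<p + q. \<beta> j * (regressor n k i \<omega> * x i j \<omega>))
        = (\<Sum>j = p..<p + q. \<beta> j * (\<Sum>i<n. regressor n k i \<omega> * x i j \<omega>))"
      by (subst sum.swap) (simp add: sum_distrib_left)
    finally show ?thesis
      by (simp only: add_divide_distrib sum_divide_distrib[of _ "{p..<p + q}"] times_divide_eq_right)
  qed
  show ?thesis
    unfolding split
    by (intro stochastically_bounded_add stochastically_bounded_sum stochastically_bounded_cmult
        regressor_x_bounded regressor_eps_bounded assms) auto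
qed

section \<open>Limits of the Gram matrix and of the noise variance\<close>

lemma eventually_index_pos: "\<forall>\<^sub>F z in in_probability M. 0 < fst z"
  using filterlim_fst_in_probability[unfolded filterlim_iff, rule_format, OF eventually_gt_at_top[of 0]] .

lemma mean_T: "((\<lambda>z. (\<Sum>i<fst z. T (fst z) i (snd z)) / real (fst z)) \<longlongrightarrow> 1/2) (in_probability M)"
proof (rule Lim_transform_eventually)
  have "(\<lambda>\<omega>. (\<Sum>i<n. 2 * T n i \<omega> - 1) / real n) \<in> borel_measurable M" for n
    using T_meas by (intro borel_measurable_divide borel_measurable_sum borel_measurable_diff
        borel_measurable_times) auto
  from conv_in_prob_imp_tendsto[OF this global_balance]
  have "((\<lambda>z. ((\<Sum>i<fst z. 2 * T (fst z) i (snd z) - 1) / real (fst z) + 1) / 2) \<longlongrightarrow> (0 + 1) / 2)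
      (in_probability M)"
    by (intro tendsto_intros) auto
  then show "((\<lambda>z. ((\<Sum>i<fst z. 2 * T (fst z) i (snd z) - 1) / real (fst z) + 1) / 2) \<longlongrightarrow> 1/2)
      (in_probability M)" by simp
  \<comment> \<open>The identity fails at \<open>n = 0\<close>, where division by zero makes the
    left side 1/2 and the right side 0.\<close>
  show "\<forall>\<^sub>F z in in_probability M. ((\<Sum>i<fst z. 2 * T (fst z) i (snd z) - 1) / real (fst z) + 1) / 2
      = (\<Sum>i<fst z. T (fst z) i (snd z)) / real (fst z)"
    using eventually_index_pos
    by eventually_elim (simp add: sum_subtractf sum_distrib_left[symmetric] field_simps)
qed

definition limit_gram :: "nat \<Rightarrow> nat \<Rightarrow> real" where
  "limit_gram k l = (if k \<noteq> l then 0 else if k < 2 then 1/2 else var_X (k - 2))"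

lemma mean_regressor_product:
  assumes "k < p + 2" "l < p + 2"
  shows "((\<lambda>z. (\<Sum>i<fst z. regressor (fst z) k i (snd z) * regressor (fst z) l i (snd z)) / real (fst z))
    \<longlongrightarrow> limit_gram k l) (in_probability M)" (is "?lim k l")
proof -
  \<comment> \<open>Positive sample size and binary assignments both hold along the filter, so
    products of indicators may be simplified pointwise inside a limit.\<close>
  have eventually_T: "(f \<longlongrightarrow> c) (in_probability M) \<Longrightarrow>
      (\<And>n \<omega>. 0 < n \<Longrightarrow> (\<And>i. i < n \<Longrightarrow> T n i \<omega> \<in> {0, 1}) \<Longrightarrow> f (n, \<omega>) = g (n, \<omega>)) \<Longrightarrow>
      (g \<longlongrightarrow> c) (in_probability M)" for f g :: "nat \<times> 'w \<Rightarrow> real" and c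
    by (erule Lim_transform_eventually)
      (use eventually_index_pos eventually_snd_in_space in
        \<open>eventually_elim, use T_01 in fastforce\<close>)
  have idem: "t * t = t" "t * (1 - t) = 0" "(1 - t) * t = 0" "(1 - t) * (1 - t) = 1 - t"
    if "t \<in> {0, 1}" for t :: real using that by auto
  have corner: "limit_gram 0 0 = 1/2" "limit_gram 1 1 = 1 - 1/2" "limit_gram 0 1 = 0" "limit_gram 1 0 = 0"
    by (simp_all add: limit_gram_def)
  have TT: "?lim 0 0"
    unfolding corner by (rule eventually_T[OF mean_T]) (simp add: idem cong: sum.cong_simp)
  have comp: "?lim 1 1"
    unfolding corner
    by (rule eventually_T[OF tendsto_diff[OF tendsto_const[of 1] mean_T]])
      (simp add: idem sum_subtractf diff_divide_distrib cong: sum.cong_simp)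
  have mixed: "?lim 0 1" "?lim 1 0"
    unfolding corner
    by (rule eventually_T[OF tendsto_const[of 0]], simp add: idem cong: sum.cong_simp)+
  have Tx: "?lim 0 (Suc (Suc j))" "?lim 1 (Suc (Suc j))" "?lim (Suc (Suc j)) 0" "?lim (Suc (Suc j)) 1"
    if "j < p" for j
    using that T_sum_x_bounded[of j, THEN stochastically_bounded_over_sqrt]
    by (simp_all add: limit_gram_def mult.commute)
  have xx: "?lim (Suc (Suc i)) (Suc (Suc j))" if "i < p" "j < p" for i j
  proof -
    have "limit_gram (Suc (Suc i)) (Suc (Suc j)) = (if i = j then var_X i else 0)"
      by (simp add: limit_gram_def)
    then show ?thesis using mean_x_product[of i j] that by (simp only: regressor_simps)
  qed
  show ?thesis
    by (rule regressor_cases[OF assms(1)]; rule regressor_cases[OF assms(2)])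
      (use TT comp mixed Tx xx in \<open>simp_all del: regressor_simps\<close>)
qed

text \<open>Only the squares survive averaging: distinct covariates are uncorrelated, and the
  products of covariates with errors are orthogonal across units. The limit is the square of
  \<open>\<sigma>\<^sub>w\<close>.\<close>

lemma mean_noise_square:
  "((\<lambda>z. (\<Sum>i<fst z. (noise \<beta> i (snd z))\<^sup>2) / real (fst z))
    \<longlongrightarrow> \<sigma>\<^sup>2 + (\<Sum>j = p..<p + q. (\<beta> j)\<^sup>2 * var_X j)) (in_probability M)"
proof -
  let ?J = "{p..<p + q}"
  have split: "(\<Sum>i<n. (noise \<beta> i \<omega>)\<^sup>2) / r
      = (\<Sum>i<n. (eps i \<omega>)\<^sup>2) / r
        + (\<Sum>j\<in>?J. \<Sum>k\<in>?J. \<beta> j * \<beta> k * ((\<Sum>i<n. x i j \<omega> * x i k \<omega>) / r))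
        + (\<Sum>j\<in>?J. 2 * \<beta> j * ((\<Sum>i<n. x i j \<omega> * eps i \<omega>) / r))" for n \<omega> r
  proof -
    have "(noise \<beta> i \<omega>)\<^sup>2 = (eps i \<omega>)\<^sup>2 + (\<Sum>j\<in>?J. \<Sum>k\<in>?J. \<beta> j * \<beta> k * (x i j \<omega> * x i k \<omega>))
        + (\<Sum>j\<in>?J. 2 * \<beta> j * (x i j \<omega> * eps i \<omega>))" for i
      unfolding noise_def power2_sum
      by (simp add: power2_eq_square sum_product sum_distrib_left sum_distrib_right algebra_simps)
    then have "(\<Sum>i<n. (noise \<beta> i \<omega>)\<^sup>2) = (\<Sum>i<n. (eps i \<omega>)\<^sup>2)
        + (\<Sum>i<n. \<Sum>j\<in>?J. \<Sum>k\<in>?J. \<beta> j * \<beta> k * (x i j \<omega> * x i k \<omega>))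
        + (\<Sum>i<n. \<Sum>j\<in>?J. 2 * \<beta> j * (x i j \<omega> * eps i \<omega>))"
      by (simp add: sum.distrib)
    also have "(\<Sum>i<n. \<Sum>j\<in>?J. 2 * \<beta> j * (x i j \<omega> * eps i \<omega>))
        = (\<Sum>j\<in>?J. 2 * \<beta> j * (\<Sum>i<n. x i j \<omega> * eps i \<omega>))"
      by (subst sum.swap) (simp add: sum_distrib_left)
    also have "(\<Sum>i<n. \<Sum>j\<in>?J. \<Sum>k\<in>?J. \<beta> j * \<beta> k * (x i j \<omega> * x i k \<omega>))
        = (\<Sum>j\<in>?J. \<Sum>i<n. \<Sum>k\<in>?J. \<beta> j * \<beta> k * (x i j \<omega> * x i k \<omega>))"
      by (rule sum.swap)
    also have "\<dots> = (\<Sum>j\<in>?J. \<Sum>k\<in>?J. \<Sum>i<n. \<beta> j * \<beta> k * (x i j \<omega> * x i k \<omega>))"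
      by (intro sum.cong refl sum.swap)
    also have "\<dots> = (\<Sum>j\<in>?J. \<Sum>k\<in>?J. \<beta> j * \<beta> k * (\<Sum>i<n. x i j \<omega> * x i k \<omega>))"
      by (simp add: sum_distrib_left)
    finally show ?thesis
      by (simp only: add_divide_distrib sum_divide_distrib[of _ ?J] times_divide_eq_right)
  qed
  have xe: "((\<lambda>z. (\<Sum>i<fst z. x i j (snd z) * eps i (snd z)) / real (fst z)) \<longlongrightarrow> 0) (in_probability M)"
    if "j < p + q" for j
  proof -
    have "stochastically_bounded M (\<lambda>z. (\<Sum>i<fst z. (\<lambda>n i a. snd a (i, j)) (fst z) i (design (fst z) (snd z))
        * eps i (snd z)) / sqrt (real (fst z)))"
      using x_moments(3,4)[OF that] that
      by (intro sum_design_eps_bounded[where C = "var_X j"]) (auto intro!: snd_component)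
    from stochastically_bounded_over_sqrt[OF this] show ?thesis
      using that by (simp cong: sum.cong_simp)
  qed
  have "((\<lambda>z. (\<Sum>i<fst z. (noise \<beta> i (snd z))\<^sup>2) / real (fst z))
    \<longlongrightarrow> \<sigma>\<^sup>2 + (\<Sum>j\<in>?J. \<Sum>k\<in>?J. \<beta> j * \<beta> k * (if j = k then var_X j else 0)) + (\<Sum>j\<in>?J. 2 * \<beta> j * 0))
      (in_probability M)"
    unfolding split
    by (intro tendsto_add mean_eps_square tendsto_sum tendsto_mult tendsto_const mean_x_product xe) auto
  also have "\<sigma>\<^sup>2 + (\<Sum>j\<in>?J. \<Sum>k\<in>?J. \<beta> j * \<beta> k * (if j = k then var_X j else 0)) + (\<Sum>j\<in>?J. 2 * \<beta> j * 0)
      = \<sigma>\<^sup>2 + (\<Sum>j\<in>?J. (\<beta> j)\<^sup>2 * var_X j)"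
    by (simp add: if_distrib power2_eq_square cong: if_cong)
  finally show ?thesis .
qed

section \<open>Inverse of the normalized Gram matrix\<close>

abbreviation regression_matrix :: "nat \<Rightarrow> 'w \<Rightarrow> real mat" where
  "regression_matrix n \<omega> \<equiv> design_matrix n p (\<lambda>i. T n i \<omega>) (\<lambda>i j. x i j \<omega>)"

lemma regression_matrix_carrier: "regression_matrix n \<omega> \<in> carrier_mat n (p + 2)"
  by (simp add: design_matrix_def)

lemma regression_matrix_entry:
  "i < n \<Longrightarrow> k < p + 2 \<Longrightarrow> regression_matrix n \<omega> $$ (i, k) = regressor n k i \<omega>"
  by (simp add: design_matrix_def regressor_def)

lemma transpose_mult_vec_entry:
  assumes "k < p + 2"
  shows "(transpose_mat (regression_matrix n \<omega>) *\<^sub>v Matrix.vec n f) $ k = (\<Sum>i<n. regressor n k i \<omega> * f i)"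
  using assms regression_matrix_carrier[of n \<omega>] regression_matrix_entry[of _ n k \<omega>]
  by (subst mult_mat_vec_entry[where m = "p + 2" and n = n]) (auto intro!: sum.cong)

lemma gram_entry:
  assumes "k < p + 2" "l < p + 2"
  shows "gram (regression_matrix n \<omega>) $$ (k, l) = (\<Sum>i<n. regressor n k i \<omega> * regressor n l i \<omega>)"
proof -
  let ?G = "regression_matrix n \<omega>"
  have "gram ?G $$ (k, l) = (\<Sum>i<n. ?G $$ (i, k) * ?G $$ (i, l))"
    using assms regression_matrix_carrier[of n \<omega>]
    by (auto simp: gram_def scalar_prod_def atLeast0LessThan intro!: sum.cong)
  also have "\<dots> = (\<Sum>i<n. regressor n k i \<omega> * regressor n l i \<omega>)"
    using assms by (intro sum.cong refl) (simp add: regression_matrix_entry)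
  finally show ?thesis .
qed

definition limit_gram_mat :: "real mat" where
  "limit_gram_mat = Matrix.mat (p + 2) (p + 2) (\<lambda>(k, l). limit_gram k l)"

definition limit_inverse :: "nat \<Rightarrow> nat \<Rightarrow> real" where
  "limit_inverse k l = (if k = l then 1 / limit_gram k k else 0)"

lemma limit_gram_mat_carrier: "limit_gram_mat \<in> carrier_mat (p + 2) (p + 2)"
  by (simp add: limit_gram_mat_def)

lemma limit_gram_pos: "k < p + 2 \<Longrightarrow> 0 < limit_gram k k"
  using var_X_pos[of "k - 2"] by (auto simp: limit_gram_def)

lemma limit_inverse_mult:
  "Matrix.mat (p + 2) (p + 2) (\<lambda>(k, l). limit_inverse k l) * limit_gram_mat = 1\<^sub>m (p + 2)"
proof (rule eq_matI)
  fix k l assume "k < dim_row (1\<^sub>m (p + 2))" "l < dim_col (1\<^sub>m (p + 2))"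
  then have kl: "k < p + 2" "l < p + 2" by auto
  have "(\<Sum>i<p + 2. limit_inverse k i * limit_gram i l)
      = (\<Sum>i<p + 2. if i = k then 1 / limit_gram k k * limit_gram k l else 0)"
    by (intro sum.cong refl) (simp add: limit_inverse_def)
  also have "\<dots> = (if k = l then 1 else 0)"
    using kl limit_gram_pos[of k] by (cases "k = l") (simp, simp add: limit_gram_def[of k l])
  finally show "(Matrix.mat (p + 2) (p + 2) (\<lambda>(k, l). limit_inverse k l) * limit_gram_mat) $$ (k, l)
      = 1\<^sub>m (p + 2) $$ (k, l)"
    using kl by (simp add: limit_gram_mat_def scalar_prod_def atLeast0LessThan)
qed (simp_all add: limit_gram_mat_def)

definition mean_gram :: "nat \<times> 'w \<Rightarrow> real mat" where
  "mean_gram z = (1 / real (fst z)) \<cdot>\<^sub>m gram (regression_matrix (fst z) (snd z))"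

lemma mean_gram_carrier: "mean_gram z \<in> carrier_mat (p + 2) (p + 2)"
  using gram_carrier[OF regression_matrix_carrier] by (simp add: mean_gram_def)

lemma mean_gram_tendsto:
  assumes "k < p + 2" "l < p + 2"
  shows "((\<lambda>z. mean_gram z $$ (k, l)) \<longlongrightarrow> limit_gram_mat $$ (k, l)) (in_probability M)"
proof -
  have "mean_gram z $$ (k, l) = (\<Sum>i<fst z. regressor (fst z) k i (snd z) * regressor (fst z) l i (snd z)) / real (fst z)" for z
    using assms gram_carrier[OF regression_matrix_carrier, of "fst z" "snd z"]
    by (simp add: mean_gram_def gram_entry)
  then show ?thesis
    using mean_regressor_product[OF assms] assms by (simp add: limit_gram_mat_def)
qed

text \<open>The limit matrix is diagonal with positive entries, and a limit different from 0 keeps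
  the determinant away from 0 with probability tending to one.\<close>

lemma eventually_regular:
  "\<forall>\<^sub>F z in in_probability M. Determinant.det (gram (regression_matrix (fst z) (snd z))) \<noteq> 0"
proof -
  note D = limit_gram_mat_carrier
  have "Determinant.det (Matrix.mat (p + 2) (p + 2) (\<lambda>(k, l). limit_inverse k l)) * Determinant.det limit_gram_mat = 1"
    using det_mult[of "Matrix.mat (p + 2) (p + 2) (\<lambda>(k, l). limit_inverse k l)" "p + 2" limit_gram_mat] D
      limit_inverse_mult by simp
  then have "Determinant.det limit_gram_mat \<noteq> 0" by auto
  moreover have "((\<lambda>z. Determinant.det (mean_gram z)) \<longlongrightarrow> Determinant.det limit_gram_mat) (in_probability M)"
    by (rule tendsto_det[OF mean_gram_carrier D mean_gram_tendsto])
  ultimately have "\<forall>\<^sub>F z in in_probability M. Determinant.det (mean_gram z) \<noteq> 0"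
    by (rule tendsto_imp_eventually_ne[rotated])
  then show ?thesis
    by eventually_elim (auto simp: mean_gram_def)
qed

text \<open>The inverse of \<open>mean_gram\<close> in the regular case. It is written as a multiple
  of \<open>gram_inverse\<close>, the matrix that occurs in the statistic.\<close>

definition scaled_inverse :: "nat \<times> 'w \<Rightarrow> real mat" where
  "scaled_inverse z = real (fst z) \<cdot>\<^sub>m gram_inverse (regression_matrix (fst z) (snd z))"

lemma scaled_inverse_tendsto:
  assumes "k < p + 2" "l < p + 2"
  shows "((\<lambda>z. scaled_inverse z $$ (k, l)) \<longlongrightarrow> limit_inverse k l) (in_probability M)"
proof -
  have "((\<lambda>z. scaled_inverse z $$ (k, l)) \<longlongrightarrow>
      Matrix.mat (p + 2) (p + 2) (\<lambda>(k, l). limit_inverse k l) $$ (k, l)) (in_probability M)"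
  proof (rule tendsto_left_inverse[OF mean_gram_carrier limit_gram_mat_carrier mat_carrier
        limit_inverse_mult mean_gram_tendsto _ assms])
    show "\<forall>\<^sub>F z in in_probability M. scaled_inverse z \<in> carrier_mat (p + 2) (p + 2) \<and>
        scaled_inverse z * mean_gram z = 1\<^sub>m (p + 2)"
      using eventually_regular eventually_index_pos
    proof eventually_elim
      case (elim z)
      let ?G = "regression_matrix (fst z) (snd z)"
      note inv = gram_inverse_of_det[OF regression_matrix_carrier elim(1)]
      note gram = gram_carrier[OF regression_matrix_carrier, of "fst z" "snd z"]
      have "scaled_inverse z * mean_gram z = (real (fst z) * (1 / real (fst z))) \<cdot>\<^sub>m (gram_inverse ?G * gram ?G)"
        unfolding scaled_inverse_def mean_gram_def
        using inv(2) gram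
        by (subst mult_smult_assoc_mat[of _ "p + 2" "p + 2" _ "p + 2"], simp, simp,
            subst mult_smult_distrib[of _ "p + 2" "p + 2" _ "p + 2"]) (auto intro!: eq_matI)
      then show ?case using inv elim(2) by (auto simp: scaled_inverse_def)
    qed
  qed
  then show ?thesis using assms by simp
qed

section \<open>Linearization of the test statistic\<close>

text \<open>The numerator and the squared denominator are both multiplied by the sample size.\<close>

lemma test_stat_rescaled:
  fixes mu1 mu2 :: real and \<beta> :: "nat \<Rightarrow> real"
  assumes det: "Determinant.det (gram (regression_matrix n \<omega>)) \<noteq> 0" and n: "0 < n"
  defines "B \<equiv> scaled_inverse (n, \<omega>)"
    and "b \<equiv> \<lambda>k. \<Sum>i<n. regressor n k i \<omega> * noise \<beta> i \<omega>"
  shows "test_stat (regression_matrix n \<omega>)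
      (Matrix.vec n (\<lambda>i. outcome mu1 mu2 \<beta> (p + q) (T n i \<omega>) (\<lambda>j. x i j \<omega>) (eps i \<omega>)))
    = (sqrt (real n) * (mu1 - mu2) + (\<Sum>l<p + 2. (B $$ (0, l) - B $$ (1, l)) * (b l / sqrt (real n)))) /
      sqrt (((\<Sum>i<n. (noise \<beta> i \<omega>)\<^sup>2) / real n
          - (\<Sum>k<p + 2. \<Sum>l<p + 2. b k / real n * B $$ (k, l) * (b l / real n)))
        * (real n / (real n - real (p + 2)))
        * (B $$ (0, 0) - B $$ (0, 1) - B $$ (1, 0) + B $$ (1, 1)))"
proof -
  let ?G = "regression_matrix n \<omega>"
  \<comment> \<open>The true coefficients of the working model; the omitted covariates join the
    errors in \<open>w\<close>, so that the outcomes are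
    \<open>?G *\<^sub>v \<theta> + w\<close>.\<close>
  define \<theta> where "\<theta> = Matrix.vec (p + 2) (\<lambda>k. if k = 0 then mu1 else if k = 1 then mu2 else \<beta> (k - 2))"
  define w where "w = Matrix.vec n (\<lambda>i. noise \<beta> i \<omega>)"
  define H where "H = gram_inverse ?G"
  note G = regression_matrix_carrier[of n \<omega>]
  have th: "\<theta> \<in> carrier_vec (p + 2)" and w: "w \<in> carrier_vec n" by (simp_all add: \<theta>_def w_def)
  have Y: "Matrix.vec n (\<lambda>i. outcome mu1 mu2 \<beta> (p + q) (T n i \<omega>) (\<lambda>j. x i j \<omega>) (eps i \<omega>)) = ?G *\<^sub>v \<theta> + w"
  proof (rule eq_vecI)
    fix i assume "i < dim_vec (?G *\<^sub>v \<theta> + w)"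
    then have i: "i < n" using w by simp
    have "(?G *\<^sub>v \<theta>) $ i = (\<Sum>k<p + 2. regressor n k i \<omega> * \<theta> $ k)"
      unfolding mult_mat_vec_entry[OF G th i] using i
      by (intro sum.cong refl) (simp add: regression_matrix_entry)
    also have "\<dots> = mu1 * T n i \<omega> + mu2 * (1 - T n i \<omega>) + (\<Sum>j<p. \<beta> j * x i j \<omega>)"
      unfolding add_2_eq_Suc' sum.lessThan_Suc_shift by (simp add: \<theta>_def mult.commute)
    finally have Gth: "(?G *\<^sub>v \<theta>) $ i = \<dots>" .
    have covariates: "(\<Sum>j<p + q. \<beta> j * x i j \<omega>) = (\<Sum>j<p. \<beta> j * x i j \<omega>) + (\<Sum>j = p..<p + q. \<beta> j * x i j \<omega>)"
      using sum.atLeastLessThan_concat[of 0 p "p + q" "\<lambda>j. \<beta> j * x i j \<omega>"]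
      by (simp add: lessThan_atLeast0)
    show "Matrix.vec n (\<lambda>i. outcome mu1 mu2 \<beta> (p + q) (T n i \<omega>) (\<lambda>j. x i j \<omega>) (eps i \<omega>)) $ i
        = (?G *\<^sub>v \<theta> + w) $ i"
      using i by (simp add: outcome_def noise_def w_def Gth covariates del: index_mult_mat_vec)
  qed (use w in simp)
  have H: "H \<in> carrier_mat (p + 2) (p + 2)"
    unfolding H_def by (rule gram_inverse_of_det[OF G det])
  have B: "B $$ (k, l) = real n * H $$ (k, l)" if "k < p + 2" "l < p + 2" for k l
    using that H by (simp add: B_def scaled_inverse_def H_def)
  have u: "(transpose_mat ?G *\<^sub>v w) $ k = b k" if "k < p + 2" for k
    unfolding w_def b_def by (rule transpose_mult_vec_entry[OF that])
  have ww: "scalar_prod w w = (\<Sum>i<n. (noise \<beta> i \<omega>)\<^sup>2)"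
    by (simp add: w_def scalar_prod_def power2_eq_square atLeast0LessThan)
  let ?num = "mu1 - mu2 + (\<Sum>l<p + 2. (H $$ (0, l) - H $$ (1, l)) * b l)"
  let ?q = "\<Sum>k<p + 2. \<Sum>l<p + 2. b k * H $$ (k, l) * b l"
  let ?h = "H $$ (0, 0) - H $$ (0, 1) - H $$ (1, 0) + H $$ (1, 1)"
  have "test_stat ?G (?G *\<^sub>v \<theta> + w)
      = ?num / sqrt (((\<Sum>i<n. (noise \<beta> i \<omega>)\<^sup>2) - ?q) / (real n - real (p + 2)) * ?h)"
    using test_stat_expansion[OF G det _ th w] unfolding H_def[symmetric] ww
    by (simp add: u \<theta>_def cong: sum.cong_simp)
  also have "\<dots> = (sqrt (real n) * ?num) / sqrt (real n * (((\<Sum>i<n. (noise \<beta> i \<omega>)\<^sup>2) - ?q) / (real n - real (p + 2)) * ?h))"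
    unfolding real_sqrt_mult[of "real n"] using n by simp
  also have "sqrt (real n) * ?num = sqrt (real n) * (mu1 - mu2) + (\<Sum>l<p + 2. (B $$ (0, l) - B $$ (1, l)) * (b l / sqrt (real n)))"
  proof -
    have "sqrt (real n) * ((H $$ (0, l) - H $$ (1, l)) * b l) = (B $$ (0, l) - B $$ (1, l)) * (b l / sqrt (real n))"
      if "l < p + 2" for l
    proof -
      have "B $$ (0, l) - B $$ (1, l) = real n * (H $$ (0, l) - H $$ (1, l))"
        using B[OF _ that, of 0] B[OF _ that, of 1] by (simp add: right_diff_distrib)
      then have "(B $$ (0, l) - B $$ (1, l)) * (b l / sqrt (real n))
          = (real n / sqrt (real n)) * ((H $$ (0, l) - H $$ (1, l)) * b l)" by simp
      also have "real n / sqrt (real n) = sqrt (real n)" by (rule real_div_sqrt) simp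
      finally show ?thesis by simp
    qed
    then show ?thesis by (simp add: distrib_left sum_distrib_left)
  qed
  \<comment> \<open>One factor \<open>n\<close> turns \<open>?h\<close> into entries of
    \<open>B\<close>; \<open>real n / (real n - real (p + 2))\<close> corrects the normalization of
    the residual sum of squares from \<open>n - p - 2\<close> to \<open>n\<close>.\<close>
  also have "real n * (((\<Sum>i<n. (noise \<beta> i \<omega>)\<^sup>2) - ?q) / (real n - real (p + 2)) * ?h)
      = ((\<Sum>i<n. (noise \<beta> i \<omega>)\<^sup>2) / real n
          - (\<Sum>k<p + 2. \<Sum>l<p + 2. b k / real n * B $$ (k, l) * (b l / real n)))
        * (real n / (real n - real (p + 2)))
        * (B $$ (0, 0) - B $$ (0, 1) - B $$ (1, 0) + B $$ (1, 1))"
  proof -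
    have "(\<Sum>k<p + 2. \<Sum>l<p + 2. b k / real n * B $$ (k, l) * (b l / real n)) = ?q / real n"
      unfolding sum_divide_distrib using n by (intro sum.cong refl) (simp add: B field_simps)
    moreover have "B $$ (0, 0) - B $$ (0, 1) - B $$ (1, 0) + B $$ (1, 1) = real n * ?h"
      by (simp add: B algebra_simps)
    ultimately show ?thesis using n by (simp add: diff_divide_distrib[symmetric])
  qed
  finally show ?thesis unfolding Y .
qed

text \<open>This is \<open>\<sigma>\<^sub>w\<close>, the standard deviation of what the working
  model leaves unexplained.\<close>

definition noise_sd :: "(nat \<Rightarrow> real) \<Rightarrow> real" where
  "noise_sd \<beta> = sqrt (\<sigma>\<^sup>2 + (\<Sum>j = p..<p + q. (\<beta> j)\<^sup>2 * var_X j))"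

lemma noise_sd_pos: "0 < noise_sd \<beta>"
proof -
  have "0 \<le> (\<Sum>j = p..<p + q. (\<beta> j)\<^sup>2 * var_X j)"
    using var_X_pos by (intro sum_nonneg mult_nonneg_nonneg) (auto intro: less_imp_le)
  then show ?thesis
    unfolding noise_sd_def using sigma_pos by (simp add: add_pos_nonneg)
qed

definition signed_noise :: "(nat \<Rightarrow> real) \<Rightarrow> nat \<Rightarrow> 'w \<Rightarrow> real" where
  "signed_noise \<beta> n \<omega> = (\<Sum>i<n. (2 * T n i \<omega> - 1) * noise \<beta> i \<omega>) / sqrt (real n)"

lemma test_stat_linearization:
  fixes S :: "nat \<Rightarrow> 'w \<Rightarrow> real" and mu1 mu2 :: "nat \<Rightarrow> real"
  assumes S: "\<And>n \<omega>. \<omega> \<in> space M \<Longrightarrow> invertible_mat (gram (regression_matrix n \<omega>)) \<Longrightarrow>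
      S n \<omega> = test_stat (regression_matrix n \<omega>)
        (Matrix.vec n (\<lambda>i. outcome (mu1 n) (mu2 n) \<beta> (p + q) (T n i \<omega>) (\<lambda>j. x i j \<omega>) (eps i \<omega>)))"
    and mu: "\<And>n. 1 \<le> n \<Longrightarrow> mu1 n - mu2 n = \<delta> / sqrt (real n)"
  shows "((\<lambda>z. S (fst z) (snd z) - (\<delta> / (2 * noise_sd \<beta>) + 1 / noise_sd \<beta> * signed_noise \<beta> (fst z) (snd z)))
    \<longlongrightarrow> 0) (in_probability M)"
proof -
  let ?F = "in_probability M"
  let ?B = scaled_inverse
  define b where "b k z = (\<Sum>i<fst z. regressor (fst z) k i (snd z) * noise \<beta> i (snd z))" for k z
  define b' where "b' k z = b k z / sqrt (real (fst z))" for k z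
  have b': "stochastically_bounded M (b' k)" if "k < p + 2" for k
    using regressor_noise_bounded[OF that] by (simp add: b'_def[abs_def] b_def)
  have b0: "((\<lambda>z. b k z / real (fst z)) \<longlongrightarrow> 0) ?F" if "k < p + 2" for k
    using stochastically_bounded_over_sqrt[of "b k"] b'[OF that] by (simp add: b'_def[abs_def])
  define num where "num z = \<delta> + (\<Sum>l<p + 2. (?B z $$ (0, l) - ?B z $$ (1, l)) * b' l z)" for z
  define num' where "num' z = \<delta> + 2 * signed_noise \<beta> (fst z) (snd z)" for z
  define den where "den z = sqrt (((\<Sum>i<fst z. (noise \<beta> i (snd z))\<^sup>2) / real (fst z)
          - (\<Sum>k<p + 2. \<Sum>l<p + 2. b k z / real (fst z) * ?B z $$ (k, l) * (b l z / real (fst z))))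
        * (real (fst z) / (real (fst z) - real (p + 2)))
        * (?B z $$ (0, 0) - ?B z $$ (0, 1) - ?B z $$ (1, 0) + ?B z $$ (1, 1)))" for z
  let ?s = "noise_sd \<beta>"
  note s = noise_sd_pos[of \<beta>]

  have inv: "limit_inverse 0 0 = 2" "limit_inverse 0 1 = 0" "limit_inverse 1 0 = 0" "limit_inverse 1 1 = 2"
    by (simp_all add: limit_inverse_def limit_gram_def)
  \<comment> \<open>The two treatment columns differ by
    \<open>T - (1 - T) = 2 * T - 1\<close>.\<close>
  have signed: "signed_noise \<beta> (fst z) (snd z) = b' 0 z - b' 1 z" for z
    unfolding signed_noise_def b'_def b_def diff_divide_distrib[symmetric] sum_subtractf[symmetric]
    by (intro arg_cong2[where f = "(/)"] sum.cong refl) (simp add: algebra_simps)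
  \<comment> \<open>The limiting weights of the contrast: 2 and -2 on the treatment columns, 0 on
    the covariates. Included covariates therefore drop out of the leading term.\<close>
  define e where "e l = limit_inverse 0 l - limit_inverse 1 l" for l
  have e_sum: "(\<Sum>l<p + 2. e l * b' l z) = 2 * (b' 0 z - b' 1 z)" for z
    unfolding add_2_eq_Suc' sum.lessThan_Suc_shift
    by (simp add: e_def limit_inverse_def limit_gram_def)
  have "((\<lambda>z. \<Sum>l<p + 2. ((?B z $$ (0, l) - ?B z $$ (1, l)) - e l) * b' l z) \<longlongrightarrow> 0) ?F"
  proof (intro tendsto_null_sum stochastically_boundedD b')
    show "((\<lambda>z. (?B z $$ (0, l) - ?B z $$ (1, l)) - e l) \<longlongrightarrow> 0) ?F" if "l \<in> {..<p + 2}" for l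
      unfolding e_def using that
      by (intro LIM_zero tendsto_diff scaled_inverse_tendsto) auto
  qed simp
  moreover have "(\<Sum>l<p + 2. ((?B z $$ (0, l) - ?B z $$ (1, l)) - e l) * b' l z) = num z - num' z" for z
    using e_sum[of z] signed[of z] by (simp add: num_def num'_def left_diff_distrib sum_subtractf)
  ultimately have num: "((\<lambda>z. num z - num' z) \<longlongrightarrow> 0) ?F" by simp

  have num'_bounded: "stochastically_bounded M num'"
  proof -
    have "num' = (\<lambda>z. \<delta> + (2 * b' 0 z + (- 2) * b' 1 z))"
      by (simp add: num'_def signed fun_eq_iff)
    then show ?thesis
      by (simp only:) (intro stochastically_bounded_add stochastically_bounded_const
          stochastically_bounded_cmult b', auto)
  qed

  have ratio: "((\<lambda>z. real (fst z) / (real (fst z) - real (p + 2))) \<longlongrightarrow> 1) ?F"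
  proof (rule filterlim_compose[OF _ filterlim_fst_in_probability])
    show "(\<lambda>n. real n / (real n - real (p + 2))) \<longlonglongrightarrow> 1" by real_asymp
  qed
  \<comment> \<open>The fitted part of the noise is quadratic in \<open>b / n\<close> and vanishes.
    The contrast of the limiting inverse is \<open>2 + 2 = 4\<close>, whence the limit
    \<open>2 * ?s\<close>.\<close>
  have "((\<lambda>z. den z) \<longlongrightarrow> sqrt ((?s\<^sup>2 - (\<Sum>k<p + 2. \<Sum>l<p + 2. 0 * limit_inverse k l * 0)) * 1
      * (limit_inverse 0 0 - limit_inverse 0 1 - limit_inverse 1 0 + limit_inverse 1 1))) ?F"
    unfolding den_def
  proof (intro tendsto_real_sqrt tendsto_mult tendsto_diff tendsto_add tendsto_sum ratio
      scaled_inverse_tendsto b0)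
    have "0 \<le> (\<Sum>j = p..<p + q. (\<beta> j)\<^sup>2 * var_X j)"
      using var_X_pos by (intro sum_nonneg mult_nonneg_nonneg) (auto intro: less_imp_le)
    then show "((\<lambda>z. (\<Sum>i<fst z. (noise \<beta> i (snd z))\<^sup>2) / real (fst z)) \<longlongrightarrow> ?s\<^sup>2) ?F"
      using mean_noise_square[of \<beta>] by (simp add: noise_sd_def)
  qed auto
  then have den: "(den \<longlongrightarrow> 2 * ?s) ?F"
    unfolding inv using s by (simp add: real_sqrt_mult mult.commute)

  \<comment> \<open>This expression equals \<open>num z / den z - num' z / (2 * ?s)\<close>. The
    numerator is only bounded in probability, so the quotient rule is applied to its error and
    boundedness to the error of \<open>1 / den\<close>.\<close>
  have "((\<lambda>z. (num z - num' z) / den z + (1 / den z - 1 / (2 * ?s)) * num' z) \<longlongrightarrow> 0 / (2 * ?s) + 0) ?F"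
  proof (intro tendsto_add tendsto_divide num den stochastically_boundedD[OF num'_bounded])
    have "((\<lambda>z. 1 / den z) \<longlongrightarrow> 1 / (2 * ?s)) ?F"
      using s by (intro tendsto_divide tendsto_const den) simp
    then show "((\<lambda>z. 1 / den z - 1 / (2 * ?s)) \<longlongrightarrow> 0) ?F" by (rule LIM_zero)
  qed (use s in simp)
  then have lim: "((\<lambda>z. (num z - num' z) / den z + (1 / den z - 1 / (2 * ?s)) * num' z) \<longlongrightarrow> 0) ?F"
    by simp
  show ?thesis
  proof (rule Lim_transform_eventually[OF lim])
    show "\<forall>\<^sub>F z in ?F. (num z - num' z) / den z + (1 / den z - 1 / (2 * ?s)) * num' z
        = S (fst z) (snd z) - (\<delta> / (2 * ?s) + 1 / ?s * signed_noise \<beta> (fst z) (snd z))"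
      using eventually_regular eventually_index_pos eventually_snd_in_space
    proof eventually_elim
      case (elim z)
      have "sqrt (real (fst z)) * (mu1 (fst z) - mu2 (fst z)) = \<delta>"
        using mu[of "fst z"] elim(2) by simp
      then have "S (fst z) (snd z) = num z / den z"
        unfolding S[OF elim(3) gram_inverse_of_det(1)[OF regression_matrix_carrier elim(1)]]
          test_stat_rescaled[OF elim(1,2)] num_def den_def b'_def b_def by simp
      moreover have "num' z / (2 * ?s) = \<delta> / (2 * ?s) + 1 / ?s * signed_noise \<beta> (fst z) (snd z)"
        by (simp add: num'_def add_divide_distrib)
      ultimately show ?case by (simp add: diff_divide_distrib left_diff_distrib)
    qed
  qed
qed

section \<open>Limit law of the statistic\<close>

lemma char_signed_noise_tendsto:
  "(\<lambda>n. char (distr M borel (signed_noise \<beta> n)) t) \<longlonglongrightarrow>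
     of_real (exp (- (t\<^sup>2 * \<sigma>\<^sup>2 / 2))) * char (distr P borel (\<lambda>u. \<Sum>j = p..<p + q. \<beta> j * \<xi> j u)) t"
proof -
  let ?J = "{p..<p + q}"
  \<comment> \<open>The signs must have modulus one at every point of the design space, whose first
    component consists of arbitrary reals. This version does, and it agrees with
    \<open>2 * T - 1\<close> on actual assignments.\<close>
  define s :: "nat \<Rightarrow> nat \<Rightarrow> (nat \<Rightarrow> real) \<times> (nat \<times> nat \<Rightarrow> real) \<Rightarrow> real"
    where "s n i a = (if fst a i = 1 then 1 else - 1)" for n i a
  \<comment> \<open>The contribution of the omitted covariates, a function of the design alone; (A2)
    gives the limit of its characteristic function.\<close>
  define v :: "nat \<Rightarrow> (nat \<Rightarrow> real) \<times> (nat \<times> nat \<Rightarrow> real) \<Rightarrow> real"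
    where "v n a = (\<Sum>j\<in>?J. \<beta> j * ((\<Sum>i<n. s n i a * snd a (i, j)) / sqrt (real n)))" for n a
  have s_meas: "s n i \<in> borel_measurable (design_space n)" if "i < n" for n i
    unfolding s_def using fst_component[OF that] by measurable
  have v_meas: "v n \<in> borel_measurable (design_space n)" for n
    unfolding v_def
    by (intro borel_measurable_sum borel_measurable_times borel_measurable_divide
        s_meas snd_component borel_measurable_const) auto
  have s_eq: "s n i (design n \<omega>) = 2 * T n i \<omega> - 1" if "i < n" "\<omega> \<in> space M" for n i \<omega>
    using T_01[OF that] that by (auto simp: s_def)
  have v_eq: "v n (design n \<omega>) = (\<Sum>j\<in>?J. \<beta> j * ((\<Sum>i<n. (2 * T n i \<omega> - 1) * x i j \<omega>) / sqrt (real n)))"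
    if "\<omega> \<in> space M" for n \<omega>
    unfolding v_def using s_eq[OF _ that]
    by (intro sum.cong refl arg_cong2[where f = "(*)"] arg_cong2[where f = "(/)"]) (auto simp del: restrict_apply, simp)
  have signed: "signed_noise \<beta> n \<omega> = v n (design n \<omega>) + (\<Sum>i<n. s n i (design n \<omega>) * eps i \<omega>) / sqrt (real n)"
    if "\<omega> \<in> space M" for n \<omega>
  proof -
    have "(\<Sum>i<n. (2 * T n i \<omega> - 1) * noise \<beta> i \<omega>)
        = (\<Sum>i<n. \<Sum>j\<in>?J. \<beta> j * ((2 * T n i \<omega> - 1) * x i j \<omega>)) + (\<Sum>i<n. (2 * T n i \<omega> - 1) * eps i \<omega>)"
      by (simp add: noise_def distrib_left sum.distrib sum_distrib_left mult.left_commute)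
    also have "(\<Sum>i<n. \<Sum>j\<in>?J. \<beta> j * ((2 * T n i \<omega> - 1) * x i j \<omega>))
        = (\<Sum>j\<in>?J. \<beta> j * (\<Sum>i<n. (2 * T n i \<omega> - 1) * x i j \<omega>))"
      by (subst sum.swap) (simp add: sum_distrib_left)
    finally have "signed_noise \<beta> n \<omega> = (\<Sum>j\<in>?J. \<beta> j * ((\<Sum>i<n. (2 * T n i \<omega> - 1) * x i j \<omega>) / sqrt (real n)))
        + (\<Sum>i<n. (2 * T n i \<omega> - 1) * eps i \<omega>) / sqrt (real n)"
      by (simp only: signed_noise_def add_divide_distrib sum_divide_distrib[of _ ?J] times_divide_eq_right)
    also have "(\<Sum>i<n. (2 * T n i \<omega> - 1) * eps i \<omega>) = (\<Sum>i<n. s n i (design n \<omega>) * eps i \<omega>)"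
      using s_eq[OF _ that] by (intro sum.cong refl) simp
    finally show ?thesis unfolding v_eq[OF that] .
  qed
  have "(\<lambda>n. char (distr M borel (\<lambda>\<omega>. \<Sum>j\<in>?J. \<beta> j * ((\<Sum>i<n. (2 * T n i \<omega> - 1) * x i j \<omega>) / sqrt (real n)))) t)
      \<longlonglongrightarrow> char (distr P borel (\<lambda>u. \<Sum>j\<in>?J. \<beta> j * \<xi> j u)) t"
  proof (rule char_linear_form_tendsto[where Y = "\<lambda>n j \<omega>. (\<Sum>i<n. (2 * T n i \<omega> - 1) * x i j \<omega>) / sqrt (real n)",
        OF prob_space_axioms P.prob_space_axioms _ _ _ _ covariate_balance])
    show "(\<lambda>\<omega>. (\<Sum>i<n. (2 * T n i \<omega> - 1) * x i j \<omega>) / sqrt (real n)) \<in> borel_measurable M"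
      if "j \<in> {..<p + q}" for n j
      using that T_meas by (intro borel_measurable_divide borel_measurable_sum borel_measurable_times
          borel_measurable_diff) auto
    show "\<xi> j \<in> borel_measurable P" if "j \<in> {..<p + q}" for j
      using that xi_integrable by auto
  qed auto
  moreover have "distr M borel (\<lambda>\<omega>. \<Sum>j\<in>?J. \<beta> j * ((\<Sum>i<n. (2 * T n i \<omega> - 1) * x i j \<omega>) / sqrt (real n)))
      = distr M borel (\<lambda>\<omega>. v n (design n \<omega>))" for n
    by (intro distr_cong refl v_eq[symmetric])
  ultimately have lim: "(\<lambda>n. char (distr M borel (\<lambda>\<omega>. v n (design n \<omega>))) t)
      \<longlonglongrightarrow> char (distr P borel (\<lambda>u. \<Sum>j\<in>?J. \<beta> j * \<xi> j u)) t"
    by (simp only:)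
  have "\<bar>s n i a\<bar> = 1" for n i a by (simp add: s_def)
  from char_signed_sum_tendsto[where v = v and s = s and U = design and A = design_space,
      OF design_indep_eps eps_indep eps_ident eps_square eps_mean eps_var v_meas s_meas this lim]
  have "(\<lambda>n. char (distr M borel
      (\<lambda>\<omega>. v n (design n \<omega>) + (\<Sum>i<n. s n i (design n \<omega>) * eps i \<omega>) / sqrt (real n))) t)
    \<longlonglongrightarrow> of_real (exp (- (t\<^sup>2 * \<sigma>\<^sup>2 / 2))) * char (distr P borel (\<lambda>u. \<Sum>j\<in>?J. \<beta> j * \<xi> j u)) t" .
  moreover have "distr M borel (signed_noise \<beta> n) = distr M borel
      (\<lambda>\<omega>. v n (design n \<omega>) + (\<Sum>i<n. s n i (design n \<omega>) * eps i \<omega>) / sqrt (real n))" for n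
    by (intro distr_cong refl signed)
  ultimately show ?thesis by (simp only:)
qed

text \<open>Levy's continuity theorem reduces the claim to matching characteristic functions. The
  limit found for the statistic is a Gaussian factor times that of the omitted-covariate form, and
  the independence of \<open>Z\<close> makes the target factorize in the same way.\<close>

theorem test_stat_weak_conv:
  fixes S :: "nat \<Rightarrow> 'w \<Rightarrow> real" and mu1 mu2 :: "nat \<Rightarrow> real" and Z :: "'u \<Rightarrow> real"
  assumes S_meas[measurable]: "\<And>n. S n \<in> borel_measurable M"
    and S: "\<And>n \<omega>. \<omega> \<in> space M \<Longrightarrow> invertible_mat (gram (regression_matrix n \<omega>)) \<Longrightarrow>
      S n \<omega> = test_stat (regression_matrix n \<omega>)
        (Matrix.vec n (\<lambda>i. outcome (mu1 n) (mu2 n) \<beta> (p + q) (T n i \<omega>) (\<lambda>j. x i j \<omega>) (eps i \<omega>)))"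
    and mu: "\<And>n. 1 \<le> n \<Longrightarrow> mu1 n - mu2 n = \<delta> / sqrt (real n)"
    and Z: "distributed P lborel Z std_normal_density"
    and Z_indep: "indep_rv P borel Z (real_vec_space {p..<p + q}) (random_vec {p..<p + q} \<xi>)"
  shows "weak_conv_m (\<lambda>n. distr M borel (S n))
    (distr P borel (\<lambda>u. \<sigma> / noise_sd \<beta> * Z u + 1 / noise_sd \<beta> * (\<Sum>j = p..<p + q. \<beta> j * \<xi> j u)
      + 1 / noise_sd \<beta> * \<delta> / 2))"
proof (rule levy_continuity)
  let ?s = "noise_sd \<beta>" and ?L = "\<lambda>u. \<Sum>j = p..<p + q. \<beta> j * \<xi> j u"
  have xi_meas[measurable]: "\<xi> j \<in> borel_measurable P" if "j < p + q" for j
    using xi_integrable[OF that] by auto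
  have [measurable]: "?L \<in> borel_measurable P"
    by (intro borel_measurable_sum borel_measurable_times) auto
  have Z_meas[measurable]: "Z \<in> borel_measurable P"
    using distributed_measurable[OF Z] by simp
  have T_meas'[measurable]: "signed_noise \<beta> n \<in> borel_measurable M" for n
    unfolding signed_noise_def noise_def
    using T_meas by (intro borel_measurable_divide borel_measurable_sum borel_measurable_times
        borel_measurable_diff borel_measurable_add) auto
  show "real_distribution (distr M borel (S n))" for n by simp
  show "real_distribution (distr P borel (\<lambda>u. \<sigma> / ?s * Z u + 1 / ?s * ?L u + 1 / ?s * \<delta> / 2))"
    by (rule P.real_distribution_distr) measurable
  fix t
  let ?lim = "iexp (t * (\<delta> / (2 * ?s))) * (of_real (exp (- ((1 / ?s * t)\<^sup>2 * \<sigma>\<^sup>2 / 2)))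
      * char (distr P borel ?L) (1 / ?s * t))"
  have "(\<lambda>n. char (distr M borel (S n)) t) \<longlonglongrightarrow> ?lim"
  proof (rule char_tendsto_of_diff_in_probability[
        where S' = "\<lambda>n \<omega>. \<delta> / (2 * ?s) + 1 / ?s * signed_noise \<beta> n \<omega>"])
    show "((\<lambda>z. S (fst z) (snd z) - (\<delta> / (2 * ?s) + 1 / ?s * signed_noise \<beta> (fst z) (snd z))) \<longlongrightarrow> 0)
        (in_probability M)"
      by (rule test_stat_linearization[OF S mu])
    show "(\<lambda>n. char (distr M borel (\<lambda>\<omega>. \<delta> / (2 * ?s) + 1 / ?s * signed_noise \<beta> n \<omega>)) t) \<longlonglongrightarrow> ?lim"
      unfolding char_affine[OF T_meas'] by (intro tendsto_mult tendsto_const char_signed_noise_tendsto)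
  qed measurable
  also have "?lim = char (distr P borel (\<lambda>u. \<sigma> / ?s * Z u + 1 / ?s * ?L u + 1 / ?s * \<delta> / 2)) t"
  proof -
    have lin: "(\<lambda>y. \<delta> / (2 * ?s) + 1 / ?s * (\<Sum>j = p..<p + q. \<beta> j * y j)) \<in> borel_measurable (real_vec_space {p..<p + q})"
      by (intro borel_measurable_add borel_measurable_times borel_measurable_sum coordinate_meas
          borel_measurable_const) auto
    \<comment> \<open>The shift is grouped with the covariate form, so that only two independent
      summands occur and \<open>char_affine\<close> extracts the shift as a phase.\<close>
    have "P.indep_var borel (\<lambda>u. \<sigma> / ?s * Z u) borel (\<lambda>u. \<delta> / (2 * ?s) + 1 / ?s * ?L u)"
      using P.indep_rv_compose[OF Z_indep _ lin, of "\<lambda>y. \<sigma> / ?s * y" borel] by (simp cong: sum.cong_simp)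
    from P.char_distr_add[OF this, of t]
    have "char (distr P borel (\<lambda>u. \<sigma> / ?s * Z u + (\<delta> / (2 * ?s) + 1 / ?s * ?L u))) t
        = char (distr P borel (\<lambda>u. 0 + \<sigma> / ?s * Z u)) t
          * char (distr P borel (\<lambda>u. \<delta> / (2 * ?s) + 1 / ?s * ?L u)) t" by simp
    also have "char (distr P borel (\<lambda>u. 0 + \<sigma> / ?s * Z u)) t = char std_normal_distribution (\<sigma> / ?s * t)"
    proof -
      have "distr P borel Z = std_normal_distribution"
        using distributed_distr_eq_density[OF Z] by (simp add: distr_def)
      then show ?thesis by (subst P.char_affine) simp_all
    qed
    also have "char std_normal_distribution (\<sigma> / ?s * t) = of_real (exp (- ((1 / ?s * t)\<^sup>2 * \<sigma>\<^sup>2 / 2)))"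
      unfolding char_std_normal_distribution by (simp add: power_mult_distrib power_divide mult_ac)
    also have "char (distr P borel (\<lambda>u. \<delta> / (2 * ?s) + 1 / ?s * ?L u)) t
        = iexp (t * (\<delta> / (2 * ?s))) * char (distr P borel ?L) (1 / ?s * t)"
      by (rule P.char_affine) measurable
    finally have "char (distr P borel (\<lambda>u. \<sigma> / ?s * Z u + (\<delta> / (2 * ?s) + 1 / ?s * ?L u))) t = ?lim"
      by (simp only: mult_ac)
    moreover have "(\<lambda>u. \<sigma> / ?s * Z u + (\<delta> / (2 * ?s) + 1 / ?s * ?L u))
        = (\<lambda>u. \<sigma> / ?s * Z u + 1 / ?s * ?L u + 1 / ?s * \<delta> / 2)"
      by (auto simp: field_simps)
    ultimately show ?thesis by simp
  qed
  finally show "(\<lambda>n. char (distr M borel (S n)) t)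
      \<longlonglongrightarrow> char (distr P borel (\<lambda>u. \<sigma> / ?s * Z u + 1 / ?s * ?L u + 1 / ?s * \<delta> / 2)) t" .
qed

end

theorem theorem3p3:
  fixes p q :: nat
    and M :: "'w measure" and N :: "'v measure" and P :: "'u measure"
    and X :: "nat \<Rightarrow> 'v \<Rightarrow> real"
    and x :: "nat \<Rightarrow> nat \<Rightarrow> 'w \<Rightarrow> real"
    and T :: "nat \<Rightarrow> nat \<Rightarrow> 'w \<Rightarrow> real"
    and eps :: "nat \<Rightarrow> 'w \<Rightarrow> real"
    and \<beta> :: "nat \<Rightarrow> real"
    and mu1 mu2 :: "nat \<Rightarrow> real"
    and \<sigma>_eps \<sigma>_w lam1 lam2 :: real
    and S :: "nat \<Rightarrow> 'w \<Rightarrow> real"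
    and \<xi> :: "nat \<Rightarrow> 'u \<Rightarrow> real"
    and Z :: "'u \<Rightarrow> real"
  assumes "prob_space M" and "prob_space N" and "prob_space P"
    \<comment> \<open>the covariates \<open>X\<^sub>1, \<dots>, X\<^sub>p\<^sub>+\<^sub>q\<close>\<close>
    and "prob_space.indep_vars N (\<lambda>_. borel) X {..<p + q}"
    and "\<And>j. j < p + q \<Longrightarrow> integrable N (\<lambda>v. (X j v)\<^sup>2)"
    and "\<And>j. j < p + q \<Longrightarrow> prob_space.expectation N (X j) = 0"
    and "\<And>j. j < p + q \<Longrightarrow> 0 < prob_space.variance N (X j)"
    \<comment> \<open>the covariate vectors of the units are i.i.d. copies of them\<close>
    and "prob_space.indep_vars M (\<lambda>_. real_vec_space {..<p + q})
           (\<lambda>i. random_vec {..<p + q} (x i)) UNIV"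
    and "\<And>i. distr M (real_vec_space {..<p + q}) (random_vec {..<p + q} (x i)) =
             distr N (real_vec_space {..<p + q}) (random_vec {..<p + q} X)"
    \<comment> \<open>i.i.d. errors\<close>
    and "prob_space.indep_vars M (\<lambda>_. borel) eps UNIV"
    and "\<And>i. distr M borel (eps i) = distr M borel (eps 0)"
    and "\<And>i. integrable M (\<lambda>\<omega>. (eps i \<omega>)\<^sup>2)"
    and "\<And>i. prob_space.expectation M (eps i) = 0"
    and "\<And>i. prob_space.variance M (eps i) = \<sigma>_eps\<^sup>2" and "0 < \<sigma>_eps"
    \<comment> \<open>treatment assignments\<close>
    and "\<And>n i. i < n \<Longrightarrow> T n i \<in> borel_measurable M"
    and "\<And>n i \<omega>. i < n \<Longrightarrow> \<omega> \<in> space M \<Longrightarrow> T n i \<omega> \<in> {0, 1}"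
    and "\<And>n. indep_rv M
           (real_vec_space {..<n} \<Otimes>\<^sub>M real_vec_space ({..<n} \<times> {..<p + q}))
           (\<lambda>\<omega>. (random_vec {..<n} (T n) \<omega>,
                  random_vec ({..<n} \<times> {..<p + q}) (\<lambda>(i, j). x i j) \<omega>))
           (real_vec_space {..<n})
           (random_vec {..<n} eps)"
    \<comment> \<open>\<open>S\<close> is the test statistic, arbitrary where \<open>G\<^sup>t G\<close> is singular\<close>
    and "\<And>n. S n \<in> borel_measurable M"
    and "\<And>n \<omega>. let G = design_matrix n p (\<lambda>i. T n i \<omega>) (\<lambda>i j. x i j \<omega>);
                      Y = Matrix.vec n (\<lambda>i. outcome (mu1 n) (mu2 n) \<beta> (p + q)
                            (T n i \<omega>) (\<lambda>j. x i j \<omega>) (eps i \<omega>))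
                  in \<omega> \<in> space M \<longrightarrow> invertible_mat (gram G) \<longrightarrow> S n \<omega> = test_stat G Y"
    and "\<sigma>_w = sqrt (\<sigma>_eps\<^sup>2 + (\<Sum>j = p..<p + q. (\<beta> j)\<^sup>2 * prob_space.variance N (X j)))"
    and "lam1 = \<sigma>_eps / \<sigma>_w" and "lam2 = 1 / \<sigma>_w"
    \<comment> \<open>(A1) global balance\<close>
    and "conv_in_prob M (\<lambda>n \<omega>. (\<Sum>i<n. 2 * T n i \<omega> - 1) / real n) 0"
    \<comment> \<open>(A2) covariate balance\<close>
    and "\<And>j. j < p + q \<Longrightarrow> integrable P (\<xi> j)"
    and "\<And>j. j < p + q \<Longrightarrow> prob_space.expectation P (\<xi> j) = 0"
    and "weak_conv_vec {..<p + q}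
           (\<lambda>n. distr M (real_vec_space {..<p + q})
              (random_vec {..<p + q} (\<lambda>j \<omega>. (\<Sum>i<n. (2 * T n i \<omega> - 1) * x i j \<omega>) / sqrt (real n))))
           (distr P (real_vec_space {..<p + q}) (random_vec {..<p + q} \<xi>))"
    and "distributed P lborel Z std_normal_density"
    and "indep_rv P borel Z
           (real_vec_space {p..<p + q}) (random_vec {p..<p + q} \<xi>)"
  shows "((\<forall>n. mu1 n - mu2 n = 0) \<longrightarrow>
           weak_conv_m (\<lambda>n. distr M borel (S n))
             (distr P borel (\<lambda>u. lam1 * Z u + lam2 * (\<Sum>j = p..<p + q. \<beta> j * \<xi> j u)))) \<and>
         (\<forall>\<delta>. \<delta> \<noteq> 0 \<longrightarrow> (\<forall>n\<ge>1. mu1 n - mu2 n = \<delta> / sqrt (real n)) \<longrightarrow>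
           weak_conv_m (\<lambda>n. distr M borel (S n))
             (distr P borel (\<lambda>u. lam1 * Z u + lam2 * (\<Sum>j = p..<p + q. \<beta> j * \<xi> j u) + lam2 * \<delta> / 2)))"
proof -
  interpret E: covariate_adaptive_experiment M N P p q X x T eps \<sigma>_eps \<xi>
    by (intro covariate_adaptive_experiment.intro covariate_adaptive_experiment_axioms.intro) (fact assms)+
  have sigma: "\<sigma>_w = E.noise_sd \<beta>"
    using assms(21) by (simp only: E.noise_sd_def E.var_X_def)
  have S_eq: "S n \<omega> = test_stat (design_matrix n p (\<lambda>i. T n i \<omega>) (\<lambda>i j. x i j \<omega>))
      (Matrix.vec n (\<lambda>i. outcome (mu1 n) (mu2 n) \<beta> (p + q) (T n i \<omega>) (\<lambda>j. x i j \<omega>) (eps i \<omega>)))"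
    if "\<omega> \<in> space M" "invertible_mat (gram (design_matrix n p (\<lambda>i. T n i \<omega>) (\<lambda>i j. x i j \<omega>)))" for n \<omega>
    using assms(20)[of n \<omega>] that by (simp add: Let_def)
  \<comment> \<open>Here \<delta> is arbitrary: \<open>\<delta> = 0\<close> is the null hypothesis,
    where the shift disappears, and the other values are the local alternatives.\<close>
  have conv: "weak_conv_m (\<lambda>n. distr M borel (S n))
      (distr P borel (\<lambda>u. lam1 * Z u + lam2 * (\<Sum>j = p..<p + q. \<beta> j * \<xi> j u) + lam2 * \<delta> / 2))"
    if mu: "\<And>n. 1 \<le> n \<Longrightarrow> mu1 n - mu2 n = \<delta> / sqrt (real n)" for \<delta>
    unfolding \<open>lam1 = \<sigma>_eps / \<sigma>_w\<close> \<open>lam2 = 1 / \<sigma>_w\<close> sigma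
    by (rule E.test_stat_weak_conv[OF assms(19) _ _ assms(28,29)]) (rule S_eq mu, assumption+)+
  show ?thesis using conv[of 0] conv by simp
qed

end
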